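(* In dimensionless units $m=l=g=1$, let $\mathcal H(J_1,J_2)$ be the Birkhoff normal form of the spherical pendulum Hamiltonian at its focus-focus point, i.e. $$ \begin{aligned} \mathcal H(J_1,J_2)={}&J_1+\tfrac1{16}(J_1^2+3J_2^2)-\tfrac1{256}J_1(J_1^2+9J_2^2)+\tfrac1{8192}(5J_1^4+102J_1^2J_2^2+33J_2^4)\\ &-\tfrac3{262144}J_1(11J_1^4+410J_1^2J_2^2+271J_2^4)+\cdots, \end{aligned} $$ and let $J_1(h,j_2)$ be the complete elliptic integral $$J_1(h,j_2)=\frac1{2\pi \mathrm i}\oint_{\alpha}\frac{w}{1-\zeta^2}\,d\zeta,\qquad w^2=P(\zeta)=2(1-\zeta^2)(h+1-\zeta)-j_2^2 ,$$ over the cycle $\alpha$ vanishing at the focus-focus equilibrium. Then the Birkhoff normal form is the inverse of $J_1(h,j_2)$ with respect to its first argument: $$\mathcal H\bigl(J_1(h,j_2),\,j_2\bigr)=h$$ for $(h,j_2)$ near $(0,0)$.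
   Context: Spherical pendulum in dimensionless units: phase space $T^*S^2=\{(\mathbf r,\mathbf p)\in\mathbb R^3\times\mathbb R^3: \|\mathbf r\|=1,\ (\mathbf r,\mathbf p)=0\}$ with the symplectic form induced by $d\mathbf r\wedge d\mathbf p$, $H=\frac12\|\mathbf r\times\mathbf p\|^2+z-1$, second integral $L_z=xp_y-yp_x$. In spherical coordinates with $\theta$ measured from the north pole, $H=\frac12\left(p_\theta^2+p_\phi^2/\sin^2\theta\right)+\cos\theta-1$ with $p_\phi=L_z=j_2$. The unstable equilibrium is $\mathbf r=(0,0,1)$, $\mathbf p=0$, with $H=0$. Birkhoff normal form: there are symplectic coordinates $(q_1,q_2,p_1,p_2)$ near this equilibrium (centred at it) in which $L_z=J_2$ and $H=\mathcal H(J_1,J_2)$, where $J_1=q_1p_1+q_2p_2$, $J_2=q_1p_2-q_2p_1$, and $\mathcal H=J_1+O(2)$. The elliptic integral: with $\zeta=\cos\theta$ the differential $p_\theta\,d\theta$ becomes (up to sign) $\frac{w}{1-\zeta^2}d\zeta$ on the curve $w^2=P(\zeta)$. For $(h,j_2)$ near $(0,0)$ the roots of $P$ satisfy $-1\le\zeta_0\le\zeta_1\le1\le\zeta_2$, with $\zeta_1,\zeta_2\to1$ as $(h,j_2)\to(0,0)$. The cycle $\alpha$ goes twice, in the $\zeta$-plane, around the interval $[\zeta_1,\zeta_2]$ (e.g. twice counterclockwise along a small fixed circle around $\zeta=1$ enclosing $\zeta_1,\zeta_2$ and $\zeta=1$), with the branch of $w$ that tends to $(\zeta-1)\sqrt{2(\zeta+1)}$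 as $(h,j_2)\to(0,0)$, so that $J_1(h,j_2)=h+O(2)$. *)

theory Defs
  imports
    "HOL-Complex_Analysis.Complex_Analysis"
    "HOL-Analysis.Cross3"
    "HOL-Library.Landau_Symbols"
begin

text \<open>
  A function is real analytic on a set if around each point of the set it is the sum of a
  convergent multivariate power series.  A multi-index is a function \<open>k\<close> from the
  standard basis to the natural numbers.
\<close>

definition real_analytic_on :: "('a::euclidean_space \<Rightarrow> 'b::real_normed_vector) \<Rightarrow> 'a set \<Rightarrow> bool"
  where "real_analytic_on f S \<longleftrightarrow>
    (\<forall>x\<in>S. \<exists>r>0. \<exists>c. \<forall>y\<in>ball x r.
      ((\<lambda>k. (\<Prod>b\<in>Basis. ((y - x) \<bullet> b) ^ k b) *\<^sub>R c k) has_sum f y) (Basis \<rightarrow>\<^sub>E (UNIV :: nat set)))"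


text \<open>
  Points of the ambient space of the pendulum are pairs \<open>(r, p)\<close>, points of the normal form
  space are pairs \<open>(q, p)\<close>; the form below is \<open>dr \<and> dp\<close>, respectively
  \<open>dq\<^sub>1 \<and> dp\<^sub>1 + dq\<^sub>2 \<and> dp\<^sub>2\<close>.
\<close>

definition symplectic_form :: "('a::real_inner) \<times> 'a \<Rightarrow> 'a \<times> 'a \<Rightarrow> real"
  where "symplectic_form u v = fst u \<bullet> snd v - snd u \<bullet> fst v"

definition phase_space :: "((real^3) \<times> (real^3)) set"
  where "phase_space = {(r, p). norm r = 1 \<and> r \<bullet> p = 0}"

definition pendulum_H :: "(real^3) \<times> (real^3) \<Rightarrow> real"
  where "pendulum_H = (\<lambda>(r, p). (norm (cross3 r p))\<^sup>2 / 2 + r$3 - 1)"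

definition pendulum_Lz :: "(real^3) \<times> (real^3) \<Rightarrow> real"
  where "pendulum_Lz = (\<lambda>(r, p). r$1 * p$2 - r$2 * p$1)"

definition unstable_equilibrium :: "(real^3) \<times> (real^3)"
  where "unstable_equilibrium = (vector [0, 0, 1], 0)"

definition BNF_J1 :: "(real^2) \<times> (real^2) \<Rightarrow> real"
  where "BNF_J1 = (\<lambda>(q, p). q$1 * p$1 + q$2 * p$2)"

definition BNF_J2 :: "(real^2) \<times> (real^2) \<Rightarrow> real"
  where "BNF_J2 = (\<lambda>(q, p). q$1 * p$2 - q$2 * p$1)"


text \<open>
  Symplectic coordinates centred at the unstable equilibrium, given through their inverse: \<open>\<Phi>\<close>
  maps an open neighbourhood \<open>U\<close> of the origin of the \<open>(q, p)\<close>-space homeomorphically and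
  analytically onto an open subset of the phase space.  Its derivative is injective because it
  pulls the symplectic form back to a nondegenerate one, so that the coordinates are analytic
  as well.
\<close>

definition symplectic_coordinates ::
  "((real^2) \<times> (real^2)) set \<Rightarrow> ((real^2) \<times> (real^2) \<Rightarrow> (real^3) \<times> (real^3)) \<Rightarrow> bool"
  where "symplectic_coordinates U \<Phi> \<longleftrightarrow>
    open U \<and> 0 \<in> U \<and> \<Phi> 0 = unstable_equilibrium \<and>
    real_analytic_on \<Phi> U \<and>
    openin (top_of_set phase_space) (\<Phi> ` U) \<and>
    (\<exists>\<Psi>. homeomorphism U (\<Phi> ` U) \<Phi> \<Psi>) \<and>
    (\<forall>x\<in>U. \<forall>u v. symplectic_form (frechet_derivative \<Phi> (at x) u) (frechet_derivative \<Phi> (at x) v)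
       = symplectic_form u v)"

text \<open>
  Only the germ of \<open>\<H>\<close> at the origin matters.  Analyticity is essential: in the smooth
  category \<open>\<H>\<close> would be determined only up to a flat function.
\<close>

definition birkhoff_normal_form :: "(real \<Rightarrow> real \<Rightarrow> real) \<Rightarrow> bool"
  where "birkhoff_normal_form \<H> \<longleftrightarrow>
    real_analytic_on (\<lambda>(a, b). \<H> a b) {(0, 0)} \<and>
    (\<lambda>(a, b). \<H> a b - a) \<in> O[nhds (0, 0)](\<lambda>z. norm z ^ 2) \<and>
    (\<exists>U \<Phi>. symplectic_coordinates U \<Phi> \<and>
      (\<forall>x\<in>U. pendulum_Lz (\<Phi> x) = BNF_J2 x \<and> pendulum_H (\<Phi> x) = \<H> (BNF_J1 x) (BNF_J2 x)))"


definition pendulum_P :: "real \<Rightarrow> real \<Rightarrow> complex \<Rightarrow> complex"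
  where "pendulum_P h j \<zeta> = 2 * (1 - \<zeta>\<^sup>2) * (of_real h + 1 - \<zeta>) - (of_real j)\<^sup>2"

text \<open>
  \<open>w h j\<close> is the branch of the square root of \<open>P\<close> along the circle of radius \<open>\<rho>\<close> around 1.
  For \<open>\<rho> < 2\<close> the point \<open>\<zeta> + 1\<close> stays in the right half plane, where the principal square
  root is continuous.
\<close>

definition vanishing_cycle_branch :: "real \<Rightarrow> (real \<Rightarrow> real \<Rightarrow> complex \<Rightarrow> complex) \<Rightarrow> bool"
  where "vanishing_cycle_branch \<rho> w \<longleftrightarrow>
    (\<forall>\<^sub>F (h, j) in nhds (0, 0).
       continuous_on (sphere 1 \<rho>) (w h j) \<and> (\<forall>\<zeta>\<in>sphere 1 \<rho>. (w h j \<zeta>)\<^sup>2 = pendulum_P h j \<zeta>)) \<and>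
    (\<forall>\<zeta>\<in>sphere 1 \<rho>. ((\<lambda>(h, j). w h j \<zeta>) \<longlongrightarrow> (\<zeta> - 1) * csqrt (2 * (\<zeta> + 1))) (nhds (0, 0)))"

definition vanishing_cycle :: "real \<Rightarrow> real \<Rightarrow> complex"
  where "vanishing_cycle \<rho> = circlepath 1 \<rho> +++ circlepath 1 \<rho>"

definition elliptic_J1 ::
  "real \<Rightarrow> (real \<Rightarrow> real \<Rightarrow> complex \<Rightarrow> complex) \<Rightarrow> real \<Rightarrow> real \<Rightarrow> complex"
  where "elliptic_J1 \<rho> w h j =
    1 / (2 * of_real pi * \<i>) * contour_integral (vanishing_cycle \<rho>) (\<lambda>\<zeta>. w h j \<zeta> / (1 - \<zeta>\<^sup>2))"

end

theory Submission imports Defs begin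

text \<open>
  The flow of \<open>J\<^sub>1\<close> in the normal form coordinates is \<open>(q, p) \<mapsto> (e\<^sup>s q, e\<^sup>-\<^sup>s p)\<close>.  In complex
  time it has period \<open>2 \<pi> \<i>\<close>, and this imaginary period is what the elliptic integral measures.  Write
  \<open>t = e\<^sup>s\<close>, \<open>A = \<partial>\<H>/\<partial>J\<^sub>1\<close>, \<open>B = \<partial>\<H>/\<partial>J\<^sub>2\<close>.  The field of the pendulum is \<open>A\<close> times the field of
  \<open>J\<^sub>1\<close> plus \<open>B\<close> times the rotation about the vertical (lemma \<open>first_action_flow\<close>).  Hence the height
  \<open>z(t)\<close> along an orbit of \<open>J\<^sub>1\<close> with \<open>J\<^sub>1 = a\<close>, \<open>J\<^sub>2 = b\<close> satisfies \<open>(A t z')\<^sup>2 = P(z)\<close> with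
  \<open>h = \<H>(a, b)\<close>, \<open>j\<^sub>2 = b\<close>, so that \<open>z\<close> carries the circle \<open>|t| = R\<close> to a closed loop on the curve
  \<open>w\<^sup>2 = P(\<zeta>)\<close>, with \<open>w = A t z'\<close>.

  The orbits used here start at \<open>q = (t, 0)\<close>, \<open>p = (a, b) / t\<close>: for small \<open>a\<close>, \<open>b\<close> and fixed \<open>|t|\<close> they
  stay near the unstable manifold and away from the equilibrium.  Thus only the
  restriction of the coordinates to a slice has to be complexified
  (\<open>real_analytic_complexification\<close>), and all relations pass from real to complex \<open>t\<close> by the identity
  theorem (\<open>complex_orbit_identities\<close>).  For \<open>a = b = 0\<close> the function \<open>z - 1\<close> has a double zero at
  \<open>t = 0\<close> (\<open>separatrix_double_zero\<close>), so the loop winds twice around \<open>\<zeta> = 1\<close>; small \<open>a\<close>, \<open>b\<close> do not change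
  the winding number.  So the loop is the vanishing cycle.

  Let \<open>K(h, j)\<close> be the elliptic integral.  Its partial derivatives are the integrals of
  \<open>1/w\<close> and \<open>-j/((1 - \<zeta>\<^sup>2) w)\<close> over the cycle, divided by \<open>2 \<pi> \<i>\<close>.  On the loop \<open>d\<zeta>/w = dt/(A t)\<close>, so
  \<open>\<partial>K/\<partial>h = 1/A\<close>.  The equation for the angle about the vertical axis turns the second integrand into
  \<open>-B/(A t)\<close> plus an angular form, which integrates to zero because \<open>x + \<i> y\<close> and \<open>x - \<i> y\<close> wind equally
  often around \<open>0\<close>; so \<open>\<partial>K/\<partial>j = -B/A\<close> (\<open>orbit_loop_slopes\<close>).  Therefore \<open>K(\<H>(a, b), b)\<close> has
  differential \<open>da\<close>, and it vanishes at the origin: \<open>K(\<H>(a, b), b) = a\<close>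
  (\<open>cycle_integral_normal_form\<close>).  Since \<open>\<H>(a, j)\<close> takes every small value \<open>h\<close>, the function \<open>\<H>\<close> inverts \<open>K\<close>.

  For the coefficients, expand the square root in \<open>K\<close> and evaluate the terms by residues at
  \<open>\<zeta> = 1\<close> (\<open>cycle_integral_taylor\<close>).  The polynomial in the theorem inverts the result up to terms of
  sixth order (\<open>cycle_taylor_birkhoff_polynomial\<close>), and \<open>K\<close> is bi-Lipschitz in \<open>h\<close>, so \<open>\<H>\<close> differs from that
  polynomial by terms of sixth order (\<open>H_taylor\<close>).
\<close>

(* Formal power series use the same infix symbol as the components of a vector. *)
unbundle no fps_syntax

section \<open>Real analytic functions\<close>

text \<open>
  Evaluating the series at the point of the ball with all coordinates equal to \<open>\<rho>\<close> bounds every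
  monomial at once, because unconditional and absolute convergence agree for real series.
\<close>

lemma real_analytic_majorant:
  fixes f :: "'a::euclidean_space \<Rightarrow> real"
  assumes "real_analytic_on f S" "x \<in> S"
  obtains r c \<rho> where "r > 0" "\<rho> > 0"
    "\<And>y. y \<in> ball x r \<Longrightarrow>
       ((\<lambda>k. (\<Prod>b\<in>Basis. ((y - x) \<bullet> b) ^ k b) * c k) has_sum f y) (Basis \<rightarrow>\<^sub>E (UNIV :: nat set))"
    "(\<lambda>k. \<rho> ^ (\<Sum>b\<in>Basis. k b) * \<bar>c k\<bar>) summable_on (Basis \<rightarrow>\<^sub>E (UNIV :: nat set))"
proof -
  obtain r c where r: "r > 0" and sum: "\<And>y. y \<in> ball x r \<Longrightarrow>
      ((\<lambda>k. (\<Prod>b\<in>Basis. ((y - x) \<bullet> b) ^ k b) *\<^sub>R c k) has_sum f y) (Basis \<rightarrow>\<^sub>E (UNIV :: nat set))"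
    using assms unfolding real_analytic_on_def by blast
  define \<rho> where "\<rho> = r / (2 * DIM('a))"
  have \<rho>: "\<rho> > 0" using r by (simp add: \<rho>_def)
  define y where "y = x + \<rho> *\<^sub>R (\<Sum>Basis)"
  have coord: "(y - x) \<bullet> b = \<rho>" if "b \<in> Basis" for b
    using that by (simp add: y_def inner_sum_left_Basis)
  have "norm (\<Sum>(Basis::'a set)) \<le> (\<Sum>b\<in>(Basis::'a set). 1)"
    by (intro sum_norm_le) auto
  then have "norm (y - x) \<le> \<rho> * DIM('a)"
    using \<rho> by (simp add: y_def mult_left_mono)
  also have "\<dots> < r" using r by (simp add: \<rho>_def)
  finally have "y \<in> ball x r" by (simp add: dist_norm norm_minus_commute)
  from has_sum_imp_summable[OF sum[OF this]]
  have "(\<lambda>k. (\<Prod>b\<in>Basis. ((y - x) \<bullet> b) ^ k b) * c k) summable_on (Basis \<rightarrow>\<^sub>E (UNIV :: nat set))"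
    by (simp only: real_scaleR_def)
  then have "(\<lambda>k. \<bar>(\<Prod>b\<in>Basis. ((y - x) \<bullet> b) ^ k b) * c k\<bar>) summable_on (Basis \<rightarrow>\<^sub>E (UNIV :: nat set))"
    by (subst (asm) summable_on_iff_abs_summable_on_real) (simp only: real_norm_def)
  moreover have "\<bar>(\<Prod>b\<in>Basis. ((y - x) \<bullet> b) ^ k b) * c k\<bar> = \<rho> ^ (\<Sum>b\<in>Basis. k b) * \<bar>c k\<bar>" for k
    using \<rho> coord by (simp add: abs_mult power_sum abs_prod power_abs)
  ultimately have "(\<lambda>k. \<rho> ^ (\<Sum>b\<in>Basis. k b) * \<bar>c k\<bar>) summable_on (Basis \<rightarrow>\<^sub>E (UNIV :: nat set))"
    by simp
  with that[of r \<rho> c] r \<rho> sum show ?thesis by simp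
qed

lemma has_derivative_zero_if_quadratic:
  fixes R :: "'a::real_normed_vector \<Rightarrow> 'b::real_normed_vector"
  assumes "e > 0" and R: "\<And>y. dist y x < e \<Longrightarrow> norm (R y) \<le> C * norm (y - x) ^ 2"
  shows "(R has_derivative (\<lambda>_. 0)) (at x)"
proof (rule has_derivativeI_sandwich[where e=e and H="\<lambda>y. C * norm (y - x)"])
  have R0: "R x = 0" using R[of x] assms(1) by simp
  show "norm (R y - R x - 0) / norm (y - x) \<le> C * norm (y - x)" if "y \<noteq> x" "dist y x < e" for y
  proof -
    have "norm (R y) / norm (y - x) \<le> (C * norm (y - x) ^ 2) / norm (y - x)"
      by (rule divide_right_mono[OF R[OF that(2)]]) simp
    then show ?thesis using that(1) by (simp add: R0 power2_eq_square)
  qed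
  have "((\<lambda>y. C * norm (y - x)) \<longlongrightarrow> C * norm (x - x)) (at x)"
    by (intro tendsto_intros)
  then show "((\<lambda>y. C * norm (y - x)) \<longlongrightarrow> 0) (at x)" by simp
qed (use \<open>e > 0\<close> in simp_all)

text \<open>
  The monomials of degree at most one form a finite sum; the majorant bounds the others by a
  multiple of the squared distance.
\<close>

lemma real_analytic_imp_differentiable_real:
  fixes f :: "'a::euclidean_space \<Rightarrow> real"
  assumes "real_analytic_on f S" "x \<in> S"
  shows "f differentiable (at x)"
proof -
  let ?I = "Basis \<rightarrow>\<^sub>E (UNIV :: nat set) :: ('a \<Rightarrow> nat) set"
  obtain r c \<rho> where r: "r > 0" "\<rho> > 0" and
    sum: "\<And>y. y \<in> ball x r \<Longrightarrow> ((\<lambda>k. (\<Prod>b\<in>Basis. ((y - x) \<bullet> b) ^ k b) * c k) has_sum f y) ?I"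
    and maj: "(\<lambda>k. \<rho> ^ (\<Sum>b\<in>Basis. k b) * \<bar>c k\<bar>) summable_on ?I"
    by (rule real_analytic_majorant[OF assms]) (rule that; assumption)
  define L where "L = {k\<in>?I. (\<Sum>b\<in>Basis. k b) \<le> 1}"
  define T where "T = (\<lambda>y k. (\<Prod>b\<in>Basis. ((y - x) \<bullet> b) ^ k b) * c k)"
  define R where "R = (\<lambda>y. f y - (\<Sum>k\<in>L. T y k))"
  define M where "M = infsum (\<lambda>k. \<rho> ^ (\<Sum>b\<in>Basis. k b) * \<bar>c k\<bar>) (?I - L)"
  have "L \<subseteq> Basis \<rightarrow>\<^sub>E {..1}"
  proof
    fix k assume k: "k \<in> L"
    have "k b \<le> 1" if "b \<in> Basis" for b
      using member_le_sum[of b Basis k] that k by (auto simp: L_def)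
    with k show "k \<in> Basis \<rightarrow>\<^sub>E {..1}"
      by (auto simp: L_def PiE_iff)
  qed
  then have finL: "finite L"
    by (rule finite_subset) (auto intro: finite_PiE)
  have maj': "(\<lambda>k. \<rho> ^ (\<Sum>b\<in>Basis. k b) * \<bar>c k\<bar>) summable_on (?I - L)"
    by (rule summable_on_subset_banach[OF maj Diff_subset])
  have R: "norm (R y) \<le> M / \<rho> ^ 2 * norm (y - x) ^ 2" if y: "dist y x < min r \<rho>" for y
  proof -
    let ?d = "norm (y - x) / \<rho>"
    have d: "0 \<le> ?d" "?d \<le> 1" using y r by (auto simp: dist_norm)
    have "(T y has_sum f y) ?I"
      unfolding T_def using y sum[of y] by (simp add: dist_commute)
    then have sR: "(T y has_sum R y) (?I - L)"
      unfolding R_def using has_sum_finite[OF finL] by (intro has_sum_Diff) (auto simp: L_def)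
    have bound: "norm (T y k) \<le> ?d^2 * (\<rho> ^ (\<Sum>b\<in>Basis. k b) * \<bar>c k\<bar>)" if k: "k \<in> ?I - L" for k
    proof -
      let ?n = "\<Sum>b\<in>Basis. k b"
      have n: "2 \<le> ?n" using k by (auto simp: L_def)
      have "(\<Prod>b\<in>Basis. \<bar>(y - x) \<bullet> b\<bar> ^ k b) \<le> (\<Prod>b\<in>Basis. norm (y - x) ^ k b)"
        by (intro prod_mono conjI power_mono) (auto simp: Basis_le_norm)
      also have "\<dots> = norm (y - x) ^ ?n" by (simp add: power_sum)
      also have "\<dots> = ?d ^ ?n * \<rho> ^ ?n" using r by (simp add: power_divide)
      also have "\<dots> \<le> ?d ^ 2 * \<rho> ^ ?n"
        using d n r by (intro mult_right_mono power_decreasing) auto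
      finally show ?thesis
        unfolding T_def by (simp add: abs_mult abs_prod power_abs mult_right_mono flip: mult.assoc)
    qed
    have sb: "(\<lambda>k. ?d^2 * (\<rho> ^ (\<Sum>b\<in>Basis. k b) * \<bar>c k\<bar>)) summable_on (?I - L)"
      by (rule summable_on_cmult_right[OF maj'])
    have abs: "(\<lambda>k. norm (T y k)) summable_on (?I - L)"
      by (rule summable_on_comparison_test[OF sb]) (use bound in auto)
    have "norm (R y) \<le> infsum (\<lambda>k. norm (T y k)) (?I - L)"
      using norm_has_sum_bound[OF has_sum_infsum[OF abs] sR] .
    also have "\<dots> \<le> infsum (\<lambda>k. ?d^2 * (\<rho> ^ (\<Sum>b\<in>Basis. k b) * \<bar>c k\<bar>)) (?I - L)"
      by (rule infsum_mono[OF abs sb bound])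
    also have "\<dots> = ?d^2 * M" unfolding M_def by (rule infsum_cmult_right[OF maj'])
    finally show ?thesis by (simp add: field_simps)
  qed
  have dR: "R differentiable (at x)"
    by (rule differentiableI[OF has_derivative_zero_if_quadratic[of "min r \<rho>", OF _ R]]) (use r in simp_all)
  have "(\<lambda>y. \<Sum>k\<in>L. T y k) differentiable (at x)"
  proof -
    have "(\<lambda>y. ((y - x) \<bullet> b) ^ n) differentiable (at x)" for b n
      by (intro differentiable_power differentiable_inner differentiable_diff
          differentiable_ident differentiable_const)
    then obtain D where D: "\<And>b n. ((\<lambda>y. ((y - x) \<bullet> b) ^ n) has_derivative D b n) (at x)"
      unfolding differentiable_def by metis
    have "(\<lambda>y. T y k) differentiable (at x)" for k
      unfolding T_def
      by (intro differentiable_mult differentiable_const)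
         (rule differentiableI[OF has_derivative_prod[OF D]])
    then show ?thesis using finL by (intro differentiable_sum) auto
  qed
  then have "(\<lambda>y. R y + (\<Sum>k\<in>L. T y k)) differentiable (at x)"
    by (rule differentiable_add[OF dR])
  then show ?thesis by (simp add: R_def)
qed

lemma real_analytic_on_bounded_linear:
  assumes "bounded_linear h" "real_analytic_on f S"
  shows "real_analytic_on (\<lambda>x. h (f x)) S"
  unfolding real_analytic_on_def
proof
  fix x assume "x \<in> S"
  then obtain r c where r: "r > 0" and sum: "\<forall>y\<in>ball x r.
      ((\<lambda>k. (\<Prod>b\<in>Basis. ((y - x) \<bullet> b) ^ k b) *\<^sub>R c k) has_sum f y) (Basis \<rightarrow>\<^sub>E (UNIV :: nat set))"
    using assms(2) unfolding real_analytic_on_def by blast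
  have "((\<lambda>k. (\<Prod>b\<in>Basis. ((y - x) \<bullet> b) ^ k b) *\<^sub>R h (c k)) has_sum h (f y))
      (Basis \<rightarrow>\<^sub>E (UNIV :: nat set))" if "y \<in> ball x r" for y
    using has_sum_bounded_linear[OF assms(1) bspec[OF sum that]]
    by (simp only: linear_cmul[OF bounded_linear.linear[OF assms(1)]])
  then show "\<exists>r>0. \<exists>c. \<forall>y\<in>ball x r. ((\<lambda>k. (\<Prod>b\<in>Basis. ((y - x) \<bullet> b) ^ k b) *\<^sub>R c k) has_sum h (f y))
      (Basis \<rightarrow>\<^sub>E (UNIV :: nat set))"
    by (intro exI[of _ r] exI[of _ "\<lambda>k. h (c k)"] conjI r ballI)
qed

lemma real_analytic_imp_differentiable:
  fixes f :: "'a::euclidean_space \<Rightarrow> 'b::euclidean_space"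
  assumes "real_analytic_on f S" "x \<in> S"
  shows "f differentiable (at x)"
  unfolding differentiable_componentwise_within[of f x UNIV]
  by (intro ballI real_analytic_imp_differentiable_real[OF
        real_analytic_on_bounded_linear[OF bounded_linear_inner_left assms(1)] assms(2)])

definition complex_power_series :: "(('a::euclidean_space \<Rightarrow> nat) \<Rightarrow> real) \<Rightarrow> ('a \<Rightarrow> complex) \<Rightarrow> complex"
  where "complex_power_series c Z =
    (\<Sum>\<^sub>\<infinity>k\<in>(Basis \<rightarrow>\<^sub>E UNIV). (\<Prod>b\<in>Basis. Z b ^ k b) * of_real (c k))"

text \<open>
  The real majorant also bounds the complexified series, so the M-test gives uniform convergence.
  Points are functions on the basis, which keeps the index set of the real series.
\<close>

lemma complex_power_series_uniform_limit:
  fixes c :: "('a::euclidean_space \<Rightarrow> nat) \<Rightarrow> real"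
  assumes "(\<lambda>k. \<rho> ^ (\<Sum>b\<in>Basis. k b) * \<bar>c k\<bar>) summable_on (Basis \<rightarrow>\<^sub>E UNIV)"
    and "\<And>p b. p \<in> S \<Longrightarrow> b \<in> Basis \<Longrightarrow> norm (g p b) \<le> \<rho>"
  shows "uniform_limit S (\<lambda>X p. \<Sum>k\<in>X. (\<Prod>b\<in>Basis. g p b ^ k b) * of_real (c k))
    (\<lambda>p. complex_power_series c (g p)) (finite_subsets_at_top (Basis \<rightarrow>\<^sub>E UNIV))"
  unfolding complex_power_series_def
proof (rule Weierstrass_m_test_general[OF _ assms(1)])
  fix k p assume p: "p \<in> S"
  have "(\<Prod>b\<in>Basis. norm (g p b) ^ k b) \<le> (\<Prod>b\<in>Basis. \<rho> ^ k b)"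
    by (intro prod_mono conjI power_mono) (use assms(2) p in auto)
  then show "norm ((\<Prod>b\<in>Basis. g p b ^ k b) * of_real (c k)) \<le> \<rho> ^ (\<Sum>b\<in>Basis. k b) * \<bar>c k\<bar>"
    by (simp add: norm_mult norm_power power_sum mult_right_mono flip: prod_norm)
qed

lemma complex_power_series_continuous:
  fixes c :: "('a::euclidean_space \<Rightarrow> nat) \<Rightarrow> real" and g :: "'p::topological_space \<Rightarrow> 'a \<Rightarrow> complex"
  assumes "(\<lambda>k. \<rho> ^ (\<Sum>b\<in>Basis. k b) * \<bar>c k\<bar>) summable_on (Basis \<rightarrow>\<^sub>E UNIV)"
    and "\<And>p b. p \<in> S \<Longrightarrow> b \<in> Basis \<Longrightarrow> norm (g p b) \<le> \<rho>"
    and "\<And>b. b \<in> Basis \<Longrightarrow> continuous_on S (\<lambda>p. g p b)"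
  shows "continuous_on S (\<lambda>p. complex_power_series c (g p))"
  by (rule uniform_limit_theorem[OF _ complex_power_series_uniform_limit[OF assms(1,2)]])
     (auto intro!: always_eventually continuous_intros assms(3))

lemma complex_power_series_holomorphic:
  fixes c :: "('a::euclidean_space \<Rightarrow> nat) \<Rightarrow> real" and g :: "complex \<Rightarrow> 'a \<Rightarrow> complex"
  assumes "(\<lambda>k. \<rho> ^ (\<Sum>b\<in>Basis. k b) * \<bar>c k\<bar>) summable_on (Basis \<rightarrow>\<^sub>E UNIV)" and "open S"
    and g: "\<And>p b. p \<in> S \<Longrightarrow> b \<in> Basis \<Longrightarrow> norm (g p b) \<le> \<rho>"
    and hol: "\<And>b. b \<in> Basis \<Longrightarrow> (\<lambda>p. g p b) holomorphic_on S"
  shows "(\<lambda>p. complex_power_series c (g p)) holomorphic_on S"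
proof -
  have "\<exists>e>0. (\<lambda>p. complex_power_series c (g p)) holomorphic_on ball t e" if tS: "t \<in> S" for t
  proof -
    obtain e where e: "e > 0" "cball t e \<subseteq> S"
      using \<open>open S\<close> tS by (meson open_contains_cball)
    have h: "(\<lambda>p. g p b) holomorphic_on cball t e" if "b \<in> Basis" for b
      by (rule holomorphic_on_subset[OF hol[OF that] e(2)])
    have h': "(\<lambda>p. g p b) holomorphic_on ball t e" if "b \<in> Basis" for b
      by (rule holomorphic_on_subset[OF h[OF that] ball_subset_cball])
    have "uniform_limit (cball t e) (\<lambda>X p. \<Sum>k\<in>X. (\<Prod>b\<in>Basis. g p b ^ k b) * of_real (c k))
        (\<lambda>p. complex_power_series c (g p)) (finite_subsets_at_top (Basis \<rightarrow>\<^sub>E UNIV))"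
      by (rule complex_power_series_uniform_limit[OF assms(1)]) (use g e in auto)
    then show ?thesis
      by (rule holomorphic_uniform_limit[rotated])
         (use e in \<open>auto intro!: always_eventually continuous_intros holomorphic_intros
                       holomorphic_on_imp_continuous_on h h'\<close>)
  qed
  then show ?thesis
    by (intro analytic_imp_holomorphic) (simp add: analytic_on_def)
qed

text \<open>
  The functions of interest live on the slice \<open>q\<^sub>2 = 0\<close> of the normal form space, with
  coordinates \<open>t = q\<^sub>1\<close>, \<open>\<alpha> = p\<^sub>1\<close>, \<open>\<beta> = p\<^sub>2\<close>.  Holomorphy is only used along curves \<open>(t, u(t), v(t))\<close>.
\<close>

definition complexifies :: "real \<Rightarrow> (complex \<times> complex \<times> complex \<Rightarrow> complex) \<Rightarrow> ((real^2) \<times> (real^2) \<Rightarrow> real) \<Rightarrow> bool"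
  where "complexifies \<rho> F f \<longleftrightarrow>
    continuous_on {(t, \<alpha>, \<beta>). norm t + norm \<alpha> + norm \<beta> \<le> \<rho>} F \<and>
    (\<forall>T u v. open T \<longrightarrow> u holomorphic_on T \<longrightarrow> v holomorphic_on T \<longrightarrow>
       (\<forall>t\<in>T. norm t + norm (u t) + norm (v t) \<le> \<rho>) \<longrightarrow> (\<lambda>t. F (t, u t, v t)) holomorphic_on T) \<and>
    (\<forall>t a b. \<bar>t\<bar> + \<bar>a\<bar> + \<bar>b\<bar> \<le> \<rho> \<longrightarrow>
       F (of_real t, of_real a, of_real b) = of_real (f (vector [t, 0], vector [a, b])))"

lemma real_analytic_complexification:
  fixes f :: "(real^2) \<times> (real^2) \<Rightarrow> real"
  assumes "real_analytic_on f S" "0 \<in> S"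
  obtains \<rho> F where "\<rho> > 0" "complexifies \<rho> F f"
proof -
  let ?I = "Basis \<rightarrow>\<^sub>E (UNIV :: nat set) :: ((real^2) \<times> (real^2) \<Rightarrow> nat) set"
  obtain r c \<rho>' where r: "r > 0" "\<rho>' > 0" and
    sum: "\<And>y. y \<in> ball 0 r \<Longrightarrow> ((\<lambda>k. (\<Prod>b\<in>Basis. ((y - 0) \<bullet> b) ^ k b) * c k) has_sum f y) ?I"
    and maj: "(\<lambda>k. \<rho>' ^ (\<Sum>b\<in>Basis. k b) * \<bar>c k\<bar>) summable_on ?I"
    by (rule real_analytic_majorant[OF assms]) (rule that; assumption)
  define \<rho> where "\<rho> = min (r / 2) \<rho>'"
  define Z :: "complex \<times> complex \<times> complex \<Rightarrow> (real^2) \<times> (real^2) \<Rightarrow> complex" where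
    "Z = (\<lambda>(t, \<alpha>, \<beta>) e. of_real (fst e $ 1) * t + of_real (snd e $ 1) * \<alpha> + of_real (snd e $ 2) * \<beta>)"
  have Zbound: "norm (Z (t, \<alpha>, \<beta>) e) \<le> \<rho>'" if "e \<in> Basis" "norm t + norm \<alpha> + norm \<beta> \<le> \<rho>" for t \<alpha> \<beta> e
  proof -
    have "\<bar>fst e $ 1\<bar> \<le> 1" "\<bar>snd e $ 1\<bar> \<le> 1" "\<bar>snd e $ 2\<bar> \<le> 1"
      using that(1) component_le_norm_cart[of "fst e"] component_le_norm_cart[of "snd e"]
        norm_fst_le[of "fst e" "snd e"] norm_snd_le[of "snd e" "fst e"]
      by (auto simp: norm_Basis intro: order_trans)
    then have "norm (Z (t, \<alpha>, \<beta>) e) \<le> norm t + norm \<alpha> + norm \<beta>"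
      unfolding Z_def by (auto simp: norm_mult intro!: norm_triangle_mono mult_left_le_one_le)
    with that show ?thesis by (simp add: \<rho>_def)
  qed
  show thesis
  proof (rule that[of \<rho> "\<lambda>p. complex_power_series c (Z p)"])
    show "\<rho> > 0" using r by (simp add: \<rho>_def)
    show "complexifies \<rho> (\<lambda>p. complex_power_series c (Z p)) f"
      unfolding complexifies_def
    proof (intro conjI allI impI)
    show "continuous_on {(t, \<alpha>, \<beta>). norm t + norm \<alpha> + norm \<beta> \<le> \<rho>} (\<lambda>p. complex_power_series c (Z p))"
      by (rule complex_power_series_continuous[OF maj])
         (use Zbound in \<open>auto simp: Z_def case_prod_unfold intro!: continuous_intros\<close>)
    show "(\<lambda>t. complex_power_series c (Z (t, u t, v t))) holomorphic_on T"
      if "open T" "u holomorphic_on T" "v holomorphic_on T"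
         "\<forall>t\<in>T. norm t + norm (u t) + norm (v t) \<le> \<rho>" for T u v
      by (rule complex_power_series_holomorphic[OF maj \<open>open T\<close>])
         (use that Zbound in \<open>auto simp: Z_def intro!: holomorphic_intros\<close>)
    show "complex_power_series c (Z (of_real t, of_real a, of_real b))
        = of_real (f (vector [t, 0], vector [a, b]))" if "\<bar>t\<bar> + \<bar>a\<bar> + \<bar>b\<bar> \<le> \<rho>" for t a b
    proof -
      let ?y = "(vector [t, 0], vector [a, b]) :: (real^2) \<times> (real^2)"
      have Z: "Z (of_real t, of_real a, of_real b) e = of_real (?y \<bullet> e)" for e
        by (simp add: Z_def inner_prod_def inner_vec_def sum_2)
      have "norm ?y \<le> norm (fst ?y) + norm (snd ?y)"
        using norm_Pair_le by fastforce
      also have "\<dots> \<le> \<bar>t\<bar> + (\<bar>a\<bar> + \<bar>b\<bar>)"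
        using norm_le_l1_cart[of "fst ?y"] norm_le_l1_cart[of "snd ?y"] by (simp add: sum_2)
      also have "\<dots> < r" using that r by (simp add: \<rho>_def)
      finally have "?y \<in> ball 0 r" by simp
      from sum[OF this] have "((\<lambda>k. complex_of_real ((\<Prod>e\<in>Basis. (?y \<bullet> e) ^ k e) * c k)) has_sum of_real (f ?y)) ?I"
        by (intro has_sum_of_real) simp
      then show ?thesis
        unfolding complex_power_series_def Z by (simp add: infsumI)
    qed
    qed
  qed
qed

section \<open>The flow of the first action\<close>

lemma has_derivative_vec_nth_comp [derivative_intros]:
  "(f has_derivative f') F \<Longrightarrow> ((\<lambda>x. f x $ i) has_derivative (\<lambda>x. f' x $ i)) F"
  by (rule bounded_linear.has_derivative[OF bounded_linear_vec_nth])

text \<open>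
  The tangent space of the phase space: the kernel of the differentials of \<open>r \<bullet> r\<close> and \<open>r \<bullet> p\<close>.
\<close>

definition tangent_at :: "(real^3) \<times> (real^3) \<Rightarrow> ((real^3) \<times> (real^3)) set"
  where "tangent_at x = {v. fst x \<bullet> fst v = 0 \<and> fst v \<bullet> snd x + fst x \<bullet> snd v = 0}"

lemma dim_tangent_at_le:
  assumes "x \<in> phase_space"
  shows "dim (tangent_at x) \<le> 4"
proof -
  define a b where "a = (fst x, 0 :: real^3)" and "b = (snd x, fst x)"
  have x: "fst x \<bullet> fst x = 1" "fst x \<bullet> snd x = 0"
    using assms by (auto simp: phase_space_def norm_eq_1)
  have ab: "a \<noteq> 0" "b \<noteq> 0" "orthogonal a b"
    using x by (auto simp: a_def b_def zero_prod_def orthogonal_def)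
  have "a \<noteq> b" using ab(1,3) by (auto simp: orthogonal_self)
  have "pairwise orthogonal {a, b}" using ab(3) by (auto simp: pairwise_def orthogonal_commute)
  then have "independent {a, b}"
    by (rule pairwise_orthogonal_independent) (use ab in auto)
  then have "dim (span {a, b}) = 2"
    using \<open>a \<noteq> b\<close> by (simp add: dim_eq_card_independent)
  moreover have "dim {y \<in> UNIV. \<forall>x\<in>span {a, b}. orthogonal x y} + dim (span {a, b})
      = dim (UNIV :: ((real^3) \<times> (real^3)) set)"
    by (rule dim_subspace_orthogonal_to_vectors) auto
  moreover have "tangent_at x \<subseteq> {y \<in> UNIV. \<forall>x\<in>span {a, b}. orthogonal x y}"
  proof (intro subsetI CollectI conjI ballI UNIV_I)
    fix v u assume v: "v \<in> tangent_at x" and u: "u \<in> span {a, b}"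
    have "orthogonal v u"
      by (rule orthogonal_to_span[OF u])
         (use v in \<open>auto simp: tangent_at_def a_def b_def orthogonal_def inner_prod_def inner_commute add.commute\<close>)
    then show "orthogonal u v" by (simp add: orthogonal_commute)
  qed
  ultimately show ?thesis using dim_subset[of "tangent_at x" "{y \<in> UNIV. \<forall>x\<in>span {a, b}. orthogonal x y}"]
    by simp
qed

lemma subspace_tangent_at: "subspace (tangent_at x)"
  unfolding subspace_def tangent_at_def by (auto simp: inner_add algebra_simps)
    (metis distrib_left mult_zero_right)

lemma symplectic_coordinates_has_derivative:
  assumes "symplectic_coordinates U \<Phi>" "x \<in> U"
  shows "(\<Phi> has_derivative frechet_derivative \<Phi> (at x)) (at x)"
  using assms real_analytic_imp_differentiable[of \<Phi> U x]
  by (simp add: symplectic_coordinates_def frechet_derivative_works)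

lemma symplectic_coordinates_in_phase_space:
  assumes "symplectic_coordinates U \<Phi>" "x \<in> U"
  shows "\<Phi> x \<in> phase_space"
proof -
  have "\<Phi> ` U \<subseteq> phase_space"
    using assms(1) by (meson openin_imp_subset symplectic_coordinates_def)
  with assms(2) show ?thesis by blast
qed

lemma symplectic_coordinates_symplectic:
  assumes "symplectic_coordinates U \<Phi>" "x \<in> U"
  shows "symplectic_form (frechet_derivative \<Phi> (at x) u) (frechet_derivative \<Phi> (at x) v) = symplectic_form u v"
  using assms unfolding symplectic_coordinates_def by blast

text \<open>
  The derivative maps into the tangent space since the constraints are constant, and it is
  injective since it pulls back a symplectic form to a nondegenerate one.  Both spaces have dimension 4.
\<close>

lemma symplectic_coordinates_range_derivative:
  assumes sc: "symplectic_coordinates U \<Phi>" and x: "x \<in> U"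
  shows "range (frechet_derivative \<Phi> (at x)) = tangent_at (\<Phi> x)"
proof -
  define D where "D = frechet_derivative \<Phi> (at x)"
  have D: "(\<Phi> has_derivative D) (at x)"
    unfolding D_def by (rule symplectic_coordinates_has_derivative[OF assms])
  have lin: "linear D" using D by (rule has_derivative_linear)
  have "open U" using sc by (simp add: symplectic_coordinates_def)
  have const: "F' v = 0" if F': "((\<lambda>y. F (\<Phi> y)) has_derivative F') (at x)"
      and F: "\<And>z. z \<in> phase_space \<Longrightarrow> F z = c" for F :: "(real^3) \<times> (real^3) \<Rightarrow> real" and F' c v
  proof -
    have "((\<lambda>y. c) has_derivative F') (at x)"
      by (rule has_derivative_transform_within_open[OF F' \<open>open U\<close> x])
         (simp add: F symplectic_coordinates_in_phase_space[OF sc])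
    then have "F' = (\<lambda>_. 0)" using has_derivative_unique has_derivative_const by blast
    then show ?thesis by simp
  qed
  have "D v \<in> tangent_at (\<Phi> x)" for v
  proof -
    have "((\<lambda>y. fst (\<Phi> y) \<bullet> fst (\<Phi> y)) has_derivative
        (\<lambda>v. fst (\<Phi> x) \<bullet> fst (D v) + fst (D v) \<bullet> fst (\<Phi> x))) (at x)"
      by (intro derivative_intros D)
    then have "fst (\<Phi> x) \<bullet> fst (D v) + fst (D v) \<bullet> fst (\<Phi> x) = 0"
      by (rule const[where F="\<lambda>z. fst z \<bullet> fst z" and c=1])
         (auto simp: phase_space_def norm_eq_1)
    moreover have "((\<lambda>y. fst (\<Phi> y) \<bullet> snd (\<Phi> y)) has_derivative
        (\<lambda>v. fst (\<Phi> x) \<bullet> snd (D v) + fst (D v) \<bullet> snd (\<Phi> x))) (at x)"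
      by (intro derivative_intros D)
    then have "fst (\<Phi> x) \<bullet> snd (D v) + fst (D v) \<bullet> snd (\<Phi> x) = 0"
      by (rule const[where F="\<lambda>z. fst z \<bullet> snd z" and c=0])
         (auto simp: phase_space_def)
    ultimately show ?thesis by (simp add: tangent_at_def inner_commute add.commute)
  qed
  then have sub: "range D \<subseteq> tangent_at (\<Phi> x)" by auto
  have "inj D"
  proof (rule linear_injective_0[OF lin, THEN iffD2], intro allI impI)
    fix u assume u: "D u = 0"
    have "symplectic_form u v = 0" for v
    proof -
      have "symplectic_form (D u) (D v) = symplectic_form u v"
        unfolding D_def using symplectic_coordinates_symplectic[OF sc x] by simp
      then show ?thesis using u by (simp add: symplectic_form_def)
    qed
    from this[of "(- snd u, fst u)"] have "fst u \<bullet> fst u + snd u \<bullet> snd u = 0"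
      by (simp add: symplectic_form_def)
    then have "u \<bullet> u = 0" by (simp add: inner_prod_def)
    then show "u = 0" by simp
  qed
  then have "dim (range D) = dim (UNIV :: ((real^2) \<times> (real^2)) set)"
    by (intro dim_image_eq lin) (auto simp: inj_on_def)
  then have "dim (tangent_at (\<Phi> x)) \<le> dim (range D)"
    using dim_tangent_at_le[OF symplectic_coordinates_in_phase_space[OF assms]] by simp
  then show ?thesis
    unfolding D_def[symmetric]
    by (intro subspace_dim_equal subspace_tangent_at sub linear_subspace_image lin) auto
qed

text \<open>
  Vertical vectors \<open>(0, \<pi>)\<close> with \<open>\<pi>\<close> orthogonal to \<open>r\<close> are tangent, hence in the range of the derivative.
  Testing the symplectic form against them isolates the position part of a Hamiltonian field.
\<close>

lemma symplectic_gradient_position: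
  assumes sc: "symplectic_coordinates U \<Phi>" and x: "x \<in> U"
    and f: "(f has_derivative f') (at (\<Phi> x))"
    and fg: "\<And>y. y \<in> U \<Longrightarrow> f (\<Phi> y) = g y"
    and g: "(g has_derivative symplectic_form \<xi>) (at x)"
    and \<pi>: "fst (\<Phi> x) \<bullet> \<pi> = 0"
  shows "fst (frechet_derivative \<Phi> (at x) \<xi>) \<bullet> \<pi> = f' (0, \<pi>)"
proof -
  define D where "D = frechet_derivative \<Phi> (at x)"
  have D: "(\<Phi> has_derivative D) (at x)"
    unfolding D_def by (rule symplectic_coordinates_has_derivative[OF sc x])
  have "open U" using sc by (simp add: symplectic_coordinates_def)
  have "((\<lambda>y. f (\<Phi> y)) has_derivative (\<lambda>v. f' (D v))) (at x)"
    by (rule has_derivative_compose[OF D f])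
  then have "(g has_derivative (\<lambda>v. f' (D v))) (at x)"
    by (rule has_derivative_transform_within_open[OF _ \<open>open U\<close> x]) (simp add: fg)
  then have eq: "(\<lambda>v. f' (D v)) = symplectic_form \<xi>"
    using g by (rule has_derivative_unique)
  have "(0, \<pi>) \<in> range D"
    unfolding D_def symplectic_coordinates_range_derivative[OF sc x]
    using \<pi> by (simp add: tangent_at_def)
  then obtain v where v: "D v = (0, \<pi>)" by auto
  have "f' (0, \<pi>) = symplectic_form \<xi> v" using fun_cong[OF eq, of v] v by simp
  also have "\<dots> = symplectic_form (D \<xi>) (D v)"
    unfolding D_def using symplectic_coordinates_symplectic[OF sc x] by simp
  also have "\<dots> = fst (D \<xi>) \<bullet> \<pi>" using v by (simp add: symplectic_form_def)
  finally show ?thesis by (simp add: D_def)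
qed

text \<open>
  On the phase space this is \<open>|p|\<^sup>2 / 2 + z - 1\<close>; the polynomial form is easy to differentiate.
\<close>

lemma pendulum_H_alt:
  "pendulum_H z = 1 / 2 * ((fst z \<bullet> fst z) * (snd z \<bullet> snd z) - (fst z \<bullet> snd z) * (fst z \<bullet> snd z)) + fst z $ 3 - 1"
  using norm_cross_dot[of "fst z" "snd z"]
  by (simp add: pendulum_H_def case_prod_unfold power_mult_distrib power2_norm_eq_inner flip: power2_eq_square)

text \<open>
  The Hamiltonian field of \<open>\<H>(J\<^sub>1, J\<^sub>2)\<close> is \<open>A X\<^sub>1 + B X\<^sub>2\<close>.  Its image is the field of the pendulum,
  whose position part is \<open>p\<close>; the image of \<open>X\<^sub>2\<close> is the field of \<open>L\<^sub>z\<close>, which rotates the position about the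
  vertical axis.  Both sides are orthogonal to \<open>r\<close>, so it suffices to test them on vectors orthogonal to \<open>r\<close>.
\<close>

lemma first_action_flow:
  assumes sc: "symplectic_coordinates U \<Phi>" and x: "x \<in> U"
    and Lz: "\<And>y. y \<in> U \<Longrightarrow> pendulum_Lz (\<Phi> y) = BNF_J2 y"
    and H: "\<And>y. y \<in> U \<Longrightarrow> pendulum_H (\<Phi> y) = \<H> (BNF_J1 y) (BNF_J2 y)"
    and dH: "((\<lambda>(a, b). \<H> a b) has_derivative (\<lambda>(\<alpha>, \<beta>). A * \<alpha> + B * \<beta>)) (at (BNF_J1 x, BNF_J2 x))"
  defines "D \<equiv> frechet_derivative \<Phi> (at x)" and "r \<equiv> fst (\<Phi> x)"
  shows "A *\<^sub>R fst (D (fst x, - snd x)) + B *\<^sub>R cross3 (axis 3 1) r = snd (\<Phi> x)"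
proof -
  define X1 where "X1 = (fst x, - snd x)"
  define X2 where "X2 = (vector [- (fst x $ 2), fst x $ 1] :: real^2, vector [- (snd x $ 2), snd x $ 1] :: real^2)"
  define p where "p = snd (\<Phi> x)"
  define e :: "real^3" where "e = cross3 (axis 3 1) r"
  have ps: "r \<bullet> r = 1" "r \<bullet> p = 0"
    using symplectic_coordinates_in_phase_space[OF sc x]
    by (auto simp: phase_space_def norm_eq_1 r_def p_def)
  have D: "(\<Phi> has_derivative D) (at x)"
    unfolding D_def by (rule symplectic_coordinates_has_derivative[OF sc x])
  then have lin: "linear D" by (rule has_derivative_linear)
  have dJ1: "(BNF_J1 has_derivative symplectic_form X1) (at x)"
  proof -
    have "BNF_J1 = (\<lambda>y. fst y \<bullet> snd y)"
      by (auto simp: BNF_J1_def inner_vec_def sum_2)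
    moreover have "((\<lambda>y. fst y \<bullet> snd y) has_derivative (\<lambda>v. fst x \<bullet> snd v + fst v \<bullet> snd x)) (at x)"
      by (intro derivative_intros)
    moreover have "(\<lambda>v. fst x \<bullet> snd v + fst v \<bullet> snd x) = symplectic_form X1"
      by (auto simp: symplectic_form_def X1_def inner_commute)
    ultimately show ?thesis by simp
  qed
  have dJ2: "(BNF_J2 has_derivative symplectic_form X2) (at x)"
  proof -
    have "((\<lambda>y. fst y $ 1 * snd y $ 2 - fst y $ 2 * snd y $ 1) has_derivative
      (\<lambda>v. fst x $ 1 * snd v $ 2 + fst v $ 1 * snd x $ 2 - (fst x $ 2 * snd v $ 1 + fst v $ 2 * snd x $ 1))) (at x)"
      by (intro derivative_intros)
    moreover have "(\<lambda>v. fst x $ 1 * snd v $ 2 + fst v $ 1 * snd x $ 2 - (fst x $ 2 * snd v $ 1 + fst v $ 2 * snd x $ 1))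
        = symplectic_form X2"
      by (auto simp: symplectic_form_def X2_def inner_vec_def sum_2)
    ultimately show ?thesis by (simp add: BNF_J2_def case_prod_unfold)
  qed
  have dHJ: "((\<lambda>y. \<H> (BNF_J1 y) (BNF_J2 y)) has_derivative
      symplectic_form (A *\<^sub>R X1 + B *\<^sub>R X2)) (at x)"
  proof -
    have "((\<lambda>y. (BNF_J1 y, BNF_J2 y)) has_derivative (\<lambda>v. (symplectic_form X1 v, symplectic_form X2 v))) (at x)"
      by (intro has_derivative_Pair dJ1 dJ2)
    then have "((\<lambda>y. (\<lambda>(a, b). \<H> a b) (BNF_J1 y, BNF_J2 y)) has_derivative
        (\<lambda>v. (\<lambda>(\<alpha>, \<beta>). A * \<alpha> + B * \<beta>) (symplectic_form X1 v, symplectic_form X2 v))) (at x)"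
      by (rule has_derivative_compose[where f="\<lambda>y. (BNF_J1 y, BNF_J2 y)" and g="\<lambda>(a, b). \<H> a b"
          and g'="\<lambda>(\<alpha>, \<beta>). A * \<alpha> + B * \<beta>"]) (rule dH)
    moreover have "(\<lambda>v. A * symplectic_form X1 v + B * symplectic_form X2 v)
        = symplectic_form (A *\<^sub>R X1 + B *\<^sub>R X2)"
      by (auto simp: symplectic_form_def inner_add_left inner_add_right algebra_simps)
    ultimately show ?thesis by simp
  qed
  have rr: "((\<lambda>z. fst z \<bullet> fst z) has_derivative (\<lambda>v. r \<bullet> fst v + fst v \<bullet> r)) (at (\<Phi> x))"
    and pp: "((\<lambda>z. snd z \<bullet> snd z) has_derivative (\<lambda>v. p \<bullet> snd v + snd v \<bullet> p)) (at (\<Phi> x))"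
    and rp: "((\<lambda>z. fst z \<bullet> snd z) has_derivative (\<lambda>v. r \<bullet> snd v + fst v \<bullet> p)) (at (\<Phi> x))"
    unfolding r_def p_def by (intro derivative_intros)+
  define N where "N = (\<lambda>v. (r \<bullet> r) * (p \<bullet> snd v + snd v \<bullet> p) + (r \<bullet> fst v + fst v \<bullet> r) * (p \<bullet> p)
      - ((r \<bullet> p) * (r \<bullet> snd v + fst v \<bullet> p) + (r \<bullet> snd v + fst v \<bullet> p) * (r \<bullet> p)))"
  have "((\<lambda>z. (fst z \<bullet> fst z) * (snd z \<bullet> snd z) - (fst z \<bullet> snd z) * (fst z \<bullet> snd z)) has_derivative N) (at (\<Phi> x))"
    unfolding N_def r_def p_def
    by (rule has_derivative_diff[OF has_derivative_mult[OF rr pp] has_derivative_mult[OF rp rp],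
          unfolded r_def p_def])
  from bounded_linear.has_derivative[OF bounded_linear_mult_right this, of "1 / 2"]
  have dPH: "(pendulum_H has_derivative (\<lambda>v. 1 / 2 * N v + fst v $ 3 - 0)) (at (\<Phi> x))"
    unfolding pendulum_H_alt[abs_def]
    by (intro has_derivative_diff has_derivative_add has_derivative_vec_nth_comp
        has_derivative_const has_derivative_fst has_derivative_ident)
  have dPL: "(pendulum_Lz has_derivative (\<lambda>v. r $ 1 * snd v $ 2 + fst v $ 1 * p $ 2
      - (r $ 2 * snd v $ 1 + fst v $ 2 * p $ 1))) (at (\<Phi> x))"
    unfolding pendulum_Lz_def case_prod_unfold r_def p_def
    by (intro derivative_intros)
  have rot: "fst (D X2) \<bullet> \<pi> = e \<bullet> \<pi>" if "r \<bullet> \<pi> = 0" for \<pi>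
    using symplectic_gradient_position[OF sc x dPL Lz dJ2] that
    by (simp add: r_def[symmetric] D_def[symmetric] e_def cross3_simps axis_def)
  have ham: "fst (D (A *\<^sub>R X1 + B *\<^sub>R X2)) \<bullet> \<pi> = p \<bullet> \<pi>" if "r \<bullet> \<pi> = 0" for \<pi>
    using symplectic_gradient_position[OF sc x dPH H dHJ] that ps
    by (simp add: N_def inner_commute r_def[symmetric] D_def[symmetric])
  \<comment> \<open>The difference of the two sides is orthogonal to \<open>r\<close> and to all vectors orthogonal to \<open>r\<close>.\<close>
  define V where "V = A *\<^sub>R fst (D X1) + B *\<^sub>R e - p"
  have V: "V \<bullet> \<pi> = 0" if "r \<bullet> \<pi> = 0" for \<pi>
    using ham[OF that] rot[OF that]
    by (simp add: V_def linear_add[OF lin] linear_cmul[OF lin] inner_left_distrib inner_diff_left)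
  have "D X1 \<in> tangent_at (\<Phi> x)"
    unfolding D_def symplectic_coordinates_range_derivative[OF sc x, symmetric] by simp
  then have "r \<bullet> V = 0"
    using ps by (simp add: V_def tangent_at_def r_def[symmetric] inner_add inner_diff_right e_def dot_cross_self)
  then have "V \<bullet> V = 0" by (rule V)
  then show ?thesis by (simp add: V_def X1_def e_def p_def)
qed

section \<open>The branch of the square root and the elliptic integral\<close>

text \<open>
  Chosen so that \<open>P(\<zeta>) = 2 (1 - \<zeta>)\<^sup>2 (1 + \<zeta>) (1 + x)\<close> with \<open>x\<close> small away from \<open>\<plusminus>1\<close> for small \<open>h\<close>, \<open>j\<close>;
  the square root of \<open>1 + x\<close> is then the principal one.
\<close>

definition cycle_perturbation :: "real \<Rightarrow> real \<Rightarrow> complex \<Rightarrow> complex"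
  where "cycle_perturbation h j \<zeta> = (of_real h - (of_real j)\<^sup>2 / (2 * (1 - \<zeta>\<^sup>2))) / (1 - \<zeta>)"

definition cycle_root :: "real \<Rightarrow> real \<Rightarrow> complex \<Rightarrow> complex"
  where "cycle_root h j \<zeta> = (\<zeta> - 1) * csqrt (2 * (\<zeta> + 1)) * csqrt (1 + cycle_perturbation h j \<zeta>)"

lemma one_minus_square_nz:
  assumes "0 < norm (\<zeta> - 1)" "norm (\<zeta> - 1) < (2::real)"
  shows "\<zeta> \<noteq> (1::complex)" "\<zeta> + 1 \<noteq> 0" "1 - \<zeta>\<^sup>2 \<noteq> 0" "Re (\<zeta> + 1) > 0"
proof -
  show 1: "\<zeta> \<noteq> 1" using assms by auto
  have "\<bar>Re (\<zeta> - 1)\<bar> < 2" using abs_Re_le_cmod[of "\<zeta> - 1"] assms by linarith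
  then show 2: "Re (\<zeta> + 1) > 0" by simp
  then show 3: "\<zeta> + 1 \<noteq> 0" by (metis less_irrefl zero_complex.simps(1))
  have "1 - \<zeta>\<^sup>2 = (1 - \<zeta>) * (\<zeta> + 1)" by (simp add: algebra_simps power2_eq_square)
  with 1 3 show "1 - \<zeta>\<^sup>2 \<noteq> 0" by auto
qed

lemma cycle_root_square:
  assumes "0 < norm (\<zeta> - 1)" "norm (\<zeta> - 1) < 2"
  shows "(cycle_root h j \<zeta>)\<^sup>2 = pendulum_P h j \<zeta>"
proof -
  note nz = one_minus_square_nz[OF assms]
  let ?h = "complex_of_real h" and ?j = "complex_of_real j"
  have eq: "1 - \<zeta>\<^sup>2 = (1 - \<zeta>) * (1 + \<zeta>)" by (simp add: algebra_simps power2_eq_square)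
  have "(cycle_root h j \<zeta>)\<^sup>2 = (1 - \<zeta>)\<^sup>2 * (2 * (1 + \<zeta>)) * (1 + cycle_perturbation h j \<zeta>)"
    by (simp add: cycle_root_def power_mult_distrib power2_csqrt power2_commute add.commute)
  also have "\<dots> = 2 * (1 - \<zeta>\<^sup>2) * ((1 - \<zeta>) * (1 + cycle_perturbation h j \<zeta>))"
    unfolding eq by (simp add: power2_eq_square)
  also have "(1 - \<zeta>) * (1 + cycle_perturbation h j \<zeta>) = 1 - \<zeta> + (?h - ?j\<^sup>2 / (2 * (1 - \<zeta>\<^sup>2)))"
    using nz(1) by (simp add: cycle_perturbation_def distrib_left)
  also have "2 * (1 - \<zeta>\<^sup>2) * \<dots> = 2 * (1 - \<zeta>\<^sup>2) * (?h + 1 - \<zeta>) - 2 * (1 - \<zeta>\<^sup>2) * (?j\<^sup>2 / (2 * (1 - \<zeta>\<^sup>2)))"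
    by (simp only: right_diff_distrib distrib_left algebra_simps)
  also have "2 * (1 - \<zeta>\<^sup>2) * (?j\<^sup>2 / (2 * (1 - \<zeta>\<^sup>2))) = ?j\<^sup>2"
    using nz(3) by simp
  finally show ?thesis by (simp add: pendulum_P_def)
qed

lemma cycle_perturbation_le:
  assumes "0 < r" "r \<le> R" "R < 2"
  obtains C where "C > 0"
    "\<And>h j \<zeta>. r \<le> norm (\<zeta> - 1) \<Longrightarrow> norm (\<zeta> - 1) \<le> R \<Longrightarrow>
       norm (cycle_perturbation h j \<zeta>) \<le> C * (\<bar>h\<bar> + j\<^sup>2)"
proof
  define M where "M = 1 + 1 / (2 * (r * (2 - R)))"
  have M: "M \<ge> 1" "1 / (2 * (r * (2 - R))) \<le> M" using assms by (simp_all add: M_def)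
  show "M / r > 0" using M assms by simp
  fix h j :: real and \<zeta> :: complex assume \<zeta>: "r \<le> norm (\<zeta> - 1)" "norm (\<zeta> - 1) \<le> R"
  have "2 - norm (1 - \<zeta>) \<le> norm (1 + \<zeta>)"
    using norm_triangle_ineq4[of 2 "1 - \<zeta>"] norm_triangle_ineq[of "1 + \<zeta>" "1 - \<zeta>"] by simp
  then have 2: "2 - R \<le> norm (1 + \<zeta>)" using \<zeta> by (simp add: norm_minus_commute)
  have "r * (2 - R) \<le> norm (1 - \<zeta>) * norm (1 + \<zeta>)"
    using \<zeta> 2 assms by (intro mult_mono) (auto simp: norm_minus_commute)
  also have "\<dots> = norm (1 - \<zeta>\<^sup>2)" by (simp add: algebra_simps power2_eq_square flip: norm_mult)
  finally have 3: "r * (2 - R) \<le> norm (1 - \<zeta>\<^sup>2)" .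
  have rR: "0 < r * (2 - R)" using assms by simp
  with 3 have pos: "0 < norm (1 - \<zeta>\<^sup>2)" by linarith
  have "norm ((of_real j)\<^sup>2 / (2 * (1 - \<zeta>\<^sup>2))) = j\<^sup>2 / (2 * norm (1 - \<zeta>\<^sup>2))"
    by (simp only: norm_divide norm_mult norm_power norm_of_real norm_numeral power2_abs)
  also have "\<dots> \<le> j\<^sup>2 / (2 * (r * (2 - R)))"
    by (rule divide_left_mono) (use 3 rR pos in \<open>simp_all add: mult_pos_pos\<close>)
  also have "\<dots> \<le> M * j\<^sup>2" using mult_right_mono[OF M(2), of "j\<^sup>2"] by simp
  finally have 4: "norm ((of_real j)\<^sup>2 / (2 * (1 - \<zeta>\<^sup>2))) \<le> M * j\<^sup>2" .
  have "norm (of_real h - (of_real j)\<^sup>2 / (2 * (1 - \<zeta>\<^sup>2))) \<le> \<bar>h\<bar> + M * j\<^sup>2"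
    using norm_triangle_ineq4[of "of_real h" "(of_real j)\<^sup>2 / (2 * (1 - \<zeta>\<^sup>2))"] 4 by simp
  also have "\<dots> \<le> M * (\<bar>h\<bar> + j\<^sup>2)" using mult_right_mono[OF M(1), of "\<bar>h\<bar>"] by (simp add: distrib_left)
  finally have "norm (cycle_perturbation h j \<zeta>) \<le> M * (\<bar>h\<bar> + j\<^sup>2) / norm (\<zeta> - 1)"
    by (simp add: cycle_perturbation_def norm_divide norm_minus_commute divide_right_mono)
  also have "\<dots> \<le> M * (\<bar>h\<bar> + j\<^sup>2) / r"
    using \<zeta> assms M by (intro divide_left_mono mult_pos_pos) auto
  finally show "norm (cycle_perturbation h j \<zeta>) \<le> M / r * (\<bar>h\<bar> + j\<^sup>2)" by simp
qed

lemma cycle_perturbation_small: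
  assumes "0 < r" "r \<le> R" "R < 2" "\<epsilon> > 0"
  obtains d where "d > 0"
    "\<And>h j \<zeta>. \<bar>h\<bar> \<le> d \<Longrightarrow> \<bar>j\<bar> \<le> d \<Longrightarrow> r \<le> norm (\<zeta> - 1) \<Longrightarrow> norm (\<zeta> - 1) \<le> R \<Longrightarrow>
       norm (cycle_perturbation h j \<zeta>) \<le> \<epsilon>"
proof -
  obtain C where C: "C > 0" "\<And>h j \<zeta>. r \<le> norm (\<zeta> - 1) \<Longrightarrow> norm (\<zeta> - 1) \<le> R \<Longrightarrow>
       norm (cycle_perturbation h j \<zeta>) \<le> C * (\<bar>h\<bar> + j\<^sup>2)"
    by (rule cycle_perturbation_le[OF assms(1-3)]) (rule that; assumption)
  define d where "d = min 1 (\<epsilon> / (2 * C))"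
  have d: "d > 0" "d \<le> 1" "C * (d + d) \<le> \<epsilon>" using C assms by (auto simp: d_def min_def field_simps)
  show ?thesis
  proof (rule that[OF d(1)])
    fix h j :: real and \<zeta> :: complex assume hj: "\<bar>h\<bar> \<le> d" "\<bar>j\<bar> \<le> d" and \<zeta>: "r \<le> norm (\<zeta> - 1)" "norm (\<zeta> - 1) \<le> R"
    have "j\<^sup>2 = \<bar>j\<bar> * \<bar>j\<bar>" by (simp add: power2_eq_square)
    also have "\<dots> \<le> \<bar>j\<bar> * 1" using hj d by (intro mult_left_mono) auto
    finally have "C * (\<bar>h\<bar> + j\<^sup>2) \<le> C * (d + d)" using hj C(1) by (intro mult_left_mono add_mono) auto
    with C(2)[OF \<zeta>, of h j] d show "norm (cycle_perturbation h j \<zeta>) \<le> \<epsilon>" by linarith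
  qed
qed

lemma Re_csqrt_pos: "Re z > 0 \<Longrightarrow> Re (csqrt z) > 0"
  using abs_Re_le_cmod[of z] by (simp add: add_nonneg_pos)

lemma one_plus_small:
  assumes "norm (x::complex) \<le> 1/2"
  shows "Re (1 + x) > 0" "1 + x \<notin> \<real>\<^sub>\<le>\<^sub>0" "Re (csqrt (1 + x)) > 0"
proof -
  have "\<bar>Re x\<bar> \<le> 1/2" using abs_Re_le_cmod[of x] assms by linarith
  then show 1: "Re (1 + x) > 0" by simp
  then show "1 + x \<notin> \<real>\<^sub>\<le>\<^sub>0" by (auto simp: complex_nonpos_Reals_iff)
  from 1 show "Re (csqrt (1 + x)) > 0" by (rule Re_csqrt_pos)
qed

lemma csqrt_two_plus:
  assumes "norm (\<zeta> - 1) < 2"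
  shows "2 * (\<zeta> + 1) \<notin> \<real>\<^sub>\<le>\<^sub>0" "csqrt (2 * (\<zeta> + 1)) \<noteq> 0"
proof -
  have "\<bar>Re (\<zeta> - 1)\<bar> < 2" using abs_Re_le_cmod[of "\<zeta> - 1"] assms by linarith
  then have 2: "Re (2 * (\<zeta> + 1)) > 0" by simp
  then show "2 * (\<zeta> + 1) \<notin> \<real>\<^sub>\<le>\<^sub>0" by (auto simp: complex_nonpos_Reals_iff)
  from Re_csqrt_pos[OF 2] show "csqrt (2 * (\<zeta> + 1)) \<noteq> 0" by (metis less_irrefl zero_complex.simps(1))
qed

lemma cycle_root_holomorphic:
  assumes "\<And>\<zeta>. \<zeta> \<in> S \<Longrightarrow> 0 < norm (\<zeta> - 1) \<and> norm (\<zeta> - 1) < 2 \<and> norm (cycle_perturbation h j \<zeta>) \<le> 1/2"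
  shows "cycle_root h j holomorphic_on S"
proof -
  have 1: "cycle_perturbation h j holomorphic_on S"
    unfolding cycle_perturbation_def[abs_def]
    using assms one_minus_square_nz by (intro holomorphic_intros) auto
  have "(\<lambda>\<zeta>. csqrt (2 * (\<zeta> + 1))) holomorphic_on S"
    using assms by (intro holomorphic_intros csqrt_two_plus) auto
  moreover have "(\<lambda>\<zeta>. csqrt (1 + cycle_perturbation h j \<zeta>)) holomorphic_on S"
    using assms by (intro holomorphic_intros 1 one_plus_small) auto
  ultimately show ?thesis
    unfolding cycle_root_def[abs_def]
    by (intro holomorphic_on_mult holomorphic_on_diff holomorphic_on_ident holomorphic_on_const)
qed

text \<open>
  The two roots differ by a factor \<open>csqrt (1 + x)\<close> each, and these factors have positive real part.
\<close>

lemma cycle_root_sum_nz: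
  assumes "0 < norm (\<zeta> - 1)" "norm (\<zeta> - 1) < 2"
    and "norm (cycle_perturbation h j \<zeta>) \<le> 1/2" "norm (cycle_perturbation h' j' \<zeta>) \<le> 1/2"
  shows "cycle_root h j \<zeta> + cycle_root h' j' \<zeta> \<noteq> 0"
proof -
  have "Re (csqrt (1 + cycle_perturbation h j \<zeta>) + csqrt (1 + cycle_perturbation h' j' \<zeta>)) > 0"
    using one_plus_small(3)[OF assms(3)] one_plus_small(3)[OF assms(4)] by (simp del: csqrt.sel)
  then have 1: "csqrt (1 + cycle_perturbation h j \<zeta>) + csqrt (1 + cycle_perturbation h' j' \<zeta>) \<noteq> 0" by force
  have "cycle_root h j \<zeta> + cycle_root h' j' \<zeta> = (\<zeta> - 1) * csqrt (2 * (\<zeta> + 1)) *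
      (csqrt (1 + cycle_perturbation h j \<zeta>) + csqrt (1 + cycle_perturbation h' j' \<zeta>))"
    by (simp add: cycle_root_def algebra_simps)
  then show ?thesis using 1 assms csqrt_two_plus(2)[OF assms(2)] by simp
qed

lemma cycle_root_nz:
  assumes "0 < norm (\<zeta> - 1)" "norm (\<zeta> - 1) < 2" "norm (cycle_perturbation h j \<zeta>) \<le> 1/2"
  shows "cycle_root h j \<zeta> \<noteq> 0"
  using cycle_root_sum_nz[OF assms assms(3)] by simp

lemma cycle_root_continuous:
  assumes "\<And>h j \<zeta>. ((h, j), \<zeta>) \<in> S \<Longrightarrow>
      0 < norm (\<zeta> - 1) \<and> norm (\<zeta> - 1) < 2 \<and> norm (cycle_perturbation h j \<zeta>) \<le> 1/2"
  shows "continuous_on S (\<lambda>((h, j), \<zeta>). cycle_root h j \<zeta>)"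
proof -
  have nz: "1 - snd x \<noteq> 0" "1 - (snd x)\<^sup>2 \<noteq> 0" "2 * (snd x + 1) \<notin> \<real>\<^sub>\<le>\<^sub>0"
      "1 + cycle_perturbation (fst (fst x)) (snd (fst x)) (snd x) \<notin> \<real>\<^sub>\<le>\<^sub>0" if "x \<in> S" for x
    using assms[of "fst (fst x)" "snd (fst x)" "snd x"] that one_minus_square_nz[of "snd x"]
      csqrt_two_plus[of "snd x"] one_plus_small[of "cycle_perturbation (fst (fst x)) (snd (fst x)) (snd x)"]
    by auto
  have csq: "continuous_on S (\<lambda>x. csqrt (g x))" if "continuous_on S g" "\<And>x. x \<in> S \<Longrightarrow> g x \<notin> \<real>\<^sub>\<le>\<^sub>0"
    for g :: "_ \<Rightarrow> complex"
    by (rule continuous_on_compose2[OF continuous_on_csqrt that(1)]) (use that(2) in auto)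
  have 1: "continuous_on S (\<lambda>x. cycle_perturbation (fst (fst x)) (snd (fst x)) (snd x))"
    unfolding cycle_perturbation_def by (intro continuous_intros) (use nz in auto)
  show ?thesis
    unfolding cycle_root_def case_prod_unfold
    by (intro continuous_intros csq 1) (use nz in auto)
qed

lemma circle_integral_continuous:
  fixes f :: "'p::topological_space \<Rightarrow> complex \<Rightarrow> complex"
  assumes "continuous_on (S \<times> sphere c \<rho>) (\<lambda>(p, \<zeta>). f p \<zeta>)" "\<rho> > 0"
  shows "continuous_on S (\<lambda>p. contour_integral (circlepath c \<rho>) (f p))"
proof -
  have "continuous_on (S \<times> cbox 0 1) (\<lambda>(p, x). f p (circlepath c \<rho> x) * vector_derivative (circlepath c \<rho>) (at x))"
  proof -
    have 1: "circlepath c \<rho> x \<in> sphere c \<rho>" for x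
      using \<open>\<rho> > 0\<close> by (simp add: circlepath dist_norm norm_mult)
    have "continuous_on (S \<times> cbox 0 1) (\<lambda>y. (\<lambda>(p, \<zeta>). f p \<zeta>) (fst y, circlepath c \<rho> (snd y)))"
      by (rule continuous_on_compose2[OF assms(1)])
         (auto intro!: continuous_intros simp: 1[unfolded circlepath] circlepath simp del: mem_sphere)
    then show ?thesis
      by (auto simp: case_prod_unfold vector_derivative_circlepath intro!: continuous_intros)
  qed
  from integral_continuous_on_param[OF this] show ?thesis
    by (simp add: contour_integral_integral)
qed

definition cycle_integral :: "real \<Rightarrow> real \<Rightarrow> real \<Rightarrow> complex"
  where "cycle_integral \<rho> h j = 1 / (of_real pi * \<i>) *
    contour_integral (circlepath 1 \<rho>) (\<lambda>\<zeta>. cycle_root h j \<zeta> / (1 - \<zeta>\<^sup>2))"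

text \<open>
  Difference quotients of the elliptic integral.  As \<open>w'\<^sup>2 - w\<^sup>2\<close> is linear in \<open>h' - h\<close> and in
  \<open>j'\<^sup>2 - j\<^sup>2\<close>, division by \<open>w + w'\<close> gives exact increments (lemma \<open>cycle_integral_diff\<close>), and
  their continuity yields both the derivative and Lipschitz bounds.
\<close>

definition cycle_slope_h :: "real \<Rightarrow> real \<times> real \<Rightarrow> real \<times> real \<Rightarrow> complex"
  where "cycle_slope_h \<rho> = (\<lambda>(h, j) (h', j'). 1 / (of_real pi * \<i>) *
    contour_integral (circlepath 1 \<rho>) (\<lambda>\<zeta>. 2 / (cycle_root h j \<zeta> + cycle_root h' j' \<zeta>)))"

definition cycle_slope_j :: "real \<Rightarrow> real \<times> real \<Rightarrow> real \<times> real \<Rightarrow> complex"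
  where "cycle_slope_j \<rho> = (\<lambda>(h, j) (h', j'). 1 / (of_real pi * \<i>) *
    contour_integral (circlepath 1 \<rho>)
      (\<lambda>\<zeta>. (of_real j + of_real j') / ((1 - \<zeta>\<^sup>2) * (cycle_root h j \<zeta> + cycle_root h' j' \<zeta>))))"

definition square_of :: "real \<Rightarrow> (real \<times> real) set"
  where "square_of d = {(h, j). \<bar>h\<bar> \<le> d \<and> \<bar>j\<bar> \<le> d}"

definition cycle_small :: "real \<Rightarrow> real \<Rightarrow> bool"
  where "cycle_small \<rho> d \<longleftrightarrow> (\<forall>h j \<zeta>. \<bar>h\<bar> \<le> d \<longrightarrow> \<bar>j\<bar> \<le> d \<longrightarrow> norm (\<zeta> - 1) = \<rho> \<longrightarrow>
    norm (cycle_perturbation h j \<zeta>) \<le> 1/2)"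

lemma ex_cycle_small:
  assumes "0 < \<rho>" "\<rho> < 2"
  obtains d where "d > 0" "cycle_small \<rho> d"
  by (rule cycle_perturbation_small[OF assms(1) order_refl assms(2), of "1/2"])
     (auto simp: cycle_small_def intro!: that)

context
  fixes \<rho> d :: real
  assumes \<rho>: "0 < \<rho>" "\<rho> < 2" and d: "d > 0"
    and cycle_small: "cycle_small \<rho> d"
begin

lemmas cycle_perturbation_le_half = cycle_small[unfolded cycle_small_def, rule_format]

lemma cycle_root_sphere_nz:
  assumes "(h, j) \<in> square_of d" "(h', j') \<in> square_of d" "\<zeta> \<in> sphere 1 \<rho>"
  shows "cycle_root h j \<zeta> + cycle_root h' j' \<zeta> \<noteq> 0" "1 - \<zeta>\<^sup>2 \<noteq> 0" "cycle_root h j \<zeta> \<noteq> 0"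
  using assms \<rho> cycle_perturbation_le_half cycle_root_sum_nz[of \<zeta> h j h' j'] cycle_root_nz[of \<zeta> h j] one_minus_square_nz(3)[of \<zeta>]
  by (auto simp: square_of_def dist_norm norm_minus_commute)

lemma cycle_root_sphere_continuous:
  "continuous_on (square_of d \<times> sphere 1 \<rho>) (\<lambda>((h, j), \<zeta>). cycle_root h j \<zeta>)"
  by (rule cycle_root_continuous) (use \<rho> cycle_perturbation_le_half in \<open>auto simp: square_of_def dist_norm norm_minus_commute\<close>)

lemma cycle_root_sphere_continuous_comp:
  assumes "continuous_on S h" "continuous_on S j" "continuous_on S z"
    "\<And>x. x \<in> S \<Longrightarrow> (h x, j x) \<in> square_of d \<and> z x \<in> sphere 1 \<rho>"
  shows "continuous_on S (\<lambda>x. cycle_root (h x) (j x) (z x))"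
proof -
  have "continuous_on S (\<lambda>x. (\<lambda>((h, j), \<zeta>). cycle_root h j \<zeta>) ((h x, j x), z x))"
    by (rule continuous_on_compose2[OF cycle_root_sphere_continuous])
       (use assms in \<open>auto intro!: continuous_intros\<close>)
  then show ?thesis by simp
qed

lemma cycle_root_sphere_continuous_fixed:
  assumes "(h, j) \<in> square_of d"
  shows "continuous_on (sphere 1 \<rho>) (cycle_root h j)"
  using cycle_root_sphere_continuous_comp[of "sphere 1 \<rho>" "\<lambda>_. h" "\<lambda>_. j" "\<lambda>\<zeta>. \<zeta>"] assms
  by (simp add: continuous_on_id del: mem_sphere)

lemma cycle_integrand_integrable:
  assumes "(h, j) \<in> square_of d"
  shows "(\<lambda>\<zeta>. cycle_root h j \<zeta> / (1 - \<zeta>\<^sup>2)) contour_integrable_on circlepath 1 \<rho>"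
proof (rule contour_integrable_continuous_circlepath)
  have "continuous_on (sphere 1 \<rho>) (\<lambda>\<zeta>. cycle_root h j \<zeta> / (1 - \<zeta>\<^sup>2))"
    by (intro continuous_intros cycle_root_sphere_continuous_fixed[OF assms])
       (use cycle_root_sphere_nz(2)[OF assms assms] in auto)
  then show "continuous_on (path_image (circlepath 1 \<rho>)) (\<lambda>\<zeta>. cycle_root h j \<zeta> / (1 - \<zeta>\<^sup>2))"
    using \<rho> by simp
qed

lemma cycle_slopes_continuous:
  "continuous_on (square_of d \<times> square_of d) (\<lambda>(p, p'). cycle_slope_h \<rho> p p')"
  "continuous_on (square_of d \<times> square_of d) (\<lambda>(p, p'). cycle_slope_j \<rho> p p')"
proof -
  let ?S = "(square_of d \<times> square_of d) \<times> sphere (1::complex) \<rho>"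
  have c: "continuous_on ?S (\<lambda>x. cycle_root (fst (fst (fst x))) (snd (fst (fst x))) (snd x)
      + cycle_root (fst (snd (fst x))) (snd (snd (fst x))) (snd x))"
    by (intro continuous_intros cycle_root_sphere_continuous_comp) auto
  have nz: "cycle_root (fst (fst (fst x))) (snd (fst (fst x))) (snd x)
      + cycle_root (fst (snd (fst x))) (snd (snd (fst x))) (snd x) \<noteq> 0" "1 - (snd x)\<^sup>2 \<noteq> 0" if "x \<in> ?S" for x
    using that cycle_root_sphere_nz by auto
  have "continuous_on (square_of d \<times> square_of d) (\<lambda>p. contour_integral (circlepath 1 \<rho>)
      (\<lambda>\<zeta>. 2 / (cycle_root (fst (fst p)) (snd (fst p)) \<zeta> + cycle_root (fst (snd p)) (snd (snd p)) \<zeta>)))"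
    by (rule circle_integral_continuous[OF _ \<rho>(1)])
       (unfold case_prod_unfold, intro continuous_intros c, use nz in auto)
  then show "continuous_on (square_of d \<times> square_of d) (\<lambda>(p, p'). cycle_slope_h \<rho> p p')"
    unfolding cycle_slope_h_def case_prod_unfold by (intro continuous_intros)
  have "continuous_on (square_of d \<times> square_of d) (\<lambda>p. contour_integral (circlepath 1 \<rho>)
      (\<lambda>\<zeta>. (of_real (snd (fst p)) + of_real (snd (snd p))) / ((1 - \<zeta>\<^sup>2) *
        (cycle_root (fst (fst p)) (snd (fst p)) \<zeta> + cycle_root (fst (snd p)) (snd (snd p)) \<zeta>))))"
    by (rule circle_integral_continuous[OF _ \<rho>(1)])
       (unfold case_prod_unfold, intro continuous_intros c, use nz in auto)
  then show "continuous_on (square_of d \<times> square_of d) (\<lambda>(p, p'). cycle_slope_j \<rho> p p')"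
    unfolding cycle_slope_j_def case_prod_unfold by (intro continuous_intros)
qed

lemma cycle_integral_diff:
  assumes p: "(h, j) \<in> square_of d" and p': "(h', j') \<in> square_of d"
  shows "cycle_integral \<rho> h' j' - cycle_integral \<rho> h j =
    of_real (h' - h) * cycle_slope_h \<rho> (h, j) (h', j') - of_real (j' - j) * cycle_slope_j \<rho> (h, j) (h', j')"
proof -
  let ?w = "cycle_root h j" and ?w' = "cycle_root h' j'"
  have int: "f contour_integrable_on circlepath 1 \<rho>" if "continuous_on (sphere 1 \<rho>) f" for f
    using that \<rho> by (intro contour_integrable_continuous_circlepath) auto
  have c: "continuous_on (sphere 1 \<rho>) ?w" "continuous_on (sphere 1 \<rho>) ?w'"
    by (rule cycle_root_sphere_continuous_fixed[OF p] cycle_root_sphere_continuous_fixed[OF p'])+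
  note nz = cycle_root_sphere_nz[OF p p']
  have i: "(\<lambda>\<zeta>. ?w \<zeta> / (1 - \<zeta>\<^sup>2)) contour_integrable_on circlepath 1 \<rho>"
      "(\<lambda>\<zeta>. ?w' \<zeta> / (1 - \<zeta>\<^sup>2)) contour_integrable_on circlepath 1 \<rho>"
      "(\<lambda>\<zeta>. 2 / (?w \<zeta> + ?w' \<zeta>)) contour_integrable_on circlepath 1 \<rho>"
      "(\<lambda>\<zeta>. (of_real j + of_real j') / ((1 - \<zeta>\<^sup>2) * (?w \<zeta> + ?w' \<zeta>))) contour_integrable_on circlepath 1 \<rho>"
       apply (rule cycle_integrand_integrable[OF p], rule cycle_integrand_integrable[OF p'])
    by (intro int continuous_intros c; use nz in auto)+
  have eq: "?w' \<zeta> / (1 - \<zeta>\<^sup>2) - ?w \<zeta> / (1 - \<zeta>\<^sup>2) =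
      of_real (h' - h) * (2 / (?w \<zeta> + ?w' \<zeta>))
      - of_real (j' - j) * ((of_real j + of_real j') / ((1 - \<zeta>\<^sup>2) * (?w \<zeta> + ?w' \<zeta>)))"
    if "\<zeta> \<in> sphere 1 \<rho>" for \<zeta>
  proof -
    define s where "s = ?w \<zeta> + ?w' \<zeta>"
    define u where "u = 1 - \<zeta>\<^sup>2"
    have s: "s \<noteq> 0" and u: "u \<noteq> 0" using nz[OF that] by (simp_all add: s_def u_def)
    have "norm (\<zeta> - 1) = \<rho>" using that by (simp add: dist_norm norm_minus_commute)
    then have sq: "(?w \<zeta>)\<^sup>2 = pendulum_P h j \<zeta>" "(?w' \<zeta>)\<^sup>2 = pendulum_P h' j' \<zeta>"
      using \<rho> by (intro cycle_root_square; simp)+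
    have "(?w' \<zeta> - ?w \<zeta>) * s = (?w' \<zeta>)\<^sup>2 - (?w \<zeta>)\<^sup>2"
      by (simp add: s_def algebra_simps power2_eq_square)
    also have "\<dots> = 2 * u * of_real (h' - h) - of_real (j' - j) * (of_real j + of_real j')"
      unfolding sq by (simp add: u_def pendulum_P_def algebra_simps power2_eq_square)
    finally have "(?w' \<zeta> - ?w \<zeta>) * s = \<dots>" .
    then have "?w' \<zeta> - ?w \<zeta> = (2 * u * of_real (h' - h) - of_real (j' - j) * (of_real j + of_real j')) / s"
      using s by (simp add: eq_divide_eq)
    then have "(?w' \<zeta> - ?w \<zeta>) / u = of_real (h' - h) * (2 / s) - of_real (j' - j) * ((of_real j + of_real j') / (u * s))"
      using s u by (simp add: divide_simps) (simp add: algebra_simps)?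
    then show ?thesis unfolding s_def[symmetric] u_def[symmetric] by (simp add: diff_divide_distrib)
  qed
  have "contour_integral (circlepath 1 \<rho>) (\<lambda>\<zeta>. ?w' \<zeta> / (1 - \<zeta>\<^sup>2)) - contour_integral (circlepath 1 \<rho>) (\<lambda>\<zeta>. ?w \<zeta> / (1 - \<zeta>\<^sup>2))
      = contour_integral (circlepath 1 \<rho>) (\<lambda>\<zeta>. ?w' \<zeta> / (1 - \<zeta>\<^sup>2) - ?w \<zeta> / (1 - \<zeta>\<^sup>2))"
    by (rule contour_integral_diff[OF i(2,1), symmetric])
  also have "\<dots> = contour_integral (circlepath 1 \<rho>) (\<lambda>\<zeta>. of_real (h' - h) * (2 / (?w \<zeta> + ?w' \<zeta>))
      - of_real (j' - j) * ((of_real j + of_real j') / ((1 - \<zeta>\<^sup>2) * (?w \<zeta> + ?w' \<zeta>))))"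
    by (rule contour_integral_cong[OF refl]) (use eq \<rho> in auto)
  also have "\<dots> = of_real (h' - h) * contour_integral (circlepath 1 \<rho>) (\<lambda>\<zeta>. 2 / (?w \<zeta> + ?w' \<zeta>))
      - of_real (j' - j) * contour_integral (circlepath 1 \<rho>) (\<lambda>\<zeta>. (of_real j + of_real j') / ((1 - \<zeta>\<^sup>2) * (?w \<zeta> + ?w' \<zeta>)))"
    by (simp only: contour_integral_diff contour_integral_lmul contour_integrable_lmul i)
  finally have diff: "contour_integral (circlepath 1 \<rho>) (\<lambda>\<zeta>. ?w' \<zeta> / (1 - \<zeta>\<^sup>2)) - contour_integral (circlepath 1 \<rho>) (\<lambda>\<zeta>. ?w \<zeta> / (1 - \<zeta>\<^sup>2)) = \<dots>" .
  have arith: "k * X - k * Y = a * (k * M) - b * (k * N)" if "X - Y = a * M - b * N" for k X Y a b M N :: complex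
    using arg_cong[OF that, of "\<lambda>x. k * x"] by (simp add: algebra_simps)
  show ?thesis
    unfolding cycle_integral_def cycle_slope_h_def cycle_slope_j_def case_prod_conv
    by (rule arith[OF diff])
qed

text \<open>
  The exact increments have continuous coefficients, whose values on the diagonal are the partial
  derivatives.
\<close>

lemma cycle_integral_has_derivative:
  assumes "\<bar>h\<bar> < d" "\<bar>j\<bar> < d"
  shows "((\<lambda>(h, j). cycle_integral \<rho> h j) has_derivative
    (\<lambda>(\<alpha>, \<beta>). of_real \<alpha> * cycle_slope_h \<rho> (h, j) (h, j) - of_real \<beta> * cycle_slope_j \<rho> (h, j) (h, j))) (at (h, j))"
proof -
  define U where "U = {-d<..<d} \<times> {-d<..<d}"
  have U: "open U" "(h, j) \<in> U" "U \<subseteq> square_of d"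
    using assms by (auto simp: U_def square_of_def open_Times)
  define M where "M = (\<lambda>p. cycle_slope_h \<rho> (h, j) p)"
  define N where "N = (\<lambda>p. cycle_slope_j \<rho> (h, j) p)"
  have "continuous_on U (\<lambda>p. (\<lambda>(p, p'). cycle_slope_h \<rho> p p') ((h, j), p))"
      "continuous_on U (\<lambda>p. (\<lambda>(p, p'). cycle_slope_j \<rho> p p') ((h, j), p))"
    by (rule continuous_on_compose2[OF cycle_slopes_continuous(1)] continuous_on_compose2[OF cycle_slopes_continuous(2)];
        use U in \<open>auto intro!: continuous_intros\<close>)+
  then have "isCont M (h, j)" "isCont N (h, j)"
    using U by (auto simp: M_def N_def continuous_on_eq_continuous_at)
  then have lim: "(\<lambda>p. norm (M p - M (h, j)) + norm (N p - N (h, j))) \<midarrow>(h, j)\<rightarrow>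
      norm (M (h, j) - M (h, j)) + norm (N (h, j) - N (h, j))"
    unfolding isCont_def by (intro tendsto_intros)
  obtain e where e: "e > 0" "ball (h, j) e \<subseteq> U" using U open_contains_ball by blast
  show ?thesis
  proof (rule has_derivativeI_sandwich[OF e(1), where H="\<lambda>p. norm (M p - M (h, j)) + norm (N p - N (h, j))"])
    show "bounded_linear (\<lambda>(\<alpha>, \<beta>). of_real \<alpha> * cycle_slope_h \<rho> (h, j) (h, j) - of_real \<beta> * cycle_slope_j \<rho> (h, j) (h, j))"
      unfolding case_prod_unfold
      by (intro bounded_linear_sub bounded_linear_compose[OF bounded_linear_mult_left]
          bounded_linear_compose[OF bounded_linear_of_real] bounded_linear_fst bounded_linear_snd)
    show "(\<lambda>p. norm (M p - M (h, j)) + norm (N p - N (h, j))) \<midarrow>(h, j)\<rightarrow> 0"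
      using lim by simp
    fix p assume p: "p \<noteq> (h, j)" "dist p (h, j) < e"
    obtain h' j' where hj': "p = (h', j')" by (cases p)
    have "(h', j') \<in> square_of d" "(h, j) \<in> square_of d"
      using p e(2) U subsetD[OF e(2), of p] by (auto simp: hj'[symmetric] dist_commute)
    note diff = cycle_integral_diff[OF this(2,1)]
    have "norm ((case p of (h, j) \<Rightarrow> cycle_integral \<rho> h j) - (case (h, j) of (h, j) \<Rightarrow> cycle_integral \<rho> h j)
        - (case p - (h, j) of (\<alpha>, \<beta>) \<Rightarrow> of_real \<alpha> * M (h, j) - of_real \<beta> * N (h, j)))
      = norm (of_real (h' - h) * (M p - M (h, j)) - of_real (j' - j) * (N p - N (h, j)))"
      by (simp only: hj' case_prod_conv diff_Pair diff M_def N_def) (simp add: algebra_simps)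
    also have "\<dots> \<le> \<bar>h' - h\<bar> * norm (M p - M (h, j)) + \<bar>j' - j\<bar> * norm (N p - N (h, j))"
      by (rule order_trans[OF norm_triangle_ineq4]) (simp add: norm_mult del: of_real_diff)
    also have "\<dots> \<le> norm (p - (h, j)) * norm (M p - M (h, j)) + norm (p - (h, j)) * norm (N p - N (h, j))"
      using norm_fst_le[of "h' - h" "j' - j"] norm_snd_le[of "j' - j" "h' - h"]
      by (intro add_mono mult_right_mono) (auto simp: hj')
    also have "\<dots> = norm (p - (h, j)) * (norm (M p - M (h, j)) + norm (N p - N (h, j)))"
      by (simp add: distrib_left)
    finally show "norm ((case p of (h, j) \<Rightarrow> cycle_integral \<rho> h j) - (case (h, j) of (h, j) \<Rightarrow> cycle_integral \<rho> h j)
        - (case p - (h, j) of (\<alpha>, \<beta>) \<Rightarrow> of_real \<alpha> * cycle_slope_h \<rho> (h, j) (h, j) - of_real \<beta> * cycle_slope_j \<rho> (h, j) (h, j)))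
        / norm (p - (h, j)) \<le> norm (M p - M (h, j)) + norm (N p - N (h, j))"
      using p(1) by (simp add: M_def N_def divide_le_eq mult.commute)
  qed
qed

lemma cycle_slope_h_0: "cycle_slope_h \<rho> (0, 0) (0, 0) = 1"
proof -
  have "((\<lambda>\<zeta>. (1 / csqrt (2 * (\<zeta> + 1))) / (\<zeta> - 1)) has_contour_integral
      2 * of_real pi * \<i> * (1 / csqrt (2 * (1 + 1)))) (circlepath 1 \<rho>)"
  proof (rule Cauchy_integral_circlepath)
    have "(\<lambda>\<zeta>. 1 / csqrt (2 * (\<zeta> + 1))) holomorphic_on cball 1 \<rho>"
      using \<rho> by (intro holomorphic_intros csqrt_two_plus) (auto simp: dist_norm norm_minus_commute csqrt_two_plus)
    then show "continuous_on (cball 1 \<rho>) (\<lambda>\<zeta>. 1 / csqrt (2 * (\<zeta> + 1)))"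
        "(\<lambda>\<zeta>. 1 / csqrt (2 * (\<zeta> + 1))) holomorphic_on ball 1 \<rho>"
      by (auto intro: holomorphic_on_imp_continuous_on holomorphic_on_subset[OF _ ball_subset_cball])
  qed (use \<rho> in simp)
  moreover have "csqrt (2 * (1 + 1)) = 2" using csqrt_of_real[of 4] by simp
  ultimately have "contour_integral (circlepath 1 \<rho>) (\<lambda>\<zeta>. (1 / csqrt (2 * (\<zeta> + 1))) / (\<zeta> - 1)) = of_real pi * \<i>"
    by (simp add: contour_integral_unique)
  moreover have "(\<lambda>\<zeta>. 2 / (cycle_root 0 0 \<zeta> + cycle_root 0 0 \<zeta>)) = (\<lambda>\<zeta>. (1 / csqrt (2 * (\<zeta> + 1))) / (\<zeta> - 1))"
    by (simp add: fun_eq_iff cycle_root_def cycle_perturbation_def mult.commute)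
  ultimately show ?thesis unfolding cycle_slope_h_def by simp
qed

end

lemma cycle_root_0: "cycle_root 0 0 \<zeta> = (\<zeta> - 1) * csqrt (2 * (\<zeta> + 1))"
  by (simp add: cycle_root_def cycle_perturbation_def)

lemma norm_diff_of_mem_sphere:
  assumes "\<zeta> \<in> sphere 1 \<rho>"
  shows "norm (\<zeta> - (1::complex)) = \<rho>"
  using assms by (simp add: dist_norm norm_minus_commute)

lemma eventually_square: "d > 0 \<Longrightarrow> \<forall>\<^sub>F (h, j) in nhds (0, 0). \<bar>h\<bar> < d \<and> \<bar>j :: real\<bar> < (d :: real)"
  unfolding eventually_nhds
  by (rule exI[of _ "{-d<..<d} \<times> {-d<..<d}"]) (auto simp: open_Times)

lemma isCont_imp_tendsto_nhds: "isCont g l \<Longrightarrow> (g \<longlongrightarrow> g l) (nhds l)"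
  by (simp add: isCont_def tendsto_at_iff_tendsto_nhds)

text \<open>
  On the circle \<open>w\<close> and \<open>cycle_root\<close> have the same square and no zeros, so their quotient is a
  constant sign.  Near the origin of the parameters both are close to the same nonzero number at
  \<open>\<zeta> = 1 + \<rho>\<close>, so the sign is \<open>+\<close>.  The cycle runs twice around the circle, which is the factor 2 hidden in the
  normalisation of \<open>cycle_integral\<close>.
\<close>

lemma elliptic_J1_eq_cycle_integral:
  assumes \<rho>: "0 < \<rho>" "\<rho> < 2" and w: "vanishing_cycle_branch \<rho> w"
  shows "\<forall>\<^sub>F (h, j) in nhds (0, 0). elliptic_J1 \<rho> w h j = cycle_integral \<rho> h j"
proof -
  obtain d where d: "d > 0" and small: "cycle_small \<rho> d"
    using ex_cycle_small[OF \<rho>] by blast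
  note nz = cycle_root_sphere_nz[OF \<rho> d small] and cont = cycle_root_sphere_continuous_comp[OF \<rho> d small]
  \<comment> \<open>A point of the circle at which the sign is read off.\<close>
  define z where "z = complex_of_real (1 + \<rho>)"
  have z: "z \<in> sphere 1 \<rho>" using \<rho> by (simp add: z_def dist_norm)
  have "continuous_on ({-d<..<d} \<times> {-d<..<d}) (\<lambda>p. cycle_root (fst p) (snd p) z)"
    using z by (intro cont continuous_intros) (auto simp: square_of_def)
  then have "isCont (\<lambda>p. cycle_root (fst p) (snd p) z) (0, 0)"
    using d by (subst (asm) continuous_on_eq_continuous_at) (auto simp: open_Times)
  from isCont_imp_tendsto_nhds[OF this]
  have "((\<lambda>p. cycle_root (fst p) (snd p) z) \<longlongrightarrow> cycle_root 0 0 z) (nhds (0, 0))"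
    by simp
  moreover have "((\<lambda>p. w (fst p) (snd p) z) \<longlongrightarrow> cycle_root 0 0 z) (nhds (0, 0))"
    using w z by (auto simp: vanishing_cycle_branch_def cycle_root_0 case_prod_unfold)
  ultimately have "((\<lambda>p. w (fst p) (snd p) z + cycle_root (fst p) (snd p) z) \<longlongrightarrow>
      cycle_root 0 0 z + cycle_root 0 0 z) (nhds (0, 0))"
    by (rule tendsto_add[rotated])
  moreover have "cycle_root 0 0 z + cycle_root 0 0 z \<noteq> 0"
    by (rule nz(1)) (use z d in \<open>simp_all add: square_of_def\<close>)
  ultimately have ev: "\<forall>\<^sub>F p in nhds (0, 0). w (fst p) (snd p) z + cycle_root (fst p) (snd p) z \<noteq> 0"
    by (rule tendsto_imp_eventually_ne)
  have ev2: "\<forall>\<^sub>F (h, j) in nhds (0, 0). continuous_on (sphere 1 \<rho>) (w h j) \<and>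
      (\<forall>\<zeta>\<in>sphere 1 \<rho>. (w h j \<zeta>)\<^sup>2 = pendulum_P h j \<zeta>)"
    using w by (simp add: vanishing_cycle_branch_def)
  show ?thesis
    using ev ev2 eventually_square[OF d]
  proof eventually_elim
    case (elim p)
    obtain h j where p: "p = (h, j)" by (cases p)
    have hj: "\<bar>h\<bar> < d" "\<bar>j\<bar> < d" "(h, j) \<in> square_of d"
      and sum: "w h j z + cycle_root h j z \<noteq> 0"
      and wc: "continuous_on (sphere 1 \<rho>) (w h j)" and sq: "\<And>\<zeta>. \<zeta> \<in> sphere 1 \<rho> \<Longrightarrow> (w h j \<zeta>)\<^sup>2 = pendulum_P h j \<zeta>"
      using elim by (auto simp: p square_of_def)
    define g where "g = (\<lambda>\<zeta>. w h j \<zeta> / cycle_root h j \<zeta>)"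
    have rc: "continuous_on (sphere 1 \<rho>) (cycle_root h j)"
      by (rule cycle_root_sphere_continuous_fixed[OF \<rho> d small hj(3)])
    have g1: "g \<zeta> = 1 \<or> g \<zeta> = -1" if "\<zeta> \<in> sphere 1 \<rho>" for \<zeta>
    proof -
      have rsq: "(cycle_root h j \<zeta>)\<^sup>2 = pendulum_P h j \<zeta>"
        by (rule cycle_root_square) (use norm_diff_of_mem_sphere[OF that] \<rho> in simp_all)
      have "(g \<zeta>)\<^sup>2 = 1"
        unfolding g_def power_divide sq[OF that] rsq
        using rsq nz(3)[OF hj(3) hj(3) that] by (metis divide_self power_not_zero)
      then show ?thesis by (simp add: power2_eq_1_iff)
    qed
    have "g constant_on sphere 1 \<rho>"
    proof (rule continuous_finite_range_constant)
      show "connected (sphere (1::complex) \<rho>)" by (intro connected_sphere) simp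
      show "continuous_on (sphere 1 \<rho>) g"
        unfolding g_def by (intro continuous_intros wc rc) (use nz(3)[OF hj(3) hj(3)] in auto)
      show "finite (g ` sphere 1 \<rho>)" by (rule finite_subset[of _ "{1, -1}"]) (use g1 in blast, simp)
    qed
    then have "g \<zeta> = g z" if "\<zeta> \<in> sphere 1 \<rho>" for \<zeta>
      using that z by (auto simp: constant_on_def)
    moreover have "g z = 1"
      using g1[OF z] sum nz(3)[OF hj(3) hj(3) z] by (auto simp: g_def field_simps)
    ultimately have eq: "w h j \<zeta> = cycle_root h j \<zeta>" if "\<zeta> \<in> sphere 1 \<rho>" for \<zeta>
      using that nz(3)[OF hj(3) hj(3) that] by (simp add: g_def field_simps)
    have img: "path_image (vanishing_cycle \<rho>) = sphere 1 \<rho>"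
      using \<rho> by (simp add: vanishing_cycle_def path_image_join)
    note int = cycle_integrand_integrable[OF \<rho> d small hj(3)]
    have "contour_integral (vanishing_cycle \<rho>) (\<lambda>\<zeta>. w h j \<zeta> / (1 - \<zeta>\<^sup>2))
        = contour_integral (vanishing_cycle \<rho>) (\<lambda>\<zeta>. cycle_root h j \<zeta> / (1 - \<zeta>\<^sup>2))"
      by (rule contour_integral_cong[OF refl]) (simp add: img eq del: mem_sphere)
    also have "\<dots> = 2 * contour_integral (circlepath 1 \<rho>) (\<lambda>\<zeta>. cycle_root h j \<zeta> / (1 - \<zeta>\<^sup>2))"
      by (simp add: vanishing_cycle_def int)
    finally show ?case by (simp add: p elliptic_J1_def cycle_integral_def)
  qed
qed

section \<open>Taylor expansion of the elliptic integral\<close>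

text \<open>
  This is \<open>-\<surd>2\<close> times the principal power of \<open>1 + \<zeta>\<close> with exponent \<open>-m - 1/2\<close>.  For \<open>m = 0\<close> it is the
  unperturbed integrand \<open>w / (1 - \<zeta>\<^sup>2)\<close>.
\<close>

definition half_power :: "nat \<Rightarrow> complex \<Rightarrow> complex"
  where "half_power m \<zeta> = - csqrt (2 * (\<zeta> + 1)) / (\<zeta> + 1) ^ Suc m"

lemma half_power_has_derivative:
  assumes "\<zeta> \<in> ball 1 2"
  shows "(half_power m has_field_derivative - (of_nat m + 1/2) * half_power (Suc m) \<zeta>) (at \<zeta>)"
proof -
  have n: "norm (\<zeta> - 1) < 2" using assms by (simp add: dist_norm norm_minus_commute)
  have nz: "\<zeta> + 1 \<noteq> 0" using csqrt_two_plus(2)[OF n] by (metis csqrt_0 mult_zero_right)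
  define s where "s = csqrt (2 * (\<zeta> + 1))"
  have s: "s \<noteq> 0" "s * s = 2 * (\<zeta> + 1)"
    using csqrt_two_plus(2)[OF n] power2_csqrt[of "2 * (\<zeta> + 1)"] by (simp_all add: s_def power2_eq_square)
  have 1: "((\<lambda>\<zeta>. csqrt (2 * (\<zeta> + 1))) has_field_derivative 1 / s) (at \<zeta>)"
    unfolding s_def using csqrt_two_plus[OF n] by (auto intro!: derivative_eq_intros simp: field_simps)
  have 1: "((\<lambda>\<zeta>. csqrt (2 * (\<zeta> + 1))) has_field_derivative s / (2 * (\<zeta> + 1))) (at \<zeta>)"
    using 1 s(1) unfolding s(2)[symmetric] by simp
  have arith: "(- (s / (2 * u)) * u ^ Suc m - - s * (of_nat (Suc m) * u ^ m)) / (u ^ Suc m * u ^ Suc m)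
      = - (of_nat m + 1/2) * (- s / u ^ Suc (Suc m))" if "u \<noteq> 0" for u :: complex
    using that by (simp add: divide_simps) (simp add: algebra_simps)
  have pow: "((\<lambda>\<zeta>. (\<zeta> + 1) ^ Suc m) has_field_derivative of_nat (Suc m) * (\<zeta> + 1) ^ m) (at \<zeta>)"
    by (rule DERIV_cong[OF DERIV_power[where n="Suc m", OF DERIV_add[OF DERIV_ident DERIV_const]]]) simp
  have "(half_power m has_field_derivative
      (- (s / (2 * (\<zeta> + 1))) * (\<zeta> + 1) ^ Suc m - - s * (of_nat (Suc m) * (\<zeta> + 1) ^ m)) / ((\<zeta> + 1) ^ Suc m * (\<zeta> + 1) ^ Suc m)) (at \<zeta>)"
    unfolding half_power_def[abs_def] using DERIV_divide[OF DERIV_minus[OF 1] pow] nz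
    by (simp add: s_def)
  also have "(- (s / (2 * (\<zeta> + 1))) * (\<zeta> + 1) ^ Suc m - - s * (of_nat (Suc m) * (\<zeta> + 1) ^ m)) / ((\<zeta> + 1) ^ Suc m * (\<zeta> + 1) ^ Suc m)
     = - (of_nat m + 1/2) * half_power (Suc m) \<zeta>"
    unfolding half_power_def s_def[symmetric] by (rule arith[OF nz])
  finally show ?thesis .
qed

lemma half_power_holomorphic: "half_power m holomorphic_on ball 1 2"
  using half_power_has_derivative by (meson has_field_derivative_at_within holomorphic_on_def field_differentiable_def)

lemma higher_deriv_half_power:
  assumes "\<zeta> \<in> ball 1 2"
  shows "(deriv ^^ k) (half_power m) \<zeta> = (-1) ^ k * pochhammer (of_nat m + 1/2) k * half_power (m + k) \<zeta>"
  using assms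
proof (induction k arbitrary: \<zeta>)
  case (Suc k)
  have ev: "\<forall>\<^sub>F x in nhds \<zeta>. (deriv ^^ k) (half_power m) x = (-1) ^ k * pochhammer (of_nat m + 1/2) k * half_power (m + k) x"
    using Suc.prems by (intro eventually_mono[OF eventually_nhds_in_open[of "ball 1 2" \<zeta>]] Suc.IH) auto
  have "(deriv ^^ Suc k) (half_power m) \<zeta> = deriv (\<lambda>x. (-1) ^ k * pochhammer (of_nat m + 1/2) k * half_power (m + k) x) \<zeta>"
    by (simp add: deriv_cong_ev[OF ev refl])
  also have "\<dots> = (-1) ^ k * pochhammer (of_nat m + 1/2) k * (- (of_nat (m + k) + 1/2) * half_power (Suc (m + k)) \<zeta>)"
    by (intro DERIV_imp_deriv DERIV_cmult half_power_has_derivative Suc.prems)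
  finally show ?case by (simp add: pochhammer_Suc algebra_simps)
qed simp

text \<open>
  The residue at \<open>\<zeta> = 1\<close> of \<open>half_power m\<close> over \<open>(1 - \<zeta>)\<^sup>N\<close>, doubled.
\<close>

definition cycle_moment :: "nat \<Rightarrow> nat \<Rightarrow> real"
  where "cycle_moment m N = (if N = 0 then 0 else
    2 * pochhammer (of_nat m + 1/2) (N - 1) / (fact (N - 1) * 2 ^ (m + N - 1)))"

lemma half_power_1: "half_power n 1 = - (1 / 2 ^ n)"
  using csqrt_of_real[of 4] by (simp add: half_power_def)

lemma half_power_contour_integral:
  assumes "0 < \<rho>" "\<rho> < 2"
  shows "((\<lambda>\<zeta>. half_power m \<zeta> / (1 - \<zeta>) ^ N) has_contour_integral
    of_real pi * \<i> * of_real (cycle_moment m N)) (circlepath 1 \<rho>)"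
proof -
  have hol: "half_power m holomorphic_on cball 1 \<rho>"
    by (rule holomorphic_on_subset[OF half_power_holomorphic]) (use assms in auto)
  show ?thesis
  proof (cases N)
    case 0
    have "(half_power m has_contour_integral 0) (circlepath 1 \<rho>)"
      by (rule Cauchy_theorem_convex_simple[OF half_power_holomorphic]) (use assms in auto)
    with 0 show ?thesis by (simp add: cycle_moment_def)
  next
    case (Suc k)
    have "((\<lambda>u. half_power m u / (u - 1) ^ Suc k) has_contour_integral
        (2 * pi * \<i>) / fact k * (deriv ^^ k) (half_power m) 1) (circlepath 1 \<rho>)"
      by (rule Cauchy_has_contour_integral_higher_derivative_circlepath)
         (use assms hol in \<open>auto intro: holomorphic_on_imp_continuous_on holomorphic_on_subset[OF _ ball_subset_cball]\<close>)
    then have "((\<lambda>u. (-1) ^ N * (half_power m u / (u - 1) ^ Suc k)) has_contour_integral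
        (-1) ^ N * ((2 * pi * \<i>) / fact k * (deriv ^^ k) (half_power m) 1)) (circlepath 1 \<rho>)"
      by (rule has_contour_integral_lmul)
    moreover have "(\<lambda>u. (-1) ^ N * (half_power m u / (u - 1) ^ Suc k)) = (\<lambda>\<zeta>. half_power m \<zeta> / (1 - \<zeta>) ^ N)"
    proof
      fix u :: complex
      have "(1 - u) ^ N = (-1) ^ N * (u - 1) ^ N"
        by (metis minus_diff_eq mult_minus1 power_mult_distrib)
      moreover have "(-1 :: complex) ^ N * (-1) ^ N = 1" by (simp flip: power_mult_distrib)
      ultimately show "(-1) ^ N * (half_power m u / (u - 1) ^ Suc k) = half_power m u / (1 - u) ^ N"
        by (simp add: Suc divide_simps)
    qed
    moreover have "(-1) ^ N * ((2 * pi * \<i>) / fact k * (deriv ^^ k) (half_power m) 1) = of_real pi * \<i> * of_real (cycle_moment m N)"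
    proof -
      have poch: "pochhammer (of_nat m + 1/2 :: complex) k = of_real (pochhammer (of_nat m + 1/2) k)"
        using pochhammer_of_real[of "of_nat m + 1/2" k, where 'a=complex] by simp
      have "(-1 :: complex) ^ k * (-1) ^ k = 1" by (simp flip: power_mult_distrib)
      then have "(-1) ^ N * ((2 * pi * \<i>) / fact k * (deriv ^^ k) (half_power m) 1)
        = (2 * pi * \<i>) / fact k * (pochhammer (of_nat m + 1/2) k * (1 / 2 ^ (m + k)))"
        by (subst higher_deriv_half_power) (simp_all add: Suc half_power_1)
      also have "\<dots> = of_real pi * \<i> * of_real (cycle_moment m N)"
        unfolding poch by (simp add: cycle_moment_def Suc)
      finally show ?thesis .
    qed
    ultimately show ?thesis by simp
  qed
qed

definition sqrt_taylor :: "complex \<Rightarrow> complex"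
  where "sqrt_taylor x = (\<Sum>n\<le>5. of_real ((1/2) gchoose n) * x ^ n)"

lemma half_gchoose_values:
  "((1/2::real) gchoose 0) = 1" "((1/2::real) gchoose 1) = 1/2" "((1/2::real) gchoose 2) = -1/8"
  "((1/2::real) gchoose 3) = 1/16" "((1/2::real) gchoose 4) = -5/128" "((1/2::real) gchoose 5) = 7/256"
  by (simp_all add: gbinomial_prod_rev eval_nat_numeral)

lemma sqrt_taylor_explicit:
  "sqrt_taylor x = 1 + x/2 - x^2/8 + x^3/16 - 5/128 * x^4 + 7/256 * x^5"
proof -
  have "{..5::nat} = {0, 1, 2, 3, 4, 5}" by auto
  then show ?thesis
    by (simp add: sqrt_taylor_def half_gchoose_values[simplified] half_gchoose_values)
qed

text \<open>
  The difference of squares \<open>1 + x - T(x)\<^sup>2\<close> is \<open>x\<^sup>6 q(x)\<close> with an explicit polynomial \<open>q\<close>; dividing it by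
  \<open>csqrt (1 + x) + T(x)\<close>, which stays away from zero, bounds the remainder.
\<close>

lemma csqrt_taylor:
  assumes "norm (x::complex) \<le> 1/2"
  shows "norm (csqrt (1 + x) - sqrt_taylor x) \<le> norm x ^ 6"
proof -
  define q where "q = - (21/512 - 3/256 * x + 81/16384 * x^2 - 35/16384 * x^3 + 49/65536 * x^4)"
  have p: "norm x ^ n \<le> (1/2) ^ n" for n using assms by (intro power_mono) auto
  have sq: "1 + x - (sqrt_taylor x)\<^sup>2 = x ^ 6 * q"
    unfolding sqrt_taylor_explicit q_def by (simp add: field_simps power2_eq_square power_numeral_reduce)
  have "norm (x/2 - x^2/8 + x^3/16 - 5/128 * x^4 + 7/256 * x^5) \<le>
      norm x / 2 + norm x ^ 2 / 8 + norm x ^ 3 / 16 + 5/128 * norm x ^ 4 + 7/256 * norm x ^ 5"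
    by (intro order_trans[OF norm_triangle_ineq] order_trans[OF norm_triangle_ineq4] add_mono)
       (simp_all add: norm_mult norm_divide norm_power)
  also have "\<dots> \<le> 1/3"
    using p[of 1] p[of 2] p[of 3] p[of 4] p[of 5] by (simp add: power_numeral_reduce)
  finally have "norm (sqrt_taylor x - 1) \<le> 1/3" by (simp add: sqrt_taylor_explicit algebra_simps)
  then have "Re (sqrt_taylor x) \<ge> 2/3" using abs_Re_le_cmod[of "sqrt_taylor x - 1"] by auto
  then have "Re (csqrt (1 + x) + sqrt_taylor x) \<ge> 2/3"
    using one_plus_small(3)[OF assms] by (simp del: csqrt.sel)
  then have den: "norm (csqrt (1 + x) + sqrt_taylor x) \<ge> 2/3"
    using complex_Re_le_cmod order_trans by blast
  have "norm q \<le> 21/512 + 3/256 * norm x + 81/16384 * norm x ^ 2 + 35/16384 * norm x ^ 3 + 49/65536 * norm x ^ 4"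
    unfolding q_def norm_minus_cancel
    by (intro order_trans[OF norm_triangle_ineq] order_trans[OF norm_triangle_ineq4] add_mono)
       (simp_all add: norm_mult norm_divide norm_power)
  also have "\<dots> \<le> 2/3"
    using p[of 1] p[of 2] p[of 3] p[of 4] by (simp add: power_numeral_reduce)
  finally have q: "norm q \<le> 2/3" .
  have "(csqrt (1 + x) - sqrt_taylor x) * (csqrt (1 + x) + sqrt_taylor x) = (csqrt (1 + x))\<^sup>2 - (sqrt_taylor x)\<^sup>2"
    by (simp add: power2_eq_square algebra_simps)
  also have "\<dots> = x ^ 6 * q" using sq by (simp add: power2_csqrt)
  finally have "norm (csqrt (1 + x) - sqrt_taylor x) * norm (csqrt (1 + x) + sqrt_taylor x) = norm x ^ 6 * norm q"
    by (metis norm_mult norm_power)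
  moreover have "norm (csqrt (1 + x) - sqrt_taylor x) * (2/3) \<le> norm (csqrt (1 + x) - sqrt_taylor x) * norm (csqrt (1 + x) + sqrt_taylor x)"
    using den by (intro mult_left_mono) auto
  moreover have "norm x ^ 6 * norm q \<le> norm x ^ 6 * (2/3)" using q by (intro mult_left_mono) auto
  ultimately show ?thesis by simp
qed

text \<open>
  The Taylor polynomial of the square root, expanded by the binomial theorem and integrated term by
  term.  It contains some terms of order above five, which are harmless.
\<close>

definition cycle_taylor :: "real \<Rightarrow> real \<Rightarrow> real"
  where "cycle_taylor h j = (\<Sum>n\<le>5. ((1/2) gchoose n) *
    (\<Sum>m\<le>n. of_nat (n choose m) * (- (j\<^sup>2 / 2)) ^ m * h ^ (n - m) * cycle_moment m (n + m)))"

lemma cycle_taylor_contour_integral: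
  assumes \<rho>: "0 < \<rho>" "\<rho> < 2"
  shows "((\<lambda>\<zeta>. half_power 0 \<zeta> * sqrt_taylor (cycle_perturbation h j \<zeta>)) has_contour_integral
    of_real pi * \<i> * of_real (cycle_taylor h j)) (circlepath 1 \<rho>)"
proof -
  let ?j = "- (complex_of_real j ^ 2 / 2)"
  have "((\<lambda>\<zeta>. \<Sum>n\<le>5. of_real ((1/2) gchoose n) * (\<Sum>m\<le>n. (of_nat (n choose m) * ?j ^ m * of_real h ^ (n - m))
        * (half_power m \<zeta> / (1 - \<zeta>) ^ (n + m)))) has_contour_integral
      (\<Sum>n\<le>5. of_real ((1/2) gchoose n) * (\<Sum>m\<le>n. (of_nat (n choose m) * ?j ^ m * of_real h ^ (n - m))
        * (of_real pi * \<i> * of_real (cycle_moment m (n + m)))))) (circlepath 1 \<rho>)"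
    by (intro has_contour_integral_sum has_contour_integral_lmul half_power_contour_integral \<rho>) auto
  moreover have "(\<Sum>n\<le>5. of_real ((1/2) gchoose n) * (\<Sum>m\<le>n. (of_nat (n choose m) * ?j ^ m * of_real h ^ (n - m))
        * (of_real pi * \<i> * of_real (cycle_moment m (n + m))))) = of_real pi * \<i> * of_real (cycle_taylor h j)"
    by (simp add: cycle_taylor_def sum_distrib_left mult_ac)
  ultimately have int: "((\<lambda>\<zeta>. \<Sum>n\<le>5. of_real ((1/2) gchoose n) * (\<Sum>m\<le>n. (of_nat (n choose m) * ?j ^ m * of_real h ^ (n - m))
        * (half_power m \<zeta> / (1 - \<zeta>) ^ (n + m)))) has_contour_integral of_real pi * \<i> * of_real (cycle_taylor h j)) (circlepath 1 \<rho>)"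
    by simp
  show ?thesis
  proof (rule has_contour_integral_eq[OF int])
    fix \<zeta> assume "\<zeta> \<in> path_image (circlepath 1 \<rho>)"
    then have "norm (\<zeta> - 1) = \<rho>" using \<rho> by (simp add: dist_norm norm_minus_commute)
    then have nz: "1 - \<zeta> \<noteq> 0" "\<zeta> + 1 \<noteq> 0"
      using one_minus_square_nz[of \<zeta>] \<rho> by auto
    have pert: "cycle_perturbation h j \<zeta> = (?j / ((1 - \<zeta>) * (\<zeta> + 1)) + of_real h) / (1 - \<zeta>)"
    proof -
      have "1 - \<zeta>\<^sup>2 = (1 - \<zeta>) * (\<zeta> + 1)" by (simp add: algebra_simps power2_eq_square)
      then show ?thesis using nz by (simp add: cycle_perturbation_def divide_simps)
    qed
    have main: "half_power 0 \<zeta> * cycle_perturbation h j \<zeta> ^ n =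
        (\<Sum>m\<le>n. (of_nat (n choose m) * ?j ^ m * of_real h ^ (n - m)) * (half_power m \<zeta> / (1 - \<zeta>) ^ (n + m)))" for n
    proof -
      have "half_power 0 \<zeta> * cycle_perturbation h j \<zeta> ^ n =
        (\<Sum>m\<le>n. half_power 0 \<zeta> / (1 - \<zeta>) ^ n * (of_nat (n choose m) * (?j / ((1 - \<zeta>) * (\<zeta> + 1))) ^ m * of_real h ^ (n - m)))"
        unfolding pert power_divide[of _ "1 - \<zeta>"] binomial_ring sum_divide_distrib sum_distrib_left
        by (intro sum.cong) auto
      also have "\<dots> = (\<Sum>m\<le>n. (of_nat (n choose m) * ?j ^ m * of_real h ^ (n - m)) * (half_power m \<zeta> / (1 - \<zeta>) ^ (n + m)))"
      proof (rule sum.cong[OF refl])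
        fix m
        have "half_power m \<zeta> = half_power 0 \<zeta> / (\<zeta> + 1) ^ m" by (simp add: half_power_def)
        then show "half_power 0 \<zeta> / (1 - \<zeta>) ^ n * (of_nat (n choose m) * (?j / ((1 - \<zeta>) * (\<zeta> + 1))) ^ m * of_real h ^ (n - m))
          = (of_nat (n choose m) * ?j ^ m * of_real h ^ (n - m)) * (half_power m \<zeta> / (1 - \<zeta>) ^ (n + m))"
          by (simp only: power_divide power_mult_distrib power_add times_divide_eq_left times_divide_eq_right
                divide_divide_eq_left mult_ac)
      qed
      finally show ?thesis .
    qed
    show "(\<Sum>n\<le>5. of_real ((1/2) gchoose n) * (\<Sum>m\<le>n. (of_nat (n choose m) * ?j ^ m * of_real h ^ (n - m))
        * (half_power m \<zeta> / (1 - \<zeta>) ^ (n + m)))) = half_power 0 \<zeta> * sqrt_taylor (cycle_perturbation h j \<zeta>)"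
      unfolding main[symmetric] sqrt_taylor_def sum_distrib_left[of "half_power 0 \<zeta>"]
      by (simp only: mult.left_commute)
  qed
qed

text \<open>
  The remainder of the square root is of sixth order in the perturbation, uniformly on the circle.
\<close>

lemma cycle_integral_taylor:
  assumes \<rho>: "0 < \<rho>" "\<rho> < 2"
  obtains C d where "C > 0" "d > 0"
    "\<And>h j. \<bar>h\<bar> \<le> d \<Longrightarrow> \<bar>j\<bar> \<le> d \<Longrightarrow>
      norm (cycle_integral \<rho> h j - of_real (cycle_taylor h j)) \<le> C * (\<bar>h\<bar> + j\<^sup>2) ^ 6"
proof -
  obtain d where d: "d > 0" and small: "cycle_small \<rho> d"
    using ex_cycle_small[OF \<rho>] by blast
  obtain C where C: "C > 0" "\<And>h j \<zeta>. \<rho> \<le> norm (\<zeta> - 1) \<Longrightarrow> norm (\<zeta> - 1) \<le> \<rho> \<Longrightarrow>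
       norm (cycle_perturbation h j \<zeta>) \<le> C * (\<bar>h\<bar> + j\<^sup>2)"
    by (rule cycle_perturbation_le[OF \<rho>(1) order_refl \<rho>(2)]) (rule that; assumption)
  have "compact (half_power 0 ` sphere 1 \<rho>)"
    by (intro compact_continuous_image compact_sphere continuous_on_subset[OF holomorphic_on_imp_continuous_on[OF half_power_holomorphic]])
       (use \<rho> in auto)
  then obtain B where B: "B > 0" "\<And>\<zeta>. \<zeta> \<in> sphere 1 \<rho> \<Longrightarrow> norm (half_power 0 \<zeta>) \<le> B"
    using compact_imp_bounded bounded_pos by (metis image_eqI)
  show ?thesis
  proof (rule that[of "2 * \<rho> * B * C ^ 6" d])
    show "2 * \<rho> * B * C ^ 6 > 0" using \<rho> B C by simp
    fix h j :: real assume hj: "\<bar>h\<bar> \<le> d" "\<bar>j\<bar> \<le> d"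
    define I where "I = contour_integral (circlepath 1 \<rho>) (\<lambda>\<zeta>. cycle_root h j \<zeta> / (1 - \<zeta>\<^sup>2))"
    have p: "(h, j) \<in> square_of d" using hj by (simp add: square_of_def)
    have "((\<lambda>\<zeta>. cycle_root h j \<zeta> / (1 - \<zeta>\<^sup>2)) has_contour_integral I) (circlepath 1 \<rho>)"
      unfolding I_def by (rule has_contour_integral_integral[OF cycle_integrand_integrable[OF \<rho> d small p]])
    from has_contour_integral_diff[OF this cycle_taylor_contour_integral[OF \<rho>, of h j]]
    have bound: "norm (I - of_real pi * \<i> * of_real (cycle_taylor h j)) \<le> (B * (C * (\<bar>h\<bar> + j\<^sup>2)) ^ 6) * (2 * pi * \<rho>)"
    proof (rule has_contour_integral_bound_circlepath)
      fix \<zeta> assume z: "norm (\<zeta> - (1::complex)) = \<rho>"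
      then have zs: "\<zeta> \<in> sphere 1 \<rho>" by (simp add: dist_norm norm_minus_commute)
      have nz: "1 - \<zeta> \<noteq> 0" "\<zeta> + 1 \<noteq> 0" using one_minus_square_nz[of \<zeta>] z \<rho> by auto
      have sq: "1 - \<zeta>\<^sup>2 = (1 - \<zeta>) * (\<zeta> + 1)" by (simp add: algebra_simps power2_eq_square)
      let ?x = "cycle_perturbation h j \<zeta>"
      have "cycle_root h j \<zeta> / (1 - \<zeta>\<^sup>2) = half_power 0 \<zeta> * csqrt (1 + ?x)"
        unfolding sq cycle_root_def half_power_def using nz by (simp add: divide_simps) (simp add: algebra_simps)
      then have "norm (cycle_root h j \<zeta> / (1 - \<zeta>\<^sup>2) - half_power 0 \<zeta> * sqrt_taylor ?x)
          = norm (half_power 0 \<zeta>) * norm (csqrt (1 + ?x) - sqrt_taylor ?x)"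
        by (simp add: norm_mult flip: right_diff_distrib)
      also have "\<dots> \<le> B * norm ?x ^ 6"
        using B zs csqrt_taylor[OF cycle_perturbation_le_half[OF \<rho> d small hj z]] by (intro mult_mono) auto
      also have "\<dots> \<le> B * (C * (\<bar>h\<bar> + j\<^sup>2)) ^ 6"
        using B C(2)[of \<zeta> h j] z by (intro mult_left_mono power_mono) auto
      finally show "norm (cycle_root h j \<zeta> / (1 - \<zeta>\<^sup>2) - half_power 0 \<zeta> * sqrt_taylor ?x) \<le> B * (C * (\<bar>h\<bar> + j\<^sup>2)) ^ 6" .
    qed (use \<rho> B C in auto)
    have "cycle_integral \<rho> h j - of_real (cycle_taylor h j) =
        (1 / (of_real pi * \<i>)) * (I - of_real pi * \<i> * of_real (cycle_taylor h j))"
      by (simp add: cycle_integral_def I_def[symmetric] right_diff_distrib)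
    then have "norm (cycle_integral \<rho> h j - of_real (cycle_taylor h j)) =
        norm (I - of_real pi * \<i> * of_real (cycle_taylor h j)) / pi"
      by (simp only: norm_mult norm_divide) simp
    also have "\<dots> \<le> (B * (C * (\<bar>h\<bar> + j\<^sup>2)) ^ 6) * (2 * pi * \<rho>) / pi"
      by (rule divide_right_mono[OF bound]) simp
    also have "\<dots> = 2 * \<rho> * B * C ^ 6 * (\<bar>h\<bar> + j\<^sup>2) ^ 6"
      by (simp add: power_mult_distrib)
    finally show "norm (cycle_integral \<rho> h j - of_real (cycle_taylor h j)) \<le> 2 * \<rho> * B * C ^ 6 * (\<bar>h\<bar> + j\<^sup>2) ^ 6" .
  qed (use d in auto)
qed

section \<open>Inverting the Taylor polynomial\<close>

definition birkhoff_polynomial :: "real \<Rightarrow> real \<Rightarrow> real"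
  where "birkhoff_polynomial a b = a + 1/16 * (a^2 + 3 * b^2) - 1/256 * a * (a^2 + 9 * b^2)
    + 1/8192 * (5 * a^4 + 102 * a^2 * b^2 + 33 * b^4)
    - 3/262144 * a * (11 * a^4 + 410 * a^2 * b^2 + 271 * b^4)"

definition sixth_order :: "(real \<Rightarrow> real \<Rightarrow> real) \<Rightarrow> bool"
  where "sixth_order f \<longleftrightarrow> (\<lambda>(a, b). f a b) \<in> O[nhds (0, 0)](\<lambda>z. norm z ^ 6)"

lemma sixth_order_add: "sixth_order f \<Longrightarrow> sixth_order g \<Longrightarrow> sixth_order (\<lambda>a b. f a b + g a b)"
  unfolding sixth_order_def case_prod_unfold by (rule sum_in_bigo)

lemma isCont_imp_bigo_1:
  fixes q :: "'a::t2_space \<Rightarrow> real"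
  assumes "isCont q x"
  shows "q \<in> O[nhds x](\<lambda>_. 1)"
proof -
  have "(\<lambda>z. q z / 1) \<midarrow>x\<rightarrow> q x" using assms by (simp add: isCont_def)
  then have "((\<lambda>z. q z / 1) \<longlongrightarrow> q x) (nhds x)" using isCont_imp_tendsto_nhds[OF assms] by simp
  then show ?thesis by (rule bigoI_tendsto) simp
qed

lemma sixth_order_mult:
  assumes "isCont (\<lambda>z. q (fst z) (snd z)) (0, 0)" "sixth_order f"
  shows "sixth_order (\<lambda>a b. q a b * f a b)"
  using landau_o.big.mult[OF isCont_imp_bigo_1[OF assms(1)] assms(2)[unfolded sixth_order_def case_prod_unfold]]
  unfolding sixth_order_def case_prod_unfold by simp

lemma sixth_order_monomial:
  assumes "i + j = 6"
  shows "sixth_order (\<lambda>a b. a ^ i * b ^ j)"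
  unfolding sixth_order_def
proof (rule bigoI[of _ 1], rule always_eventually, safe)
  fix a b :: real
  have "\<bar>a\<bar> ^ i * \<bar>b\<bar> ^ j \<le> norm (a, b) ^ i * norm (a, b) ^ j"
    using norm_fst_le[of a b] norm_snd_le[of b a] by (intro mult_mono power_mono) auto
  also have "\<dots> = norm (a, b) ^ 6" by (simp add: assms flip: power_add)
  finally show "norm (a ^ i * b ^ j) \<le> 1 * norm (norm (a, b) ^ 6)" by (simp add: abs_mult power_abs)
qed

text \<open>
  Polynomials without terms of order below six, even in \<open>b\<close>, are combinations of these four
  monomials; all remainders below are written in this form.
\<close>

lemma sixth_order_ideal:
  assumes "isCont (\<lambda>z. p (fst z) (snd z)) (0, 0)" "isCont (\<lambda>z. q (fst z) (snd z)) (0, 0)"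
    "isCont (\<lambda>z. r (fst z) (snd z)) (0, 0)" "isCont (\<lambda>z. s (fst z) (snd z)) (0, 0)"
  shows "sixth_order (\<lambda>a b. p a b * a^6 + q a b * (a^4 * b^2) + r a b * (a^2 * b^4) + s a b * b^6)"
proof -
  have m: "sixth_order (\<lambda>a b. a^6)" "sixth_order (\<lambda>a b. a^4 * b^2)"
      "sixth_order (\<lambda>a b. a^2 * b^4)" "sixth_order (\<lambda>a b. b^6)"
    using sixth_order_monomial[of 6 0] sixth_order_monomial[of 4 2]
      sixth_order_monomial[of 2 4] sixth_order_monomial[of 0 6] by simp_all
  show ?thesis
    by (rule sixth_order_add[OF sixth_order_add[OF sixth_order_add[OF
          sixth_order_mult[OF assms(1) m(1)] sixth_order_mult[OF assms(2) m(2)]]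
          sixth_order_mult[OF assms(3) m(3)]] sixth_order_mult[OF assms(4) m(4)]])
qed

text \<open>
  The truncations at order five of the second, third and fourth power of \<open>birkhoff_polynomial\<close>.
  The truncated fifth power is \<open>a\<^sup>5\<close>.
\<close>

definition birkhoff_power2 :: "real \<Rightarrow> real \<Rightarrow> real"
  where "birkhoff_power2 a b =
     a^2 + 1/8*a^3 + 3/8*a*b^2 - 1/256*a^4 - 3/64*a^2*b^2 + 9/256*b^4 + 3/4096*a^5 + 39/2048*a^3*b^2 -
     21/4096*a*b^4"

definition birkhoff_power3 :: "real \<Rightarrow> real \<Rightarrow> real"
  where "birkhoff_power3 a b =
     a^3 + 3/16*a^4 + 9/16*a^2*b^2 - 9/256*a^3*b^2 + 27/256*a*b^4"

definition birkhoff_power4 :: "real \<Rightarrow> real \<Rightarrow> real"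
  where "birkhoff_power4 a b =
     a^4 + 1/4*a^5 + 3/4*a^3*b^2"

lemma birkhoff_product2:
  "sixth_order (\<lambda>a b. birkhoff_polynomial a b * birkhoff_polynomial a b - birkhoff_power2 a b)"
proof -
  have eq: "birkhoff_polynomial a b * birkhoff_polynomial a b - birkhoff_power2 a b =
     (- 21/131072 - 43/2097152*a + 91/67108864*a^2 + 2037/33554432*b^2 - 165/1073741824*a^3 -
     2379/268435456*a*b^2 + 1089/68719476736*a^4 + 20295/17179869184*a^2*b^2 + 783279/34359738368*b^4) * a^6
     + (- 15/2048 - 1623/2097152*a + 8625/16777216*b^2 - 65307/536870912*a*b^2 + 499995/17179869184*b^4) *
     (a^4*b^2) + (27/131072 - 6405/2097152*a + 10683/33554432*b^2 - 30879/268435456*a*b^2 +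
     660969/68719476736*b^4) * (a^2*b^4) + (99/65536 - 3033/2097152*a + 1089/67108864*b^2 -
     26829/1073741824*a*b^2) * b^6"
    for a b
    unfolding birkhoff_polynomial_def birkhoff_power2_def by algebra
  show ?thesis unfolding eq by (intro sixth_order_ideal continuous_intros)
qed

lemma birkhoff_product3:
  "sixth_order (\<lambda>a b. birkhoff_polynomial a b * birkhoff_power2 a b - birkhoff_power3 a b)"
proof -
  have eq: "birkhoff_polynomial a b * birkhoff_power2 a b - birkhoff_power3 a b =
     (5/8192 + 3/262144*a - 11/524288*a^2 - 1701/2097152*b^2 + 63/67108864*a^3 + 1509/33554432*a*b^2 -
     99/1073741824*a^4 - 783/134217728*a^2*b^2 - 48843/536870912*b^4) * a^6 + (45/2048 - 165/131072*a -
     7077/2097152*b^2 + 3897/8388608*a*b^2 - 2349/67108864*b^4) * (a^4*b^2) + (- 171/8192 + 1791/262144*a -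
     1539/2097152*b^2 - 225/33554432*a*b^2 + 17073/1073741824*b^4) * (a^2*b^4) + (27/4096 - 45/65536*a +
     297/2097152*b^2 - 8703/67108864*a*b^2) * b^6"
    for a b
    unfolding birkhoff_polynomial_def birkhoff_power2_def birkhoff_power3_def by algebra
  show ?thesis unfolding eq by (intro sixth_order_ideal continuous_intros)
qed

lemma birkhoff_product4:
  "sixth_order (\<lambda>a b. birkhoff_polynomial a b * birkhoff_power3 a b - birkhoff_power4 a b)"
proof -
  have eq: "birkhoff_polynomial a b * birkhoff_power3 a b - birkhoff_power4 a b =
     (1/128 - 1/8192*a - 3/262144*a^2 - 123/65536*b^2 - 99/4194304*a^3 - 4077/4194304*a*b^2 +
     297/67108864*a^2*b^2 + 10179/67108864*b^4) * a^6 + (3/2048*a + 1437/262144*b^2 - 15075/4194304*a*b^2 -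
     25893/67108864*b^4) * (a^4*b^2) + (27/128 - 129/8192*a - 189/131072*b^2 - 2403/4194304*a*b^2 -
     21951/67108864*b^4) * (a^2*b^4) + (81/4096*a + 891/2097152*a*b^2) * b^6"
    for a b
    unfolding birkhoff_polynomial_def birkhoff_power3_def birkhoff_power4_def by algebra
  show ?thesis unfolding eq by (intro sixth_order_ideal continuous_intros)
qed

lemma birkhoff_product5:
  "sixth_order (\<lambda>a b. birkhoff_polynomial a b * birkhoff_power4 a b - a^5)"
proof -
  have eq: "birkhoff_polynomial a b * birkhoff_power4 a b - a^5 =
     (5/16 + 3/256*a - 3/8192*a^2 + 3/4096*b^2 + 7/262144*a^3 - 147/131072*a*b^2 - 33/1048576*a^4 -
     1329/1048576*a^2*b^2 - 4503/1048576*b^4) * a^6 + (15/16 + 15/256*a - 183/8192*b^2 + 1899/262144*a*b^2 -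
     2439/1048576*b^4) * (a^4*b^2) + (9/64*a + 99/32768*a*b^2) * (a^2*b^4) + (0) * b^6"
    for a b
    unfolding birkhoff_polynomial_def birkhoff_power4_def by algebra
  show ?thesis unfolding eq by (intro sixth_order_ideal continuous_intros)
qed

lemma cycle_taylor_explicit:
  "cycle_taylor h j =
     (- 3/16*j^2 - 105/8192*j^4 - 9009/4194304*j^6 - 2078505/4294967296*j^8 - 557732175/4398046511104*j^10)
     + (1 + 15/256*j^2 + 3465/262144*j^4 + 255255/67108864*j^6 + 334639305/274877906944*j^8) * h + (- 1/16 -
     105/4096*j^2 - 45045/4194304*j^4 - 4849845/1073741824*j^6) * h^2 + (3/256 + 1575/131072*j^2 +
     525525/67108864*j^4) * h^3 + (- 25/8192 - 24255/4194304*j^2) * h^4 + (245/262144) * h^5"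
proof -
  have sets: "{..5::nat} = {0, 1, 2, 3, 4, 5}" "{..4::nat} = {0, 1, 2, 3, 4}" "{..3::nat} = {0, 1, 2, 3}"
    "{..2::nat} = {0, 1, 2}" "{..1::nat} = {0, 1}" by auto
  have mom0: "cycle_moment m 0 = 0"
      "cycle_moment m (Suc k) = 2 * pochhammer (of_nat m + 1/2) k / (fact k * 2 ^ (m + k))" for m k
    by (simp_all add: cycle_moment_def)
  have mom: "cycle_moment 0 1 = 2" "cycle_moment 0 2 = 1/2" "cycle_moment 0 3 = 3/16" "cycle_moment 0 4 = 5/64"
      "cycle_moment 0 5 = 35/1024" "cycle_moment 1 2 = 3/4" "cycle_moment 1 3 = 15/32" "cycle_moment 1 4 = 35/128"
      "cycle_moment 1 5 = 315/2048" "cycle_moment 1 6 = 693/8192" "cycle_moment 2 4 = 105/256" "cycle_moment 2 5 = 1155/4096"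
      "cycle_moment 2 6 = 3003/16384" "cycle_moment 2 7 = 15015/131072" "cycle_moment 3 6 = 9009/32768" "cycle_moment 3 7 = 51051/262144"
      "cycle_moment 3 8 = 138567/1048576" "cycle_moment 4 8 = 415701/2097152" "cycle_moment 4 9 = 9561123/67108864" "cycle_moment 5 10 = 79676025/536870912"
     
    using mom0(1) mom0(2)[of _ 0] by (simp_all add: numeral_eq_Suc mom0(2) pochhammer_Suc field_simps)
  have binom: "(2::nat) choose 1 = 2" "(3::nat) choose 1 = 3" "(3::nat) choose 2 = 3" "(4::nat) choose 1 = 4" "(4::nat) choose 2 = 6" "(4::nat) choose 3 = 4" "(5::nat) choose 1 = 5" "(5::nat) choose 2 = 10" "(5::nat) choose 3 = 10" "(5::nat) choose 4 = 5"
    by (simp_all add: numeral_eq_Suc)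
  show ?thesis
    unfolding cycle_taylor_def sets
    by (simp add: sets mom mom[unfolded One_nat_def] mom[unfolded One_nat_def numeral_2_eq_2] mom[unfolded One_nat_def numeral_3_eq_3] mom0(1) binom half_gchoose_values half_gchoose_values[simplified])
       (simp add: power_divide add_divide_distrib diff_divide_distrib distrib_left distrib_right
          right_diff_distrib left_diff_distrib mult_ac flip: power_mult)
qed

text \<open>
  In \<open>cycle_taylor\<close>, a polynomial in its first argument, the powers of \<open>birkhoff_polynomial\<close> may be replaced
  by their truncations; what remains is an identity between explicit polynomials.
\<close>

lemma cycle_taylor_birkhoff_polynomial:
  "sixth_order (\<lambda>a b. cycle_taylor (birkhoff_polynomial a b) b - a)"
proof -
  let ?B = birkhoff_polynomial
  have cont: "isCont (\<lambda>z. ?B (fst z) (snd z)) (0, 0)"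
    unfolding birkhoff_polynomial_def by (intro continuous_intros)
  have p2: "sixth_order (\<lambda>a b. ?B a b ^ 2 - birkhoff_power2 a b)"
    using birkhoff_product2 by (simp add: power2_eq_square)
  have "?B a b ^ 3 - birkhoff_power3 a b = ?B a b * (?B a b ^ 2 - birkhoff_power2 a b) + (?B a b * birkhoff_power2 a b - birkhoff_power3 a b)" for a b
    by (simp add: algebra_simps power_numeral_reduce)
  then have p3: "sixth_order (\<lambda>a b. ?B a b ^ 3 - birkhoff_power3 a b)"
    by (simp only:) (intro sixth_order_add sixth_order_mult birkhoff_product3 p2 cont)
  have "?B a b ^ 4 - birkhoff_power4 a b = ?B a b * (?B a b ^ 3 - birkhoff_power3 a b) + (?B a b * birkhoff_power3 a b - birkhoff_power4 a b)" for a b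
    by (simp add: algebra_simps power_numeral_reduce)
  then have p4: "sixth_order (\<lambda>a b. ?B a b ^ 4 - birkhoff_power4 a b)"
    by (simp only:) (intro sixth_order_add sixth_order_mult birkhoff_product4 p3 cont)
  have "?B a b ^ 5 - a^5 = ?B a b * (?B a b ^ 4 - birkhoff_power4 a b) + (?B a b * birkhoff_power4 a b - a^5)" for a b
    by (simp add: algebra_simps power_numeral_reduce)
  then have p5: "sixth_order (\<lambda>a b. ?B a b ^ 5 - a^5)"
    by (simp only:) (intro sixth_order_add sixth_order_mult birkhoff_product5 p4 cont)
  have eq: "cycle_taylor (?B a b) b - a =
     ((0) * a^6 + (- 14235/4194304 - 98775/67108864*a + 3260565/2147483648*b^2 - 654885/68719476736*a*b^2 +
     10975965/549755813888*b^4 - 66621555/17592186044416*a*b^4 + 1673196525/2251799813685248*b^6 -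
     11043097065/72057594037927936*a*b^6) * (a^4*b^2) + (- 2565/2097152 + 30675/33554432*a +
     426195/536870912*b^2 - 38527335/34359738368*a*b^2 + 1474097625/4398046511104*b^4 -
     7643100465/70368744177664*a*b^4 + 17066604555/1125899906842624*b^6 -
     205803172575/36028797018963968*a*b^6) * (a^2*b^4) + (- 351/1048576 + 35475/67108864*a -
     408375/4294967296*b^2 + 63191205/274877906944*a*b^2 - 46201155/1099511627776*b^4 -
     2212295085/70368744177664*a*b^4 + 11043097065/2251799813685248*b^6 -
     272061754965/72057594037927936*a*b^6) * b^6) + (- 1/16 - 105/4096*b^2 - 45045/4194304*b^4 -
     4849845/1073741824*b^6) * (?B a b ^ 2 - birkhoff_power2 a b) + (3/256 + 1575/131072*b^2 +
     525525/67108864*b^4) * (?B a b ^ 3 - birkhoff_power3 a b) + (- 25/8192 - 24255/4194304*b^2) * (?B a b ^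
     4 - birkhoff_power4 a b) + (245/262144) * (?B a b ^ 5 - a^5)"
    for a b
  proof -
    have alg: "(c0 + c1 * x + c2 * x^2 + c3 * x^3 + c4 * x^4 + c5 * x^5) - a =
      (c0 + c1 * x + c2 * t2 + c3 * t3 + c4 * t4 + c5 * a^5 - a)
      + c2 * (x^2 - t2) + c3 * (x^3 - t3) + c4 * (x^4 - t4) + c5 * (x^5 - a^5)"
      for c0 c1 c2 c3 c4 c5 x t2 t3 t4 :: real
      by (simp add: algebra_simps)
    have fin: "(- 3/16*b^2 - 105/8192*b^4 - 9009/4194304*b^6 - 2078505/4294967296*b^8 - 557732175/4398046511104*b^10)
        + (1 + 15/256*b^2 + 3465/262144*b^4 + 255255/67108864*b^6 + 334639305/274877906944*b^8) * ?B a b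
        + (- 1/16 - 105/4096*b^2 - 45045/4194304*b^4 - 4849845/1073741824*b^6) * birkhoff_power2 a b
        + (3/256 + 1575/131072*b^2 + 525525/67108864*b^4) * birkhoff_power3 a b
        + (- 25/8192 - 24255/4194304*b^2) * birkhoff_power4 a b
        + (245/262144) * a^5 - a =
     (0) * a^6 + (- 14235/4194304 - 98775/67108864*a + 3260565/2147483648*b^2 - 654885/68719476736*a*b^2 +
     10975965/549755813888*b^4 - 66621555/17592186044416*a*b^4 + 1673196525/2251799813685248*b^6 -
     11043097065/72057594037927936*a*b^6) * (a^4*b^2) + (- 2565/2097152 + 30675/33554432*a +
     426195/536870912*b^2 - 38527335/34359738368*a*b^2 + 1474097625/4398046511104*b^4 -
     7643100465/70368744177664*a*b^4 + 17066604555/1125899906842624*b^6 -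
     205803172575/36028797018963968*a*b^6) * (a^2*b^4) + (- 351/1048576 + 35475/67108864*a -
     408375/4294967296*b^2 + 63191205/274877906944*a*b^2 - 46201155/1099511627776*b^4 -
     2212295085/70368744177664*a*b^4 + 11043097065/2251799813685248*b^6 -
     272061754965/72057594037927936*a*b^6) * b^6"
      unfolding birkhoff_polynomial_def birkhoff_power2_def birkhoff_power3_def birkhoff_power4_def by algebra
    show ?thesis
      unfolding cycle_taylor_explicit fin[symmetric] by (rule alg)
  qed
  have ideal: "sixth_order (\<lambda>a b.
     (0) * a^6 + (- 14235/4194304 - 98775/67108864*a + 3260565/2147483648*b^2 - 654885/68719476736*a*b^2 +
     10975965/549755813888*b^4 - 66621555/17592186044416*a*b^4 + 1673196525/2251799813685248*b^6 -
     11043097065/72057594037927936*a*b^6) * (a^4*b^2) + (- 2565/2097152 + 30675/33554432*a +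
     426195/536870912*b^2 - 38527335/34359738368*a*b^2 + 1474097625/4398046511104*b^4 -
     7643100465/70368744177664*a*b^4 + 17066604555/1125899906842624*b^6 -
     205803172575/36028797018963968*a*b^6) * (a^2*b^4) + (- 351/1048576 + 35475/67108864*a -
     408375/4294967296*b^2 + 63191205/274877906944*a*b^2 - 46201155/1099511627776*b^4 -
     2212295085/70368744177664*a*b^4 + 11043097065/2251799813685248*b^6 -
     272061754965/72057594037927936*a*b^6) * b^6)"
    by (intro sixth_order_ideal continuous_intros)
  have m2: "sixth_order (\<lambda>a b. (- 1/16 - 105/4096*b^2 - 45045/4194304*b^4 - 4849845/1073741824*b^6) * (?B a b ^ 2 - birkhoff_power2 a b))"
    by (rule sixth_order_mult[OF _ p2]) (intro continuous_intros)
  have m3: "sixth_order (\<lambda>a b. (3/256 + 1575/131072*b^2 + 525525/67108864*b^4) * (?B a b ^ 3 - birkhoff_power3 a b))"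
    by (rule sixth_order_mult[OF _ p3]) (intro continuous_intros)
  have m4: "sixth_order (\<lambda>a b. (- 25/8192 - 24255/4194304*b^2) * (?B a b ^ 4 - birkhoff_power4 a b))"
    by (rule sixth_order_mult[OF _ p4]) (intro continuous_intros)
  have m5: "sixth_order (\<lambda>a b. (245/262144) * (?B a b ^ 5 - a^5))"
    by (rule sixth_order_mult[OF _ p5]) (intro continuous_intros)
  show ?thesis
    unfolding eq
    by (rule sixth_order_add[OF sixth_order_add[OF sixth_order_add[OF sixth_order_add[OF ideal m2] m3] m4] m5])
qed

section \<open>Integrals over loops that wind around a point\<close>

text \<open>
  The substitution \<open>\<zeta> = 1 + e\<^sup>s\<close> unrolls the punctured plane.  The loop \<open>z\<close> lifts to the path
  \<open>m ln R + m \<i> \<theta> + l(R e\<^sup>\<i>\<^sup>\<theta>)\<close>, so the integral is a difference of two values of a primitive \<open>P\<close>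
  of the lifted form.
\<close>

lemma pullback_integral_circlepath:
  fixes f z l P :: "complex \<Rightarrow> complex"
  assumes R: "R > 0" and T: "open T" "sphere 0 R \<subseteq> T" and l: "l holomorphic_on T"
    and z: "\<And>t. t \<in> T \<Longrightarrow> z t = 1 + t ^ m * exp (l t)"
    and P: "\<And>s. s \<in> V \<Longrightarrow> (P has_field_derivative f (1 + exp s) * exp s) (at s)"
    and V: "\<And>s t. t \<in> sphere 0 R \<Longrightarrow> 1 + exp s = z t \<Longrightarrow> s \<in> V"
  shows "((\<lambda>t. f (z t) * deriv z t) has_contour_integral
    P (of_nat m * of_real (ln R) + l R + 2 * of_nat m * of_real pi * \<i>) - P (of_nat m * of_real (ln R) + l R)) (circlepath 0 R)"
proof -
  define \<gamma> where "\<gamma> = (\<lambda>x. of_nat m * of_real (ln R) + 2 * of_nat m * of_real pi * \<i> * of_real x + l (circlepath 0 R x))"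
  define c where "c = circlepath 0 R"
  have cT: "c x \<in> sphere 0 R" for x using R by (simp add: c_def circlepath norm_mult)
  have c0: "c x \<noteq> 0" for x using cT[of x] R by auto
  have c_exp: "c x = exp (of_real (ln R) + 2 * of_real pi * \<i> * of_real x)" for x
    using R by (simp add: c_def circlepath exp_add exp_of_real)
  have dc: "(c has_vector_derivative 2 * of_real pi * \<i> * c x) (at x within X)" for x X
    using has_vector_derivative_circlepath[of 0 R x X] by (simp add: c_def circlepath mult_ac)
  have exp\<gamma>: "1 + exp (\<gamma> x) = z (c x)" for x
  proof -
    have "\<gamma> x = of_nat m * (of_real (ln R) + 2 * of_real pi * \<i> * of_real x) + l (c x)"
      by (simp add: \<gamma>_def c_def algebra_simps)
    then have "exp (\<gamma> x) = c x ^ m * exp (l (c x))" by (simp add: exp_add exp_of_nat_mult c_exp)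
    moreover have "c x \<in> T" using cT T by blast
    ultimately show ?thesis by (simp add: z)
  qed
  have dl: "(l has_field_derivative deriv l t) (at t)" if "t \<in> T" for t
    using holomorphic_derivI[OF l T(1) that] .
  have dz: "deriv z t = t ^ m * exp (l t) * (of_nat m / t + deriv l t)" if t: "t \<in> T" "t \<noteq> 0" for t
  proof -
    have "((\<lambda>t. 1 + t ^ m * exp (l t)) has_field_derivative
        of_nat m * t ^ (m - 1) * exp (l t) + t ^ m * (exp (l t) * deriv l t)) (at t)"
      by (auto intro!: derivative_eq_intros dl t simp: algebra_simps)
    also have "of_nat m * t ^ (m - 1) * exp (l t) + t ^ m * (exp (l t) * deriv l t)
        = t ^ m * exp (l t) * (of_nat m / t + deriv l t)"
      using t(2) by (cases m) (simp_all add: field_simps)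
    finally have "(z has_field_derivative t ^ m * exp (l t) * (of_nat m / t + deriv l t)) (at t)"
      by (rule has_field_derivative_transform_within_open[OF _ T(1) t(1)]) (simp add: z)
    then show ?thesis by (rule DERIV_imp_deriv)
  qed
  have d: "((\<lambda>x. P (\<gamma> x)) has_vector_derivative f (z (c x)) * deriv z (c x) * vector_derivative c (at x)) (at x within {0..1})" for x
  proof -
    have cx: "c x \<in> T" using cT T by auto
    have "((\<lambda>x. l (c x)) has_vector_derivative 2 * of_real pi * \<i> * c x * deriv l (c x)) (at x)"
      using field_vector_diff_chain_at[OF dc dl[OF cx]] by (simp add: o_def)
    moreover have "((\<lambda>x. of_nat m * of_real (ln R) + 2 * of_nat m * of_real pi * \<i> * of_real x) has_vector_derivative
        2 * of_nat m * of_real pi * \<i>) (at x)"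
      by (auto intro!: derivative_eq_intros simp: scaleR_conv_of_real)
    ultimately have d\<gamma>: "(\<gamma> has_vector_derivative 2 * of_nat m * of_real pi * \<i> + 2 * of_real pi * \<i> * c x * deriv l (c x)) (at x)"
      unfolding \<gamma>_def c_def[symmetric] by (rule has_vector_derivative_add[rotated])
    have "\<gamma> x \<in> V" using V[OF cT exp\<gamma>] .
    from field_vector_diff_chain_at[OF d\<gamma> P[OF this]]
    have "((\<lambda>x. P (\<gamma> x)) has_vector_derivative (2 * of_nat m * of_real pi * \<i> + 2 * of_real pi * \<i> * c x * deriv l (c x))
        * (f (1 + exp (\<gamma> x)) * exp (\<gamma> x))) (at x)"
      by (simp add: o_def)
    also have "(2 * of_nat m * of_real pi * \<i> + 2 * of_real pi * \<i> * c x * deriv l (c x)) * (f (1 + exp (\<gamma> x)) * exp (\<gamma> x))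
        = f (z (c x)) * deriv z (c x) * vector_derivative c (at x)"
    proof -
      have e: "exp (\<gamma> x) = c x ^ m * exp (l (c x))" using exp\<gamma>[of x] z[OF cx] by simp
      show ?thesis
        unfolding exp\<gamma> unfolding e dz[OF cx c0] vector_derivative_at[OF dc]
        using c0[of x] by (simp add: field_simps)
    qed
    finally show ?thesis by (rule has_vector_derivative_at_within)
  qed
  have "((\<lambda>x. f (z (c x)) * deriv z (c x) * vector_derivative c (at x)) has_integral P (\<gamma> 1) - P (\<gamma> 0)) {0..1}"
    by (rule fundamental_theorem_of_calculus) (auto intro: d)
  moreover have "c 0 = of_real R" "c 1 = of_real R" by (simp_all add: c_def circlepath)
  ultimately show ?thesis
    unfolding has_contour_integral c_def[symmetric]
    by (simp add: \<gamma>_def c_def[symmetric] algebra_simps)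
qed

text \<open>
  On the vertical strip over the annulus the lifted form has a primitive, and by periodicity of the form the
  increment of the primitive over \<open>2 \<pi> \<i>\<close> is a constant, the integral over the circle.  The lift of the loop
  ends \<open>2 \<pi> \<i> m\<close> above its start.
\<close>

lemma winding_loop_integral:
  fixes f z l :: "complex \<Rightarrow> complex"
  assumes r: "0 < r'" "r' < \<rho>" "\<rho> < R'"
    and f: "f holomorphic_on {\<zeta>. r' < norm (\<zeta> - 1) \<and> norm (\<zeta> - 1) < R'}"
    and R: "R > 0" and T: "open T" "sphere 0 R \<subseteq> T" and l: "l holomorphic_on T"
    and z: "\<And>t. t \<in> T \<Longrightarrow> z t = 1 + t ^ m * exp (l t)"
    and zA: "\<And>t. t \<in> sphere 0 R \<Longrightarrow> r' < norm (z t - 1) \<and> norm (z t - 1) < R'"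
  shows "((\<lambda>t. f (z t) * deriv z t) has_contour_integral
    of_nat m * contour_integral (circlepath 1 \<rho>) f) (circlepath 0 R)"
proof -
  \<comment> \<open>The strip over the annulus.\<close>
  define V where "V = {s. ln r' < Re s \<and> Re s < ln R'}"
  have R': "R' > 0" using r by simp
  have V: "convex V" "open V"
  proof -
    have "V = {s. Re s > ln r'} \<inter> {s. Re s < ln R'}" by (auto simp: V_def)
    then show "convex V" "open V"
      by (simp_all add: convex_Int convex_halfspace_Re_gt convex_halfspace_Re_lt open_Int open_halfspace_Re_gt open_halfspace_Re_lt)
  qed
  have exp_norm: "s \<in> V \<longleftrightarrow> r' < norm (exp s) \<and> norm (exp s) < R'" for s
  proof -
    have "ln r' < Re s \<longleftrightarrow> r' < exp (Re s)" using r by (metis exp_less_cancel_iff exp_ln)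
    moreover have "Re s < ln R' \<longleftrightarrow> exp (Re s) < R'" using R' by (metis exp_less_cancel_iff exp_ln)
    ultimately show ?thesis by (simp add: V_def norm_exp_eq_Re)
  qed
  have "(\<lambda>s. f (1 + exp s) * exp s) holomorphic_on V"
  proof -
    have "(f \<circ> (\<lambda>s. 1 + exp s)) holomorphic_on V"
      by (rule holomorphic_on_compose_gen[OF _ f]) (auto intro!: holomorphic_intros simp: exp_norm)
    then show ?thesis by (auto simp: o_def intro!: holomorphic_intros)
  qed
  then obtain P where "\<And>s. s \<in> V \<Longrightarrow> (P has_field_derivative f (1 + exp s) * exp s) (at s within V)"
    by (rule holomorphic_convex_primitive'[OF V]) blast
  then have P: "\<And>s. s \<in> V \<Longrightarrow> (P has_field_derivative f (1 + exp s) * exp s) (at s)"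
    using V(2) at_within_open by metis
  define p where "p = 2 * of_real pi * \<i>"
  have ep: "exp (s + p) = exp s" for s by (simp add: p_def exp_add)
  have "\<exists>C. \<forall>s\<in>V. P (s + p) - P s = C"
  proof (rule has_field_derivative_zero_constant[OF V(1)])
    fix s assume s: "s \<in> V"
    then have sp: "s + p \<in> V" by (simp add: V_def p_def)
    have "((\<lambda>s. P (s + p)) has_field_derivative f (1 + exp (s + p)) * exp (s + p)) (at s)"
      using DERIV_shift[of P "f (1 + exp (s + p)) * exp (s + p)" s p] P[OF sp] by simp
    from DERIV_diff[OF this P[OF s]] show "((\<lambda>s. P (s + p) - P s) has_field_derivative 0) (at s within V)"
      by (simp add: ep has_field_derivative_at_within)
  qed
  then obtain C where C: "\<And>s. s \<in> V \<Longrightarrow> P (s + p) - P s = C" by blast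
  have Cn: "P (s + of_nat n * p) - P s = of_nat n * C" if "s \<in> V" for s n
  proof (induction n)
    case (Suc n)
    have "s + of_nat n * p \<in> V" using that by (simp add: V_def p_def)
    from C[OF this] Suc show ?case by (simp add: algebra_simps)
  qed simp
  have Vz: "s \<in> V" if "t \<in> sphere 0 R" "1 + exp s = z t" for s t
    using zA[OF that(1)] by (simp add: exp_norm flip: that(2))
  have main: "((\<lambda>t. f (z t) * deriv z t) has_contour_integral of_nat m * C) (circlepath 0 R)"
  proof -
    have eR: "exp (complex_of_real (ln R)) = of_real R" using R by (simp add: exp_of_real)
    have "of_nat m * of_real (ln R) + l R \<in> V"
    proof (rule Vz[of "of_real R"])
      have "complex_of_real R \<in> T" using T(2) R by (auto simp: subset_iff)
      then show "1 + exp (of_nat m * of_real (ln R) + l R) = z R"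
        using eR by (simp add: z exp_add exp_of_nat_mult)
    qed (use R in simp)
    note eqC = Cn[OF this, of m]
    have "((\<lambda>t. f (z t) * deriv z t) has_contour_integral
        P (of_nat m * of_real (ln R) + l R + 2 * of_nat m * of_real pi * \<i>) - P (of_nat m * of_real (ln R) + l R)) (circlepath 0 R)"
      by (rule pullback_integral_circlepath[OF R T l]) (rule z P Vz; assumption)+
    with eqC show ?thesis by (simp add: p_def mult_ac)
  qed
  have "((\<lambda>t. f (1 + t) * deriv (\<lambda>t. 1 + t) t) has_contour_integral
      P (of_nat 1 * of_real (ln \<rho>) + 0 + 2 * of_nat 1 * of_real pi * \<i>) - P (of_nat 1 * of_real (ln \<rho>) + 0)) (circlepath 0 \<rho>)"
  proof (rule pullback_integral_circlepath[where T=UNIV and l="\<lambda>_. 0" and V=V])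
    show "s \<in> V" if "t \<in> sphere 0 \<rho>" "1 + exp s = 1 + t" for s t
      using that r by (simp add: exp_norm)
  qed (use r P in auto)
  moreover have "complex_of_real (ln \<rho>) \<in> V" using r by (simp add: V_def)
  ultimately have "((\<lambda>t. f (1 + t)) has_contour_integral C) (circlepath 0 \<rho>)"
    using C[of "of_real (ln \<rho>)"] by (simp add: p_def deriv_add)
  moreover have "vector_derivative (circlepath 1 \<rho>) (at x) = vector_derivative (circlepath 0 \<rho>) (at x)" for x
    using vector_derivative_at[OF has_vector_derivative_circlepath, of 1 \<rho> x]
      vector_derivative_at[OF has_vector_derivative_circlepath, of 0 \<rho> x] by simp
  moreover have "circlepath 1 \<rho> x = 1 + circlepath 0 \<rho> x" for x by (simp add: circlepath)
  ultimately have "(f has_contour_integral C) (circlepath 1 \<rho>)"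
    unfolding has_contour_integral by simp
  with main show ?thesis by (simp add: contour_integral_unique)
qed

text \<open>
  The quotient by \<open>t\<^sup>m k(t)\<close> stays in the disc of radius 1 around 1, where the principal logarithm is
  holomorphic, and \<open>k\<close> has a logarithm on the whole disc.
\<close>

lemma holomorphic_log_near:
  assumes k: "k holomorphic_on ball 0 r" "\<And>t. t \<in> ball 0 r \<Longrightarrow> k t \<noteq> 0"
    and A: "A \<subseteq> ball 0 r - {0}"
    and f: "f holomorphic_on A"
    and close: "\<And>t. t \<in> A \<Longrightarrow> norm (f t - t ^ m * k t) < norm (t ^ m * k t)"
  obtains l where "l holomorphic_on A" "\<And>t. t \<in> A \<Longrightarrow> f t = t ^ m * exp (l t)"
proof (cases "A = {}")
  case True
  then show ?thesis using that[of "\<lambda>_. 0"] by simp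
next
  case False
  then have "(0::complex) \<in> ball 0 r" using A by (force simp: dist_norm intro: le_less_trans[OF norm_ge_zero])
  then obtain l0 where l0: "l0 holomorphic_on ball 0 r" "\<And>t. t \<in> ball 0 r \<Longrightarrow> exp (l0 t) = k t"
    using holomorphic_logarithm_exists[OF convex_ball open_ball k] by blast
  define q where "q = (\<lambda>t. f t / (t ^ m * k t))"
  have nz: "t ^ m * k t \<noteq> 0" if "t \<in> A" for t using A k(2) that by auto
  have q: "q t \<notin> \<real>\<^sub>\<le>\<^sub>0" if "t \<in> A" for t
  proof -
    have "q t - 1 = (f t - t ^ m * k t) / (t ^ m * k t)" using nz[OF that] by (simp add: q_def diff_divide_distrib)
    then have "norm (q t - 1) < 1" using close[OF that] nz[OF that] by (simp add: norm_divide)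
    then have "\<bar>Re (q t - 1)\<bar> < 1" using abs_Re_le_cmod le_less_trans by blast
    then show ?thesis by (auto simp: complex_nonpos_Reals_iff)
  qed
  have Ab: "A \<subseteq> ball 0 r" using A by auto
  have qh: "q holomorphic_on A"
    unfolding q_def by (intro holomorphic_intros f holomorphic_on_subset[OF k(1) Ab]) (use nz in auto)
  show ?thesis
  proof (rule that[of "\<lambda>t. l0 t + Ln (q t)"])
    show "(\<lambda>t. l0 t + Ln (q t)) holomorphic_on A"
      by (intro holomorphic_intros holomorphic_on_subset[OF l0(1) Ab] qh q)
    fix t assume t: "t \<in> A"
    have "q t \<noteq> 0" using q[OF t] by auto
    then show "f t = t ^ m * exp (l0 t + Ln (q t))"
      using l0(2)[of t] t Ab nz[OF t] by (auto simp: exp_add q_def)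
  qed
qed

text \<open>
  The angular form is \<open>(u'/u - v'/v) / (2 \<i>)\<close> for \<open>u = x + \<i> y\<close>, \<open>v = x - \<i> y\<close>.  As \<open>u\<close> and \<open>v\<close> contain the same
  power of \<open>t\<close>, it is the derivative of the single-valued function \<open>(l1 - l2) / (2 \<i>)\<close>.
\<close>

lemma angular_form_integral_zero:
  fixes x y :: "complex \<Rightarrow> complex"
  assumes R: "R > 0" and T: "open T" "sphere 0 R \<subseteq> T" "0 \<notin> T"
    and xy: "x holomorphic_on T" "y holomorphic_on T"
    and l1: "l1 holomorphic_on T" "\<And>t. t \<in> T \<Longrightarrow> x t + \<i> * y t = t ^ m * exp (l1 t)"
    and l2: "l2 holomorphic_on T" "\<And>t. t \<in> T \<Longrightarrow> x t - \<i> * y t = t ^ m * exp (l2 t)"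
  shows "((\<lambda>t. (x t * deriv y t - y t * deriv x t) / ((x t)\<^sup>2 + (y t)\<^sup>2)) has_contour_integral 0) (circlepath 0 R)"
proof -
  have prim: "((\<lambda>t. (l1 t - l2 t) / (2 * \<i>)) has_field_derivative
      (x t * deriv y t - y t * deriv x t) / ((x t)\<^sup>2 + (y t)\<^sup>2)) (at t within T)" if t: "t \<in> T" for t
  proof -
    have t0: "t \<noteq> 0" using t T by auto
    note d = holomorphic_derivI[OF xy(1) T(1) t] holomorphic_derivI[OF xy(2) T(1) t]
    have log: "deriv l t * f t = f' - of_nat m / t * f t"
      if l: "l holomorphic_on T" "\<And>t. t \<in> T \<Longrightarrow> f t = t ^ m * exp (l t)" and f': "(f has_field_derivative f') (at t)" for l f f'
    proof -
      have "((\<lambda>t. t ^ m * exp (l t)) has_field_derivative of_nat m * t ^ (m - 1) * exp (l t) + t ^ m * (exp (l t) * deriv l t)) (at t)"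
        by (auto intro!: derivative_eq_intros holomorphic_derivI[OF l(1) T(1) t] simp: algebra_simps)
      moreover have "((\<lambda>t. t ^ m * exp (l t)) has_field_derivative f') (at t)"
        by (rule has_field_derivative_transform_within_open[OF f' T(1) t]) (simp add: l(2))
      ultimately have "f' = of_nat m * t ^ (m - 1) * exp (l t) + t ^ m * (exp (l t) * deriv l t)"
        using DERIV_unique by blast
      also have "\<dots> = of_nat m / t * f t + deriv l t * f t"
        using t0 l(2)[OF t] by (cases m) (simp_all add: field_simps)
      finally show ?thesis by simp
    qed
    define X Y X' Y' where "X = x t" and "Y = y t" and "X' = deriv x t" and "Y' = deriv y t"
    have L1: "deriv l1 t * (X + \<i> * Y) = X' + \<i> * Y' - of_nat m / t * (X + \<i> * Y)"
      unfolding X_def Y_def X'_def Y'_def by (rule log[OF l1]) (auto intro!: derivative_eq_intros d)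
    have L2: "deriv l2 t * (X - \<i> * Y) = X' - \<i> * Y' - of_nat m / t * (X - \<i> * Y)"
      unfolding X_def Y_def X'_def Y'_def by (rule log[OF l2]) (auto intro!: derivative_eq_intros d)
    define n where "n = of_nat m / t"
    have nz: "X + \<i> * Y \<noteq> 0" "X - \<i> * Y \<noteq> 0"
      using l1(2)[OF t] l2(2)[OF t] t0 by (simp_all add: X_def Y_def)
    have prod: "(X + \<i> * Y) * (X - \<i> * Y) = X\<^sup>2 + Y\<^sup>2"
      by (simp add: algebra_simps power2_eq_square)
    have "(deriv l1 t - deriv l2 t) * (X\<^sup>2 + Y\<^sup>2)
        = (deriv l1 t * (X + \<i> * Y)) * (X - \<i> * Y) - (deriv l2 t * (X - \<i> * Y)) * (X + \<i> * Y)"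
      unfolding prod[symmetric] by (simp add: algebra_simps)
    also have "\<dots> = 2 * \<i> * (X * Y' - Y * X')"
      unfolding L1[folded n_def] L2[folded n_def] by (simp add: algebra_simps)
    finally have "(deriv l1 t - deriv l2 t) / (2 * \<i>) = (X * Y' - Y * X') / (X\<^sup>2 + Y\<^sup>2)"
      using nz prod by (simp add: divide_simps) (auto simp: mult_ac)
    moreover have "((\<lambda>t. (l1 t - l2 t) / (2 * \<i>)) has_field_derivative (deriv l1 t - deriv l2 t) / (2 * \<i>)) (at t)"
      by (intro DERIV_cdivide DERIV_diff holomorphic_derivI[OF l1(1) T(1) t] holomorphic_derivI[OF l2(1) T(1) t])
    ultimately show ?thesis
      by (simp add: X_def Y_def X'_def Y'_def has_field_derivative_at_within)
  qed
  show ?thesis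
    by (rule Cauchy_theorem_primitive[OF prim]) (use R T in auto)
qed

text \<open>
  Away from \<open>t = 0\<close> the orbit with actions \<open>a\<close>, \<open>b\<close> is uniformly close to the separatrix, by uniform
  continuity of \<open>F\<close> on the compact polydisc.
\<close>

lemma uniform_near_unstable_manifold:
  fixes F :: "complex \<times> complex \<times> complex \<Rightarrow> complex"
  assumes F: "continuous_on {(t, \<alpha>, \<beta>). norm t + norm \<alpha> + norm \<beta> \<le> \<rho>} F"
    and r: "0 < r1" "r1 \<le> r2" "r2 < \<rho>" and "\<epsilon> > 0"
  obtains d where "d > 0"
    "\<And>a b t. \<bar>a\<bar> < d \<Longrightarrow> \<bar>b\<bar> < d \<Longrightarrow> r1 \<le> norm t \<Longrightarrow> norm t \<le> r2 \<Longrightarrow>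
      norm t + norm (of_real a / t) + norm (of_real b / t) \<le> \<rho> \<and>
      norm (F (t, of_real a / t, of_real b / t) - F (t, 0, 0)) < \<epsilon>"
proof -
  let ?K = "{(t::complex, \<alpha>::complex, \<beta>::complex). norm t + norm \<alpha> + norm \<beta> \<le> \<rho>}"
  have "?K = {p. norm (fst p) + norm (fst (snd p)) + norm (snd (snd p)) \<le> \<rho>}" by auto
  then have "closed ?K" by (simp only:) (intro closed_Collect_le continuous_intros)
  moreover have "bounded ?K"
  proof (rule boundedI)
    fix p assume "p \<in> ?K"
    then obtain t \<alpha> \<beta> where "p = (t, \<alpha>, \<beta>)" "norm t + norm \<alpha> + norm \<beta> \<le> \<rho>" by auto
    then show "norm p \<le> \<rho>" using norm_Pair_le[of t "(\<alpha>, \<beta>)"] norm_Pair_le[of \<alpha> \<beta>] by simp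
  qed
  ultimately have "compact ?K" by (simp add: compact_eq_bounded_closed)
  then have "uniformly_continuous_on ?K F" using compact_uniformly_continuous[OF F] by blast
  then obtain \<delta> where \<delta>: "\<delta> > 0" "\<And>p q. p \<in> ?K \<Longrightarrow> q \<in> ?K \<Longrightarrow> dist q p < \<delta> \<Longrightarrow> dist (F q) (F p) < \<epsilon>"
    by (rule uniformly_continuous_onE[OF _ \<open>\<epsilon> > 0\<close>]) (rule that; assumption)
  define e where "e = min \<delta> (\<rho> - r2) / 2"
  have e: "e > 0" "e + e \<le> \<delta>" "e + e \<le> \<rho> - r2" using \<delta> r by (auto simp: e_def)
  show ?thesis
  proof (rule that[of "e * r1"])
    show "e * r1 > 0" using e r by simp
    fix a b :: real and t :: complex
    assume ab: "\<bar>a\<bar> < e * r1" "\<bar>b\<bar> < e * r1" and t: "r1 \<le> norm t" "norm t \<le> r2"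
    have div: "norm (complex_of_real x / t) < e" if "\<bar>x\<bar> < e * r1" for x
    proof -
      have "e * r1 \<le> e * norm t" using t(1) e(1) by (intro mult_left_mono) auto
      with that have "\<bar>x\<bar> < e * norm t" by linarith
      then show ?thesis using t r e(1) by (simp add: norm_divide divide_less_eq)
    qed
    note d = div[OF ab(1)] div[OF ab(2)]
    have K: "(t, of_real a / t, of_real b / t) \<in> ?K" "(t, 0, 0) \<in> ?K" using d e t r by auto
    have "dist (t, of_real a / t, of_real b / t) (t, 0, 0) \<le> norm (of_real a / t) + norm (of_real b / t)"
      using norm_Pair_le[of "of_real a / t" "of_real b / t"] by (simp add: dist_norm norm_Pair)
    also have "\<dots> < \<delta>" using d e by linarith
    finally have "dist (F (t, of_real a / t, of_real b / t)) (F (t, 0, 0)) < \<epsilon>" by (rule \<delta>(2)[OF K(2,1)])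
    then show "norm t + norm (of_real a / t) + norm (of_real b / t) \<le> \<rho> \<and>
        norm (F (t, of_real a / t, of_real b / t) - F (t, 0, 0)) < \<epsilon>"
      using K by (simp add: dist_norm)
  qed
qed

section \<open>Complexified orbits\<close>

lemma complexifies_mono:
  assumes "complexifies \<rho> F f" "\<rho>' \<le> \<rho>"
  shows "complexifies \<rho>' F f"
proof -
  have c: "continuous_on {(t, \<alpha>, \<beta>). norm t + norm \<alpha> + norm \<beta> \<le> \<rho>} F"
    and h: "\<And>T u v. open T \<Longrightarrow> u holomorphic_on T \<Longrightarrow> v holomorphic_on T \<Longrightarrow>
       (\<forall>t\<in>T. norm t + norm (u t) + norm (v t) \<le> \<rho>) \<Longrightarrow> (\<lambda>t. F (t, u t, v t)) holomorphic_on T"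
    and r: "\<And>t a b. \<bar>t\<bar> + \<bar>a\<bar> + \<bar>b\<bar> \<le> \<rho> \<Longrightarrow>
       F (of_real t, of_real a, of_real b) = of_real (f (vector [t, 0], vector [a, b]))"
    using assms(1) unfolding complexifies_def by blast+
  show ?thesis
    unfolding complexifies_def
  proof (intro conjI allI impI)
    show "continuous_on {(t, \<alpha>, \<beta>). norm t + norm \<alpha> + norm \<beta> \<le> \<rho>'} F"
      by (rule continuous_on_subset[OF c]) (use assms(2) in auto)
    show "(\<lambda>t. F (t, u t, v t)) holomorphic_on T"
      if "open T" "u holomorphic_on T" "v holomorphic_on T" "\<forall>t\<in>T. norm t + norm (u t) + norm (v t) \<le> \<rho>'" for T u v
      by (rule h) (use that assms(2) in force)+
    show "F (of_real t, of_real a, of_real b) = of_real (f (vector [t, 0], vector [a, b]))"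
      if "\<bar>t\<bar> + \<bar>a\<bar> + \<bar>b\<bar> \<le> \<rho>'" for t a b
      by (rule r) (use that assms(2) in simp)
  qed
qed

text \<open>
  The \<open>J\<^sub>1\<close>-orbit with actions \<open>a\<close>, \<open>b\<close> that passes near the unstable manifold \<open>p = 0\<close>; the exponential
  of time is the parameter.  For \<open>a = b = 0\<close> it also covers the equilibrium at \<open>t = 0\<close>.
\<close>

definition orbit_point :: "real \<Rightarrow> real \<Rightarrow> real \<Rightarrow> (real^2) \<times> (real^2)"
  where "orbit_point a b t = (vector [t, 0], vector [a / t, b / t])"

lemma orbit_point_alt: "orbit_point a b t = (t *\<^sub>R axis 1 1, (1 / t) *\<^sub>R vector [a, b])"
  by (simp add: orbit_point_def vec_eq_iff forall_2 axis_def)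

lemma orbit_point_J: "t \<noteq> 0 \<Longrightarrow> BNF_J1 (orbit_point a b t) = a" "t \<noteq> 0 \<Longrightarrow> BNF_J2 (orbit_point a b t) = b"
  by (simp_all add: BNF_J1_def BNF_J2_def orbit_point_def)

lemma orbit_point_has_vector_derivative:
  assumes "t \<noteq> 0"
  shows "(orbit_point a b has_vector_derivative
    (1 / t) *\<^sub>R (fst (orbit_point a b t), - snd (orbit_point a b t))) (at t)"
proof -
  have 1: "((\<lambda>t. t *\<^sub>R axis 1 1 :: real^2) has_vector_derivative axis 1 1) (at t)"
    by (auto intro!: derivative_eq_intros)
  have "((\<lambda>t. 1 / t) has_real_derivative - (1 / t) * (1 / t)) (at t)"
    by (rule DERIV_cong[OF DERIV_inverse[OF assms, unfolded inverse_eq_divide]]) simp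
  then have 2: "((\<lambda>t. (1 / t) *\<^sub>R vector [a, b] :: real^2) has_vector_derivative (- (1 / t) * (1 / t)) *\<^sub>R vector [a, b]) (at t)"
    using has_vector_derivative_scaleR[OF _ has_vector_derivative_const] by fastforce
  show ?thesis
    unfolding orbit_point_alt[abs_def]
    using has_vector_derivative_Pair[OF 1 2] assms by simp
qed

lemma cross3_axis3: "cross3 (axis 3 1) r = vector [- (r $ 2), r $ 1, 0]"
  by (simp add: cross3_simps axis_def)

locale birkhoff_coordinates =
  fixes \<H> :: "real \<Rightarrow> real \<Rightarrow> real" and U \<Phi>
  assumes sc: "symplectic_coordinates U \<Phi>"
    and Lz: "\<And>x. x \<in> U \<Longrightarrow> pendulum_Lz (\<Phi> x) = BNF_J2 x"
    and Ham: "\<And>x. x \<in> U \<Longrightarrow> pendulum_H (\<Phi> x) = \<H> (BNF_J1 x) (BNF_J2 x)"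
    and quad: "(\<lambda>(a, b). \<H> a b - a) \<in> O[nhds (0, 0)](\<lambda>z. norm z ^ 2)"
begin

definition pos :: "3 \<Rightarrow> (real^2) \<times> (real^2) \<Rightarrow> real"
  where "pos i x = fst (\<Phi> x) $ i"

definition mom :: "3 \<Rightarrow> (real^2) \<times> (real^2) \<Rightarrow> real"
  where "mom i x = snd (\<Phi> x) $ i"

text \<open>
  The second identity is the energy relation \<open>P = (1 - z\<^sup>2) |p|\<^sup>2 - L\<^sub>z\<^sup>2 = p\<^sub>z\<^sup>2\<close>, the splitting of the momentum
  into a meridional and an azimuthal part.
\<close>

lemma phase_space_identities:
  assumes "x \<in> U"
  shows "(pos 1 x)\<^sup>2 + (pos 2 x)\<^sup>2 + (pos 3 x)\<^sup>2 = 1"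
    and "(mom 3 x)\<^sup>2 = 2 * (1 - (pos 3 x)\<^sup>2) * (\<H> (BNF_J1 x) (BNF_J2 x) + 1 - pos 3 x) - (BNF_J2 x)\<^sup>2"
    and "pos 1 x * mom 2 x - pos 2 x * mom 1 x = BNF_J2 x"
proof -
  define r p where "r = fst (\<Phi> x)" and "p = snd (\<Phi> x)"
  have ph: "\<Phi> x \<in> phase_space" by (rule symplectic_coordinates_in_phase_space[OF sc assms])
  then have r: "r \<bullet> r = 1" and rp: "r \<bullet> p = 0"
    by (auto simp: phase_space_def norm_eq_1 r_def p_def)
  then have s: "(r$1)\<^sup>2 + (r$2)\<^sup>2 + (r$3)\<^sup>2 = 1" and rp': "r$1 * p$1 + r$2 * p$2 + r$3 * p$3 = 0"
    by (simp_all add: inner_vec_def sum_3 power2_eq_square)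
  show "(pos 1 x)\<^sup>2 + (pos 2 x)\<^sup>2 + (pos 3 x)\<^sup>2 = 1" using s by (simp add: pos_def r_def)
  have L: "r$1 * p$2 - r$2 * p$1 = BNF_J2 x"
    using Lz[OF assms] by (simp add: pendulum_Lz_def case_prod_unfold r_def p_def)
  then show "pos 1 x * mom 2 x - pos 2 x * mom 1 x = BNF_J2 x" by (simp add: pos_def mom_def r_def p_def)
  have "\<H> (BNF_J1 x) (BNF_J2 x) = (p \<bullet> p) / 2 + r$3 - 1"
    using Ham[OF assms] r rp by (simp add: pendulum_H_alt r_def p_def)
  then have h: "2 * (\<H> (BNF_J1 x) (BNF_J2 x) + 1 - r$3) = (p$1)\<^sup>2 + (p$2)\<^sup>2 + (p$3)\<^sup>2"
    by (simp add: inner_vec_def sum_3 power2_eq_square)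
  have "(p$3)\<^sup>2 = (1 - (r$3)\<^sup>2) * ((p$1)\<^sup>2 + (p$2)\<^sup>2 + (p$3)\<^sup>2) - (r$1 * p$2 - r$2 * p$1)\<^sup>2"
    using s rp' by algebra
  then have "(p$3)\<^sup>2 = 2 * (1 - (r$3)\<^sup>2) * (\<H> (BNF_J1 x) (BNF_J2 x) + 1 - r$3) - (BNF_J2 x)\<^sup>2"
    using h L by algebra
  then show "(mom 3 x)\<^sup>2 = 2 * (1 - (pos 3 x)\<^sup>2) * (\<H> (BNF_J1 x) (BNF_J2 x) + 1 - pos 3 x) - (BNF_J2 x)\<^sup>2"
    by (simp only: pos_def mom_def r_def p_def)
qed

text \<open>
  The derivative in \<open>t\<close> is \<open>1/t\<close> times the field of \<open>J\<^sub>1\<close>, so this is \<open>first_action_flow\<close> in coordinates.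
\<close>

lemma orbit_derivatives:
  assumes t: "t \<noteq> 0" and x: "orbit_point a b t \<in> U"
    and dH: "((\<lambda>(a, b). \<H> a b) has_derivative (\<lambda>(\<alpha>, \<beta>). A * \<alpha> + B * \<beta>)) (at (a, b))"
  obtains V where
    "\<And>i. ((\<lambda>t. pos i (orbit_point a b t)) has_vector_derivative V i) (at t)"
    "A * t * V 3 = mom 3 (orbit_point a b t)"
    "A * t * V 1 - B * pos 2 (orbit_point a b t) = mom 1 (orbit_point a b t)"
    "A * t * V 2 + B * pos 1 (orbit_point a b t) = mom 2 (orbit_point a b t)"
proof -
  define x where "x = orbit_point a b t"
  have xU: "x \<in> U" using assms by (simp add: x_def)
  define D where "D = frechet_derivative \<Phi> (at x)"
  have D: "(\<Phi> has_derivative D) (at x)"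
    unfolding D_def by (rule symplectic_coordinates_has_derivative[OF sc xU])
  then have lin: "linear D" by (rule has_derivative_linear)
  define W where "W = fst (D (fst x, - snd x))"
  have "((\<lambda>t. \<Phi> (orbit_point a b t)) has_vector_derivative D ((1 / t) *\<^sub>R (fst x, - snd x))) (at t)"
    using vector_derivative_diff_chain_within[OF orbit_point_has_vector_derivative[OF t] has_derivative_at_withinI[OF D[unfolded x_def]]]
    by (simp add: o_def x_def)
  then have "((\<lambda>t. \<Phi> (orbit_point a b t)) has_derivative (\<lambda>s. s *\<^sub>R (1 / t) *\<^sub>R D (fst x, - snd x))) (at t)"
    by (simp only: has_vector_derivative_def linear_cmul[OF lin])
  then have "((\<lambda>t. fst (\<Phi> (orbit_point a b t)) $ i) has_derivative (\<lambda>s. fst (s *\<^sub>R (1 / t) *\<^sub>R D (fst x, - snd x)) $ i)) (at t)" for i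
    by (intro has_derivative_vec_nth_comp has_derivative_fst)
  then have dV: "((\<lambda>t. pos i (orbit_point a b t)) has_vector_derivative W $ i / t) (at t)" for i
    by (simp add: has_vector_derivative_def pos_def W_def)
  have flow: "A *\<^sub>R W + B *\<^sub>R cross3 (axis 3 1) (fst (\<Phi> x)) = snd (\<Phi> x)"
    unfolding W_def D_def
    by (rule first_action_flow[OF sc xU Lz Ham]) (use dH t in \<open>simp_all add: x_def orbit_point_J\<close>)
  have c: "A * W $ i + B * cross3 (axis 3 1) (fst (\<Phi> x)) $ i = snd (\<Phi> x) $ i" for i
    using arg_cong[OF flow, of "\<lambda>v. v $ i"] by simp
  show ?thesis
    by (rule that[OF dV])
       (use c[of 1] c[of 2] c[of 3] t in \<open>simp_all add: cross3_axis3 mom_def pos_def x_def\<close>)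
qed

end

lemma islimpt_of_real_interval:
  assumes "e > 0"
  shows "complex_of_real t0 islimpt (of_real ` {t. \<bar>t - t0\<bar> < e})"
  unfolding islimpt_approachable
proof (intro allI impI)
  fix d :: real assume "d > 0"
  define s where "s = t0 + min d e / 2"
  have "\<bar>s - t0\<bar> < e" "s \<noteq> t0" "\<bar>s - t0\<bar> < d" using assms \<open>d > 0\<close> by (auto simp: s_def min_def)
  then show "\<exists>x'\<in>of_real ` {t. \<bar>t - t0\<bar> < e}. x' \<noteq> complex_of_real t0 \<and> dist x' (of_real t0) < d"
    by (intro bexI[of _ "of_real s"]) (auto simp: dist_norm simp flip: of_real_diff)
qed

lemma complex_derivative_of_real_eq:
  assumes F: "(F has_field_derivative D) (at (complex_of_real t))"
    and f: "(f has_vector_derivative f') (at t)"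
    and e: "e > 0" and eq: "\<And>s. \<bar>s - t\<bar> < e \<Longrightarrow> F (of_real s) = of_real (f s)"
  shows "D = of_real f'"
proof -
  have "((\<lambda>s. F (of_real s)) has_vector_derivative D) (at t)"
    using F by (rule has_vector_derivative_real_field)
  moreover have "((\<lambda>s. complex_of_real (f s)) has_vector_derivative of_real f') (at t)"
    using bounded_linear.has_vector_derivative[OF bounded_linear_of_real f] .
  then have "((\<lambda>s. F (of_real s)) has_vector_derivative of_real f') (at t)"
    by (rule has_vector_derivative_transform_within[OF _ e]) (simp_all add: eq dist_real_def)
  ultimately show ?thesis by (rule vector_derivative_unique_at)
qed

context birkhoff_coordinates
begin

text \<open>
  For real \<open>t\<close> near \<open>t0\<close> all identities follow from \<open>orbit_derivatives\<close> and \<open>phase_space_identities\<close>.  Both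
  sides are holomorphic on the connected set \<open>S\<close>, so they agree there.  With \<open>a = b = 0\<close> the set \<open>S\<close> may contain
  \<open>0\<close>, as \<open>0 / t\<close> is the constant 0.
\<close>

lemma complex_orbit_identities:
  assumes F: "complexifies \<rho> (F 1) (pos 1)" "complexifies \<rho> (F 2) (pos 2)" "complexifies \<rho> (F 3) (pos 3)"
    and dH: "((\<lambda>(a, b). \<H> a b) has_derivative (\<lambda>(\<alpha>, \<beta>). A * \<alpha> + B * \<beta>)) (at (a, b))"
    and S: "open S" "connected S" "(\<lambda>t. of_real a / t) holomorphic_on S" "(\<lambda>t. of_real b / t) holomorphic_on S"
      "\<And>t. t \<in> S \<Longrightarrow> norm t + norm (of_real a / t) + norm (of_real b / t) \<le> \<rho>"
    and t0: "t0 \<noteq> 0" "of_real t0 \<in> S" "orbit_point a b t0 \<in> U"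
    and t: "t \<in> S"
  defines "X \<equiv> \<lambda>i t. F i (t, of_real a / t, of_real b / t)"
  shows "X (i::3) holomorphic_on S"
    and "(X 1 t)\<^sup>2 + (X 2 t)\<^sup>2 + (X 3 t)\<^sup>2 = 1"
    and "(of_real A * t * deriv (X 3) t)\<^sup>2 = pendulum_P (\<H> a b) b (X 3 t)"
    and "of_real A * t * (X 1 t * deriv (X 2) t - X 2 t * deriv (X 1) t) = of_real b - of_real B * (1 - (X 3 t)\<^sup>2)"
    and "of_real A * of_real t0 * deriv (X 3) (of_real t0) = of_real (mom 3 (orbit_point a b t0))"
    and "X i (of_real t0) = of_real (pos i (orbit_point a b t0))"
proof -
  have F': "complexifies \<rho> (F i) (pos i)" for i
    using F exhaust_3[of i] by auto
  have hol: "X i holomorphic_on S" for i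
    using F'[of i] S unfolding complexifies_def X_def by blast
  then show "X i holomorphic_on S" .
  have holD: "deriv (X i) holomorphic_on S" for i by (intro holomorphic_deriv hol S)
  define Q where "Q = {s. s \<noteq> 0 \<and> complex_of_real s \<in> S \<and> orbit_point a b s \<in> U}"
  have "isCont (orbit_point a b) t0"
    using orbit_point_has_vector_derivative[OF t0(1)] by (rule has_vector_derivative_continuous)
  moreover have "open U" using sc by (simp add: symplectic_coordinates_def)
  ultimately have "\<forall>\<^sub>F s in nhds t0. orbit_point a b s \<in> U"
    using t0(3) isCont_imp_tendsto_nhds topological_tendstoD by blast
  moreover have "\<forall>\<^sub>F s in nhds t0. complex_of_real s \<in> S"
    by (rule topological_tendstoD[OF _ S(1) t0(2)]) (intro tendsto_of_real filterlim_ident)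
  moreover have "\<forall>\<^sub>F s in nhds t0. s \<noteq> 0"
    using t0(1) by (intro t1_space_nhds)
  ultimately have "\<forall>\<^sub>F s in nhds t0. s \<in> Q"
    by eventually_elim (simp add: Q_def)
  then obtain e where e: "e > 0" "\<And>s. \<bar>s - t0\<bar> < e \<Longrightarrow> s \<in> Q"
    unfolding eventually_nhds_metric dist_real_def by blast
  have real: "X i (of_real s) = of_real (pos i (orbit_point a b s))" if "\<bar>s - t0\<bar> < e" for s i
  proof -
    have "s \<in> Q" using e(2) that .
    then have "\<bar>s\<bar> + \<bar>a / s\<bar> + \<bar>b / s\<bar> \<le> \<rho>"
      using S(5)[of "of_real s"] by (simp add: Q_def norm_divide)
    then have "F i (of_real s, of_real (a / s), of_real (b / s)) = of_real (pos i (vector [s, 0], vector [a / s, b / s]))"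
      using F'[of i] unfolding complexifies_def by blast
    then show ?thesis by (simp add: X_def orbit_point_def)
  qed
  have ode: "\<exists>V. (\<forall>i. deriv (X i) (of_real s) = of_real (V i)) \<and>
      A * s * V 3 = mom 3 (orbit_point a b s) \<and>
      A * s * V 1 - B * pos 2 (orbit_point a b s) = mom 1 (orbit_point a b s) \<and>
      A * s * V 2 + B * pos 1 (orbit_point a b s) = mom 2 (orbit_point a b s)" if s: "\<bar>s - t0\<bar> < e" for s
  proof -
    have "s \<noteq> 0" "orbit_point a b s \<in> U" and sS: "of_real s \<in> S" using e(2)[OF s] by (auto simp: Q_def)
    from orbit_derivatives[OF this(1,2) dH] obtain V where V:
      "\<And>i. ((\<lambda>t. pos i (orbit_point a b t)) has_vector_derivative V i) (at s)"
      "A * s * V 3 = mom 3 (orbit_point a b s)"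
      "A * s * V 1 - B * pos 2 (orbit_point a b s) = mom 1 (orbit_point a b s)"
      "A * s * V 2 + B * pos 1 (orbit_point a b s) = mom 2 (orbit_point a b s)" by blast
    have "deriv (X i) (of_real s) = of_real (V i)" for i
    proof (rule complex_derivative_of_real_eq[OF _ V(1)])
      show "(X i has_field_derivative deriv (X i) (of_real s)) (at (of_real s))"
        by (rule holomorphic_derivI[OF hol S(1) sS])
      show "e - \<bar>s - t0\<bar> > 0" using s by simp
      show "X i (of_real s') = of_real (pos i (orbit_point a b s'))" if "\<bar>s' - s\<bar> < e - \<bar>s - t0\<bar>" for s'
        by (rule real) (use that in linarith)
    qed
    with V(2-4) show ?thesis by blast
  qed
  have t0e: "\<bar>t0 - t0\<bar> < e" using e by simp
  from real[OF this] show "X i (of_real t0) = of_real (pos i (orbit_point a b t0))" .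
  from ode[OF t0e] show "of_real A * of_real t0 * deriv (X 3) (of_real t0) = of_real (mom 3 (orbit_point a b t0))"
    by (metis of_real_mult)
  have id: "f t = 0" if f: "f holomorphic_on S" and z: "\<And>s. \<bar>s - t0\<bar> < e \<Longrightarrow> f (of_real s) = 0" for f
  proof (rule analytic_continuation[OF f S(1,2) _ t0(2) islimpt_of_real_interval[OF e(1)] _ t])
    show "of_real ` {t. \<bar>t - t0\<bar> < e} \<subseteq> S" using e(2) by (auto simp: Q_def)
    show "f z = 0" if "z \<in> of_real ` {t. \<bar>t - t0\<bar> < e}" for z using that z by auto
  qed
  have sU: "orbit_point a b s \<in> U" "s \<noteq> 0" if "\<bar>s - t0\<bar> < e" for s using e(2)[OF that] by (auto simp: Q_def)
  have "(X 1 t)\<^sup>2 + (X 2 t)\<^sup>2 + (X 3 t)\<^sup>2 - 1 = 0"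
  proof (rule id)
    fix s assume s: "\<bar>s - t0\<bar> < e"
    show "(X 1 (of_real s))\<^sup>2 + (X 2 (of_real s))\<^sup>2 + (X 3 (of_real s))\<^sup>2 - 1 = 0"
      unfolding real[OF s] using arg_cong[OF phase_space_identities(1)[OF sU(1)[OF s]], of complex_of_real] by simp
  qed (intro holomorphic_intros hol)
  then show "(X 1 t)\<^sup>2 + (X 2 t)\<^sup>2 + (X 3 t)\<^sup>2 = 1" by simp
  have "(of_real A * t * deriv (X 3) t)\<^sup>2 - pendulum_P (\<H> a b) b (X 3 t) = 0"
  proof (rule id)
    show "(\<lambda>t. (of_real A * t * deriv (X 3) t)\<^sup>2 - pendulum_P (\<H> a b) b (X 3 t)) holomorphic_on S"
      unfolding pendulum_P_def by (intro holomorphic_intros hol holD)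
    fix s assume s: "\<bar>s - t0\<bar> < e"
    obtain V where V: "\<And>i. deriv (X i) (of_real s) = of_real (V i)" "A * s * V 3 = mom 3 (orbit_point a b s)"
      using ode[OF s] by blast
    show "(of_real A * of_real s * deriv (X 3) (of_real s))\<^sup>2 - pendulum_P (\<H> a b) b (X 3 (of_real s)) = 0"
      unfolding V real[OF s] pendulum_P_def of_real_mult[symmetric] V(2)
      using arg_cong[OF phase_space_identities(2)[OF sU(1)[OF s]], of complex_of_real]
      by (simp add: orbit_point_J sU(2)[OF s])
  qed
  then show "(of_real A * t * deriv (X 3) t)\<^sup>2 = pendulum_P (\<H> a b) b (X 3 t)" by simp
  have "of_real A * t * (X 1 t * deriv (X 2) t - X 2 t * deriv (X 1) t) - (of_real b - of_real B * (1 - (X 3 t)\<^sup>2)) = 0"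
  proof (rule id)
    show "(\<lambda>t. of_real A * t * (X 1 t * deriv (X 2) t - X 2 t * deriv (X 1) t) - (of_real b - of_real B * (1 - (X 3 t)\<^sup>2))) holomorphic_on S"
      by (intro holomorphic_intros hol holD)
    fix s assume s: "\<bar>s - t0\<bar> < e"
    define p where "p = (\<lambda>i. pos i (orbit_point a b s))"
    obtain V where V: "\<And>i. deriv (X i) (of_real s) = of_real (V i)"
      "A * s * V 1 - B * p 2 = mom 1 (orbit_point a b s)" "A * s * V 2 + B * p 1 = mom 2 (orbit_point a b s)"
      using ode[OF s] unfolding p_def by blast
    have "p 1 * (A * s * V 2 + B * p 1) - p 2 * (A * s * V 1 - B * p 2) = b"
      unfolding V(2,3) unfolding p_def using phase_space_identities(3)[OF sU(1)[OF s]] by (simp add: orbit_point_J sU(2)[OF s])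
    moreover have sq: "1 - (p 3)\<^sup>2 = p 1 * p 1 + p 2 * p 2"
      unfolding p_def using phase_space_identities(1)[OF sU(1)[OF s]] by (simp add: power2_eq_square)
    ultimately have "A * s * (p 1 * V 2 - p 2 * V 1) - (b - B * (1 - (p 3)\<^sup>2)) = 0"
      unfolding sq by (simp add: ring_distribs mult_ac)
    from arg_cong[OF this, of complex_of_real]
    show "of_real A * of_real s * (X 1 (of_real s) * deriv (X 2) (of_real s) - X 2 (of_real s) * deriv (X 1) (of_real s))
        - (of_real b - of_real B * (1 - (X 3 (of_real s))\<^sup>2)) = 0"
      unfolding V(1) real[OF s] by (simp add: p_def)
  qed
  then show "of_real A * t * (X 1 t * deriv (X 2) t - X 2 t * deriv (X 1) t) = of_real b - of_real B * (1 - (X 3 t)\<^sup>2)"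
    by simp
qed

lemma open_U: "open U" and zero_in_U: "0 \<in> U" and Phi_0: "\<Phi> 0 = unstable_equilibrium"
  using sc by (auto simp: symplectic_coordinates_def)

lemma H_quadratic:
  obtains C d where "C > 0" "d > 0"
    "\<And>a b. \<bar>a\<bar> < d \<Longrightarrow> \<bar>b\<bar> < d \<Longrightarrow> \<bar>\<H> a b - a\<bar> \<le> C * norm (a, b) ^ 2"
proof -
  obtain C where C: "C > 0" "\<forall>\<^sub>F z in nhds (0, 0). norm (case z of (a, b) \<Rightarrow> \<H> a b - a) \<le> C * norm (norm z ^ 2)"
    using quad by (rule landau_o.bigE)
  then obtain e where e: "e > 0" "\<And>z. dist z (0, 0) < e \<Longrightarrow> norm (case z of (a, b) \<Rightarrow> \<H> a b - a) \<le> C * norm (norm z ^ 2)"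
    unfolding eventually_nhds_metric by blast
  show ?thesis
  proof (rule that[OF C(1), of "e / 2"])
    fix a b :: real assume "\<bar>a\<bar> < e / 2" "\<bar>b\<bar> < e / 2"
    then have "dist (a, b) (0, 0) < e" using norm_Pair_le[of a b] by (simp add: dist_norm)
    from e(2)[OF this] show "\<bar>\<H> a b - a\<bar> \<le> C * norm (a, b) ^ 2" by simp
  qed (use e in simp)
qed

lemma H_0: "\<H> 0 0 = 0"
proof -
  obtain C d where "d > 0" "\<And>a b. \<bar>a\<bar> < d \<Longrightarrow> \<bar>b\<bar> < d \<Longrightarrow> \<bar>\<H> a b - a\<bar> \<le> C * norm (a, b) ^ 2"
    by (rule H_quadratic) (rule that; assumption)
  from this(2)[of 0 0] this(1) show ?thesis by simp
qed

lemma H_has_derivative_0: "((\<lambda>(a, b). \<H> a b) has_derivative (\<lambda>(\<alpha>, \<beta>). 1 * \<alpha> + 0 * \<beta>)) (at (0, 0))"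
proof -
  obtain C d where d: "d > 0" "\<And>a b. \<bar>a\<bar> < d \<Longrightarrow> \<bar>b\<bar> < d \<Longrightarrow> \<bar>\<H> a b - a\<bar> \<le> C * norm (a, b) ^ 2"
    by (rule H_quadratic) (rule that; assumption)
  have "((\<lambda>z. \<H> (fst z) (snd z) - fst z) has_derivative (\<lambda>_. 0)) (at (0, 0))"
  proof (rule has_derivative_zero_if_quadratic[OF d(1)])
    fix z :: "real \<times> real" assume "dist z (0, 0) < d"
    then have "\<bar>fst z\<bar> < d" "\<bar>snd z\<bar> < d"
      using norm_fst_le[of "fst z" "snd z"] norm_snd_le[of "snd z" "fst z"] by (auto simp: dist_norm zero_prod_def[symmetric])
    from d(2)[OF this] show "norm (\<H> (fst z) (snd z) - fst z) \<le> C * norm (z - (0, 0)) ^ 2"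
      by (simp add: zero_prod_def[symmetric])
  qed
  from has_derivative_add[OF this has_derivative_fst[OF has_derivative_ident]]
  show ?thesis by (simp add: case_prod_unfold)
qed

lemma pendulum_H_differentiable: "pendulum_H differentiable (at z)"
proof -
  have "(\<lambda>z :: (real^3) \<times> (real^3). fst z $ 3) differentiable (at z)"
    by (rule differentiableI[OF has_derivative_vec_nth_comp[OF has_derivative_fst[OF has_derivative_ident]]])
  moreover have "fst differentiable (at z)" "snd differentiable (at z)" for z :: "(real^3) \<times> (real^3)"
    by (auto intro!: differentiableI has_derivative_fst has_derivative_snd has_derivative_ident)
  ultimately show ?thesis
    unfolding pendulum_H_alt[abs_def]
    by (intro differentiable_diff differentiable_add differentiable_mult differentiable_inner differentiable_const) auto
qed

lemma orbit_section_has_derivative: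
  "((\<lambda>(a, b). orbit_point a b t) has_derivative (\<lambda>(a, b). (0, (1 / t) *\<^sub>R vector [a, b]))) (at p)"
proof -
  have "linear (\<lambda>(a, b). (0 :: real^2, (1 / t) *\<^sub>R vector [a, b] :: real^2))"
    by (rule linearI) (auto simp: vec_eq_iff forall_2 algebra_simps add_divide_distrib)
  then have "bounded_linear (\<lambda>(a, b). (0 :: real^2, (1 / t) *\<^sub>R vector [a, b] :: real^2))"
    by (simp add: linear_conv_bounded_linear)
  then have "((\<lambda>(a, b). (0 :: real^2, (1 / t) *\<^sub>R vector [a, b] :: real^2)) has_derivative
      (\<lambda>(a, b). (0, (1 / t) *\<^sub>R vector [a, b]))) (at p)"
    by (rule bounded_linear_imp_has_derivative)
  from has_derivative_add[OF has_derivative_const[of "(t *\<^sub>R axis 1 1, 0)"] this]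
  show ?thesis by (simp add: orbit_point_alt case_prod_unfold)
qed

text \<open>
  On the section \<open>q = (t, 0)\<close>, \<open>p = (a, b) / t\<close> the actions are \<open>a\<close> and \<open>b\<close>, so \<open>\<H>\<close> is the energy
  restricted to the section, and differentiability is inherited from the coordinates.
\<close>

lemma H_differentiable:
  assumes "t \<noteq> 0" "orbit_point a b t \<in> U"
  obtains A B where "((\<lambda>(a, b). \<H> a b) has_derivative (\<lambda>(\<alpha>, \<beta>). A * \<alpha> + B * \<beta>)) (at (a, b))"
proof -
  let ?s = "\<lambda>(a, b). orbit_point a b t"
  have ds: "?s differentiable (at (a, b))"
    by (rule differentiableI[OF orbit_section_has_derivative])
  have "isCont ?s (a, b)" by (rule differentiable_imp_continuous_within[OF ds])
  then have "\<forall>\<^sub>F z in nhds (a, b). ?s z \<in> U"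
    using isCont_imp_tendsto_nhds topological_tendstoD[OF _ open_U] assms(2) by fastforce
  then obtain e where e: "e > 0" "\<And>z. dist z (a, b) < e \<Longrightarrow> ?s z \<in> U"
    unfolding eventually_nhds_metric by blast
  have "(\<lambda>z. \<Phi> (?s z)) differentiable (at (a, b))"
    using differentiable_chain_at[OF ds] symplectic_coordinates_has_derivative[OF sc assms(2)]
    by (auto simp: differentiable_def o_def)
  from differentiable_chain_at[OF this pendulum_H_differentiable]
  have "(\<lambda>z. pendulum_H (\<Phi> (?s z))) differentiable (at (a, b))" by (simp add: o_def)
  then obtain L where L: "((\<lambda>z. pendulum_H (\<Phi> (?s z))) has_derivative L) (at (a, b))"
    by (auto simp: differentiable_def)
  then have "((\<lambda>(a, b). \<H> a b) has_derivative L) (at (a, b))"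
  proof (rule has_derivative_transform_within[OF _ e(1)])
    show "pendulum_H (\<Phi> (?s z)) = (\<lambda>(a, b). \<H> a b) z" if "dist z (a, b) < e" for z
      using Ham[OF e(2)[OF that]] assms(1) by (cases z) (simp add: orbit_point_J)
  qed auto
  moreover have "L = (\<lambda>(\<alpha>, \<beta>). L (1, 0) * \<alpha> + L (0, 1) * \<beta>)"
  proof
    fix z :: "real \<times> real"
    have lin: "linear L" using L by (rule has_derivative_linear)
    have "z = fst z *\<^sub>R (1, 0) + snd z *\<^sub>R (0, 1)" by (cases z) simp
    then have "L z = fst z * L (1, 0) + snd z * L (0, 1)"
      by (metis linear_add[OF lin] linear_cmul[OF lin] real_scaleR_def)
    then show "L z = (case z of (\<alpha>, \<beta>) \<Rightarrow> L (1, 0) * \<alpha> + L (0, 1) * \<beta>)"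
      by (simp add: case_prod_unfold mult.commute)
  qed
  ultimately show ?thesis using that[of "L (1, 0)" "L (0, 1)"] by simp
qed

text \<open>
  The only point of the phase space with energy 0 and \<open>z = 1\<close> is the equilibrium, and the coordinates are
  injective.
\<close>

lemma unstable_manifold_not_equilibrium:
  assumes "t \<noteq> 0" "orbit_point 0 0 t \<in> U"
  shows "pos 3 (orbit_point 0 0 t) \<noteq> 1"
proof
  let ?x = "orbit_point 0 0 t"
  define r p where "r = fst (\<Phi> ?x)" and "p = snd (\<Phi> ?x)"
  assume "pos 3 ?x = 1"
  then have r3: "r $ 3 = 1" by (simp add: pos_def r_def)
  with phase_space_identities(1)[OF assms(2)] have "(r $ 1)\<^sup>2 + (r $ 2)\<^sup>2 = 0" by (simp add: pos_def r_def)
  then have r: "r = vector [0, 0, 1]" using r3 by (simp add: vec_eq_iff forall_3 sum_power2_eq_zero_iff)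
  have "\<Phi> ?x \<in> phase_space" by (rule symplectic_coordinates_in_phase_space[OF sc assms(2)])
  then have rr: "r \<bullet> r = 1" "r \<bullet> p = 0" by (auto simp: phase_space_def norm_eq_1 r_def p_def)
  have "pendulum_H (\<Phi> ?x) = 0" using Ham[OF assms(2)] assms(1) H_0 by (simp add: orbit_point_J)
  then have "p \<bullet> p = 0" using rr r3 by (simp add: pendulum_H_alt r_def p_def)
  then have "\<Phi> ?x = unstable_equilibrium"
    using r by (simp add: unstable_equilibrium_def prod_eq_iff r_def p_def)
  then have "\<Phi> ?x = \<Phi> 0" using Phi_0 by simp
  moreover obtain \<Psi> where "homeomorphism U (\<Phi> ` U) \<Phi> \<Psi>"
    using sc unfolding symplectic_coordinates_def by blast
  ultimately have "?x = 0"
    using homeomorphism_apply1[of U "\<Phi> ` U" \<Phi> \<Psi>] assms(2) zero_in_U by metis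
  then have "fst ?x $ 1 = 0" by simp
  then show False using assms(1) by (simp add: orbit_point_def)
qed

end

lemma holomorphic_limit_eq:
  assumes "f holomorphic_on ball 0 r" "g holomorphic_on ball 0 r" "r > 0"
    and "\<And>t. t \<in> ball 0 r \<Longrightarrow> t \<noteq> 0 \<Longrightarrow> f t = g t"
  shows "f 0 = g 0"
proof -
  have "isCont f 0" "isCont g 0"
    using assms(1,2,3) by (auto intro: holomorphic_on_imp_continuous_on continuous_on_interior simp: interior_open)
  then have "f \<midarrow>0\<rightarrow> f 0" "g \<midarrow>0\<rightarrow> g 0" by (simp_all add: isCont_def)
  moreover have "\<forall>\<^sub>F t in at 0. f t = g t"
    unfolding eventually_at using assms(3,4) by (intro exI[of _ r]) auto
  ultimately have "f \<midarrow>0\<rightarrow> g 0" by (simp add: tendsto_cong)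
  then show ?thesis using \<open>f \<midarrow>0\<rightarrow> f 0\<close> LIM_unique by blast
qed

text \<open>
  Let \<open>z - 1 = t\<^sup>n k\<close>.  Then \<open>\<sigma> = t z' / (z - 1) = n + t k'/k\<close> is holomorphic with \<open>\<sigma>\<^sup>2 = 2 (z + 1)\<close>, and at
  \<open>t = 0\<close> this reads \<open>n\<^sup>2 = 4\<close>.  As \<open>\<sigma>(0) = 2\<close>, near \<open>0\<close> it is the principal square root; this fixes the
  orientation: \<open>q\<close> is the expanding direction.
\<close>

lemma separatrix_double_zero:
  assumes z: "z holomorphic_on ball 0 r" "r > 0" "z 0 = 1" "\<not> z constant_on ball 0 r"
    and ode: "\<And>t. t \<in> ball 0 r \<Longrightarrow> (t * deriv z t)\<^sup>2 = 2 * (1 - (z t)\<^sup>2) * (1 - z t)"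
  obtains k e where "0 < e" "e \<le> r" "k holomorphic_on ball 0 e"
    "\<And>t. t \<in> ball 0 e \<Longrightarrow> k t \<noteq> 0"
    "\<And>t. t \<in> ball 0 e \<Longrightarrow> z t - 1 = t\<^sup>2 * k t"
    "\<And>t. t \<in> ball 0 e \<Longrightarrow> t * deriv z t = (z t - 1) * csqrt (2 * (z t + 1))"
proof -
  have f: "(\<lambda>t. z t - 1) holomorphic_on ball 0 r" by (intro holomorphic_intros z)
  have t0: "0 \<in> ball (0::complex) r" "z 0 - 1 = 0" using z by simp_all
  have nc: "\<not> (\<lambda>t. z t - 1) constant_on ball 0 r"
    using z(4) unfolding constant_on_def by (metis diff_add_cancel)
  obtain k e1 n where n: "0 < n" "0 < e1" "ball 0 e1 \<subseteq> ball (0::complex) r" "k holomorphic_on ball 0 e1"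
      "\<And>w. w \<in> ball 0 e1 \<Longrightarrow> z w - 1 = (w - 0) ^ n * k w" "\<And>w. w \<in> ball 0 e1 \<Longrightarrow> k w \<noteq> 0"
    by (rule holomorphic_factor_zero_nonconstant[OF f open_ball connected_ball t0 nc]) (rule that; assumption)
  have zk: "z t = 1 + t ^ n * k t" if "t \<in> ball 0 e1" for t using n(5)[OF that] by (simp add: algebra_simps)
  have dz: "t * deriv z t = t ^ n * (of_nat n * k t + t * deriv k t)" if t: "t \<in> ball 0 e1" for t
  proof -
    have "((\<lambda>t. 1 + t ^ n * k t) has_field_derivative of_nat n * t ^ (n - 1) * k t + t ^ n * deriv k t) (at t)"
      by (auto intro!: derivative_eq_intros holomorphic_derivI[OF n(4) open_ball t] simp: algebra_simps)
    then have "(z has_field_derivative of_nat n * t ^ (n - 1) * k t + t ^ n * deriv k t) (at t)"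
      by (rule has_field_derivative_transform_within_open[OF _ open_ball t]) (simp add: zk)
    then have "deriv z t = of_nat n * t ^ (n - 1) * k t + t ^ n * deriv k t" by (rule DERIV_imp_deriv)
    then show ?thesis using n(1) by (cases n) (simp_all add: algebra_simps)
  qed
  have kd: "deriv k holomorphic_on ball 0 e1" by (intro holomorphic_deriv n open_ball)
  have zh: "z holomorphic_on ball 0 e1" by (rule holomorphic_on_subset[OF z(1) n(3)])
  define \<sigma> where "\<sigma> = (\<lambda>t. (of_nat n * k t + t * deriv k t) / k t)"
  have sh: "\<sigma> holomorphic_on ball 0 e1"
    unfolding \<sigma>_def by (intro holomorphic_intros n kd)
  have sq: "(\<sigma> t)\<^sup>2 = 2 * (z t + 1)" if t: "t \<in> ball 0 e1" "t \<noteq> 0" for t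
  proof -
    have "t \<in> ball 0 r" using t n(3) by blast
    from ode[OF this] have "(t ^ n * (of_nat n * k t + t * deriv k t))\<^sup>2 = 2 * (z t - 1)\<^sup>2 * (z t + 1)"
      unfolding dz[OF t(1)] by (simp add: power2_eq_square algebra_simps)
    also have "\<dots> = (t ^ n * k t)\<^sup>2 * (2 * (z t + 1))" using n(5)[OF t(1)] by simp
    finally have "(t ^ n * k t)\<^sup>2 * (\<sigma> t)\<^sup>2 = (t ^ n * k t)\<^sup>2 * (2 * (z t + 1))"
      using n(6)[OF t(1)] by (simp add: \<sigma>_def power_mult_distrib power_divide)
    then show ?thesis using n(6)[OF t(1)] t(2) by simp
  qed
  have "(\<sigma> 0)\<^sup>2 = 2 * (z 0 + 1)"
    by (rule holomorphic_limit_eq[where f="\<lambda>t. (\<sigma> t)\<^sup>2" and g="\<lambda>t. 2 * (z t + 1)", OF _ _ n(2) sq])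
       (intro holomorphic_intros sh zh)+
  moreover have s0: "\<sigma> 0 = of_nat n" using n(2) n(6)[of 0] by (simp add: \<sigma>_def)
  ultimately have "(of_nat n :: complex)\<^sup>2 = 4" using z(3) by simp
  then have "of_nat (n\<^sup>2) = (of_nat 4 :: complex)" by simp
  then have "n\<^sup>2 = 2\<^sup>2" by (simp only: of_nat_eq_iff) simp
  then have n2: "n = 2" by (simp only: power2_eq_iff_nonneg zero_le)
  have "isCont \<sigma> 0"
    using sh n(2) by (auto intro: holomorphic_on_imp_continuous_on continuous_on_interior simp: interior_open)
  then have "(\<lambda>t. Re (\<sigma> t)) \<midarrow>0\<rightarrow> 2" using s0 n2 by (auto simp: isCont_def intro!: tendsto_eq_intros)
  then have "\<forall>\<^sub>F t in at 0. Re (\<sigma> t) > 0" by (rule order_tendstoD) simp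
  then obtain e2 where e2: "e2 > 0" "\<And>t. t \<noteq> 0 \<Longrightarrow> dist t 0 < e2 \<Longrightarrow> Re (\<sigma> t) > 0"
    unfolding eventually_at by blast
  define e where "e = min e1 (min e2 r)"
  have e: "ball 0 e \<subseteq> ball (0::complex) e1" by (auto simp: e_def)
  show ?thesis
  proof (rule that[of e k])
    show "0 < e" "e \<le> r" using n(2) e2(1) z(2) by (auto simp: e_def)
    show "k holomorphic_on ball 0 e" by (rule holomorphic_on_subset[OF n(4) e])
    fix t :: complex assume t: "t \<in> ball 0 e"
    then have t1: "t \<in> ball 0 e1" using e by blast
    show "k t \<noteq> 0" by (rule n(6)[OF t1])
    show "z t - 1 = t\<^sup>2 * k t" using n(5)[OF t1] n2 by simp
    show "t * deriv z t = (z t - 1) * csqrt (2 * (z t + 1))"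
    proof (cases "t = 0")
      case True
      then show ?thesis using z(3) by simp
    next
      case False
      have "Re (\<sigma> t) > 0" using e2(2)[OF False] t by (simp add: e_def dist_norm)
      then have "csqrt (2 * (z t + 1)) = \<sigma> t" by (intro csqrt_unique sq t1 False) simp
      then show ?thesis using dz[OF t1] n(5)[OF t1] n(6)[OF t1] by (simp add: \<sigma>_def)
    qed
  qed
qed

text \<open>
  Both factors vanish at \<open>0\<close> and the zero of the product is exactly double.
\<close>

lemma simple_zeros_of_product:
  assumes u: "u holomorphic_on ball 0 r" "u 0 = 0" and v: "v holomorphic_on ball 0 r" "v 0 = 0" and "r > 0"
    and k: "k holomorphic_on ball 0 r" "k 0 \<noteq> 0" and uv: "\<And>t. t \<in> ball 0 r \<Longrightarrow> u t * v t = t\<^sup>2 * k t"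
  obtains k1 e where "0 < e" "e \<le> r" "k1 holomorphic_on ball 0 e" "\<And>t. t \<in> ball 0 e \<Longrightarrow> k1 t \<noteq> 0"
    "\<And>t. t \<in> ball 0 e \<Longrightarrow> u t = t * k1 t"
proof -
  have "isCont k 0"
    using k(1) \<open>r > 0\<close> by (auto intro: holomorphic_on_imp_continuous_on continuous_on_interior simp: interior_open)
  from tendsto_imp_eventually_ne[OF isCont_imp_tendsto_nhds[OF this] k(2)]
  obtain e0 where e0: "e0 > 0" "\<And>t. dist t 0 < e0 \<Longrightarrow> k t \<noteq> 0" unfolding eventually_nhds_metric by blast
  define t1 where "t1 = complex_of_real (min e0 r / 2)"
  have t1: "t1 \<noteq> 0" "norm t1 < e0" "t1 \<in> ball 0 r" using e0(1) \<open>r > 0\<close> by (auto simp: t1_def)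
  then have "u t1 * v t1 \<noteq> 0" using uv e0(2)[of t1] by (simp add: dist_norm)
  have t0: "0 \<in> ball (0::complex) r" using \<open>r > 0\<close> by simp
  have nc: "\<not> u constant_on ball 0 r" "\<not> v constant_on ball 0 r"
    using \<open>u t1 * v t1 \<noteq> 0\<close> u(2) v(2) t1(3) t0 unfolding constant_on_def
    by (metis mult_zero_left, metis mult_zero_right)
  obtain g1 e1 n1 where g1: "0 < n1" "0 < e1" "ball 0 e1 \<subseteq> ball (0::complex) r" "g1 holomorphic_on ball 0 e1"
      "\<And>w. w \<in> ball 0 e1 \<Longrightarrow> u w = (w - 0) ^ n1 * g1 w" "\<And>w. w \<in> ball 0 e1 \<Longrightarrow> g1 w \<noteq> 0"
    by (rule holomorphic_factor_zero_nonconstant[OF u(1) open_ball connected_ball t0 u(2) nc(1)]) (rule that; assumption)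
  obtain g2 e2 n2 where g2: "0 < n2" "0 < e2" "ball 0 e2 \<subseteq> ball (0::complex) r" "g2 holomorphic_on ball 0 e2"
      "\<And>w. w \<in> ball 0 e2 \<Longrightarrow> v w = (w - 0) ^ n2 * g2 w" "\<And>w. w \<in> ball 0 e2 \<Longrightarrow> g2 w \<noteq> 0"
    by (rule holomorphic_factor_zero_nonconstant[OF v(1) open_ball connected_ball t0 v(2) nc(2)]) (rule that; assumption)
  define e where "e = min r (min e1 e2)"
  have e: "0 < e" "ball 0 e \<subseteq> ball (0::complex) e1" "ball 0 e \<subseteq> ball (0::complex) e2" "ball 0 e \<subseteq> ball (0::complex) r"
    using g1(2) g2(2) \<open>r > 0\<close> by (auto simp: e_def)
  \<comment> \<open>The excess of the order over 2.\<close>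
  obtain m where m: "n1 + n2 = m + 2" using g1(1) g2(1) by (metis add.commute le_Suc_ex add_mono One_nat_def Suc_leI one_add_one)
  have "(\<lambda>t. t ^ m * (g1 t * g2 t)) 0 = k 0"
  proof (rule holomorphic_limit_eq[OF _ _ e(1)])
    show "(\<lambda>t. t ^ m * (g1 t * g2 t)) holomorphic_on ball 0 e"
      by (intro holomorphic_intros holomorphic_on_subset[OF g1(4) e(2)] holomorphic_on_subset[OF g2(4) e(3)])
    show "k holomorphic_on ball 0 e" by (rule holomorphic_on_subset[OF k(1) e(4)])
    fix t :: complex assume t: "t \<in> ball 0 e" "t \<noteq> 0"
    have "t\<^sup>2 * (t ^ m * (g1 t * g2 t)) = t ^ (m + 2) * (g1 t * g2 t)" by (simp add: power_add mult_ac power2_eq_square)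
    also have "\<dots> = u t * v t"
      unfolding m[symmetric] using g1(5)[OF subsetD[OF e(2) t(1)]] g2(5)[OF subsetD[OF e(3) t(1)]]
      by (simp add: power_add mult_ac)
    also have "\<dots> = t\<^sup>2 * k t" using uv t e by blast
    finally show "t ^ m * (g1 t * g2 t) = k t" using t(2) by simp
  qed
  then have "m = 0" using k(2) by (cases m) auto
  then have "n1 = 1" using m g1(1) g2(1) by simp
  then show ?thesis
    using g1 e by (intro that[of e g1]) (auto simp: e_def intro: holomorphic_on_subset[OF g1(4)])
qed

section \<open>The slopes of the elliptic integral along an orbit\<close>

text \<open>
  The velocity \<open>A t Z'\<close> and the branch \<open>w(Z)\<close> have equal squares without zeros on the connected set \<open>T\<close>, so they
  agree up to a sign, which \<open>sign\<close> fixes at \<open>t = R\<close>.  Then \<open>d\<zeta>/w = dt/(A t)\<close> on the loop \<open>Z\<close>, which winds twice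
  around the circle.  In the second integral \<open>id3\<close> gives \<open>b / ((1 - Z\<^sup>2) A t) = B / (A t)\<close> plus the angular form.
\<close>

lemma orbit_loop_slopes:
  fixes X Y Z :: "complex \<Rightarrow> complex" and A B h b :: real
  assumes r: "0 < r'" "r' < \<rho>" "\<rho> < R'" "R' < 2"
    and pert: "\<And>\<zeta>. r' < norm (\<zeta> - 1) \<Longrightarrow> norm (\<zeta> - 1) < R' \<Longrightarrow> norm (cycle_perturbation h b \<zeta>) \<le> 1/2"
    and R: "R > 0" and T: "open T" "connected T" "sphere 0 R \<subseteq> T" "0 \<notin> T"
    and hol: "X holomorphic_on T" "Y holomorphic_on T" "Z holomorphic_on T"
    and id1: "\<And>t. t \<in> T \<Longrightarrow> (X t)\<^sup>2 + (Y t)\<^sup>2 + (Z t)\<^sup>2 = 1"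
    and id2: "\<And>t. t \<in> T \<Longrightarrow> (of_real A * t * deriv Z t)\<^sup>2 = pendulum_P h b (Z t)"
    and id3: "\<And>t. t \<in> T \<Longrightarrow> of_real A * t * (X t * deriv Y t - Y t * deriv X t) = of_real b - of_real B * (1 - (Z t)\<^sup>2)"
    and l0: "l0 holomorphic_on T" "\<And>t. t \<in> T \<Longrightarrow> Z t - 1 = t\<^sup>2 * exp (l0 t)"
    and l1: "l1 holomorphic_on T" "\<And>t. t \<in> T \<Longrightarrow> X t + \<i> * Y t = t ^ 1 * exp (l1 t)"
    and l2: "l2 holomorphic_on T" "\<And>t. t \<in> T \<Longrightarrow> X t - \<i> * Y t = t ^ 1 * exp (l2 t)"
    and ZA: "\<And>t. t \<in> T \<Longrightarrow> r' < norm (Z t - 1) \<and> norm (Z t - 1) < R'"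
    and sign: "of_real A * of_real R * deriv Z (of_real R) + cycle_root h b (Z (of_real R)) \<noteq> 0"
  shows "A \<noteq> 0" "cycle_slope_h \<rho> (h, b) (h, b) = of_real (1 / A)" "cycle_slope_j \<rho> (h, b) (h, b) = of_real (B / A)"
proof -
  let ?N = "{\<zeta>. r' < norm (\<zeta> - 1) \<and> norm (\<zeta> - (1::complex)) < R'}"
  define w where "w = cycle_root h b"
  have N: "0 < norm (\<zeta> - 1)" "norm (\<zeta> - 1) < 2" "norm (cycle_perturbation h b \<zeta>) \<le> 1/2" if "\<zeta> \<in> ?N" for \<zeta>
    using that r pert by auto
  have wh: "w holomorphic_on ?N" unfolding w_def by (rule cycle_root_holomorphic) (use N in auto)
  have wnz: "w \<zeta> \<noteq> 0" if "\<zeta> \<in> ?N" for \<zeta> unfolding w_def by (rule cycle_root_nz[OF N[OF that]])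
  have wsq: "(w \<zeta>)\<^sup>2 = pendulum_P h b \<zeta>" if "\<zeta> \<in> ?N" for \<zeta>
    unfolding w_def by (rule cycle_root_square[OF N(1,2)[OF that]])
  have snz: "1 - \<zeta>\<^sup>2 \<noteq> 0" if "\<zeta> \<in> ?N" for \<zeta> by (rule one_minus_square_nz(3)[OF N(1,2)[OF that]])
  have ZN: "Z t \<in> ?N" if "t \<in> T" for t using ZA[OF that] by simp
  have RT: "of_real R \<in> T" using T(3) R by (auto simp: subset_iff)
  have WZ: "(\<lambda>t. w (Z t)) holomorphic_on T"
    using holomorphic_on_compose_gen[OF hol(3) wh] ZN by (auto simp: o_def)
  have dZ: "deriv Z holomorphic_on T" by (intro holomorphic_deriv hol T)
  \<comment> \<open>The ratio of the two square roots; it takes the values \<open>1\<close> and \<open>-1\<close> only.\<close>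
  define g where "g = (\<lambda>t. of_real A * t * deriv Z t / w (Z t))"
  have g1: "g t = 1 \<or> g t = -1" if "t \<in> T" for t
  proof -
    have "(g t)\<^sup>2 = 1"
      unfolding g_def power_divide id2[OF that] wsq[OF ZN[OF that], symmetric]
      using wnz[OF ZN[OF that]] by simp
    then show ?thesis by (simp add: power2_eq_1_iff)
  qed
  have "g constant_on T"
  proof (rule continuous_finite_range_constant[OF T(2)])
    show "continuous_on T g"
      unfolding g_def
      by (intro holomorphic_on_imp_continuous_on holomorphic_intros dZ WZ) (use wnz ZN in auto)
    show "finite (g ` T)" by (rule finite_subset[of _ "{1, -1}"]) (use g1 in blast, simp)
  qed
  then have "g t = g (of_real R)" if "t \<in> T" for t using that RT by (auto simp: constant_on_def)
  moreover have "g (of_real R) = 1"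
    using g1[OF RT] sign wnz[OF ZN[OF RT]] unfolding g_def w_def by (auto simp: field_simps)
  ultimately have vel: "of_real A * t * deriv Z t = w (Z t)" if "t \<in> T" for t
    using that wnz[OF ZN[OF that]] by (simp add: g_def field_simps)
  show A: "A \<noteq> 0" using vel[OF RT] wnz[OF ZN[OF RT]] by auto
  have inv: "((\<lambda>t. c / t) has_contour_integral 2 * of_real pi * \<i> * c) (circlepath 0 R)" for c :: complex
    using Cauchy_integral_circlepath[of 0 R "\<lambda>_. c" 0] R by simp
  have Zl: "Z t = 1 + t ^ 2 * exp (l0 t)" if "t \<in> T" for t using l0(2)[OF that] by (simp add: algebra_simps)
  have loop: "2 * contour_integral (circlepath 1 \<rho>) f = I"
    if f: "f holomorphic_on ?N" and I: "(F has_contour_integral I) (circlepath 0 R)"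
      and eq: "\<And>t. t \<in> sphere 0 R \<Longrightarrow> f (Z t) * deriv Z t = F t" for f F I
  proof -
    have "((\<lambda>t. f (Z t) * deriv Z t) has_contour_integral of_nat 2 * contour_integral (circlepath 1 \<rho>) f) (circlepath 0 R)"
      by (rule winding_loop_integral[OF r(1-3) f R T(1,3) l0(1) Zl ZA]) (use T(3) in auto)
    moreover have "((\<lambda>t. f (Z t) * deriv Z t) has_contour_integral I) (circlepath 0 R)"
      by (rule has_contour_integral_eq[OF I]) (use eq R in auto)
    ultimately show ?thesis using has_contour_integral_unique by fastforce
  qed
  have tT: "t \<in> T" "t \<noteq> 0" if "t \<in> sphere 0 R" for t using that T(3,4) by auto
  have "2 * contour_integral (circlepath 1 \<rho>) (\<lambda>\<zeta>. 1 / w \<zeta>) = 2 * of_real pi * \<i> * (1 / of_real A)"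
  proof (rule loop[OF _ inv])
    show "(\<lambda>\<zeta>. 1 / w \<zeta>) holomorphic_on ?N" by (intro holomorphic_intros wh wnz)
    fix t :: complex assume "t \<in> sphere 0 R"
    note t = tT[OF this]
    show "1 / w (Z t) * deriv Z t = 1 / of_real A / t"
      using vel[OF t(1)] wnz[OF ZN[OF t(1)]] t(2) A by (simp add: field_simps)
  qed
  from arg_cong[OF this, of "\<lambda>x. x / 2"]
  have "contour_integral (circlepath 1 \<rho>) (\<lambda>\<zeta>. 1 / w \<zeta>) = of_real pi * \<i> / of_real A" by simp
  moreover have "2 / (w \<zeta> + w \<zeta>) = 1 / w \<zeta>" for \<zeta> by simp
  ultimately show "cycle_slope_h \<rho> (h, b) (h, b) = of_real (1 / A)"
    unfolding cycle_slope_h_def case_prod_conv w_def[symmetric] by simp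
  define F where "F = (\<lambda>t. (of_real (B / A)) / t + (X t * deriv Y t - Y t * deriv X t) / ((X t)\<^sup>2 + (Y t)\<^sup>2))"
  have F: "(F has_contour_integral 2 * of_real pi * \<i> * of_real (B / A) + 0) (circlepath 0 R)"
    unfolding F_def
    by (rule has_contour_integral_add[OF inv angular_form_integral_zero[OF R T(1,3,4) hol(1,2) l1 l2]])
  have "2 * contour_integral (circlepath 1 \<rho>) (\<lambda>\<zeta>. of_real b / ((1 - \<zeta>\<^sup>2) * w \<zeta>)) = 2 * of_real pi * \<i> * of_real (B / A) + 0"
  proof (rule loop[OF _ F])
    show "(\<lambda>\<zeta>. of_real b / ((1 - \<zeta>\<^sup>2) * w \<zeta>)) holomorphic_on ?N"
      by (intro holomorphic_intros wh) (use wnz snz in auto)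
    fix t :: complex assume "t \<in> sphere 0 R"
    note t = tT[OF this]
    define s where "s = 1 - (Z t)\<^sup>2"
    define q where "q = X t * deriv Y t - Y t * deriv X t"
    have s: "s \<noteq> 0" "(X t)\<^sup>2 + (Y t)\<^sup>2 = s"
      using snz[OF ZN[OF t(1)]] id1[OF t(1)] by (simp_all add: s_def algebra_simps)
    have q: "of_real b = of_real A * t * q + of_real B * s"
      using id3[OF t(1)] by (simp add: q_def s_def)
    have "of_real b / (s * w (Z t)) * deriv Z t = of_real b / (s * (of_real A * t))"
      using vel[OF t(1), symmetric] wnz[OF ZN[OF t(1)]] s t(2) A by (simp add: field_simps)
    also have "\<dots> = of_real (B / A) / t + q / s"
      unfolding q using s(1) t(2) A by (simp add: field_simps)
    finally show "of_real b / ((1 - (Z t)\<^sup>2) * w (Z t)) * deriv Z t = F t"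
      by (simp add: F_def s(2) q_def s_def[symmetric])
  qed
  from arg_cong[OF this, of "\<lambda>x. x / 2"]
  have "contour_integral (circlepath 1 \<rho>) (\<lambda>\<zeta>. of_real b / ((1 - \<zeta>\<^sup>2) * w \<zeta>)) = of_real pi * \<i> * of_real (B / A)" by simp
  moreover have "(of_real b + of_real b) / ((1 - \<zeta>\<^sup>2) * (w \<zeta> + w \<zeta>)) = of_real b / ((1 - \<zeta>\<^sup>2) * w \<zeta>)" for \<zeta>
    by (simp only: mult_2[symmetric] mult.left_commute[of _ 2] mult_divide_mult_cancel_left[OF numeral_neq_zero])
  ultimately show "cycle_slope_j \<rho> (h, b) (h, b) = of_real (B / A)"
    unfolding cycle_slope_j_def case_prod_conv w_def[symmetric] by simp
qed

lemma compact_norm_lower_bound: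
  fixes f :: "'a::topological_space \<Rightarrow> 'b::real_normed_vector"
  assumes "compact S" "continuous_on S f" "\<And>x. x \<in> S \<Longrightarrow> f x \<noteq> 0"
  obtains m where "m > 0" "\<And>x. x \<in> S \<Longrightarrow> m \<le> norm (f x)"
proof (cases "S = {}")
  case True
  then show ?thesis using that[of 1] by simp
next
  case False
  have "continuous_on S (\<lambda>x. norm (f x))" by (intro continuous_intros assms)
  from continuous_attains_inf[OF assms(1) False this] obtain x where "x \<in> S" "\<forall>y\<in>S. norm (f x) \<le> norm (f y)" by blast
  then show ?thesis using that[of "norm (f x)"] assms(3) by auto
qed

context birkhoff_coordinates
begin

lemma orbit_point_zero_in_U:
  obtains e where "e > 0" "\<And>t. \<bar>t\<bar> < e \<Longrightarrow> orbit_point 0 0 t \<in> U"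
proof -
  obtain e where e: "e > 0" "ball 0 e \<subseteq> U" using open_U zero_in_U open_contains_ball by blast
  show ?thesis
  proof (rule that[OF e(1)])
    fix t :: real assume t: "\<bar>t\<bar> < e"
    have v0: "vector [0, 0] = (0 :: real^2)" by (simp add: vec_eq_iff forall_2)
    have "norm (orbit_point 0 0 t) = norm (vector [t, 0] :: real^2)"
      by (simp add: orbit_point_def v0 norm_Pair)
    also have "\<dots> \<le> \<bar>t\<bar>"
      using norm_le_l1_cart[of "vector [t, 0] :: real^2"] by (simp add: sum_2)
    finally have "orbit_point 0 0 t \<in> ball 0 e" using t by simp
    with e(2) show "orbit_point 0 0 t \<in> U" by blast
  qed
qed

lemma pos_real_analytic: "real_analytic_on (pos i) U"
proof -
  have "bounded_linear (\<lambda>w :: (real^3) \<times> (real^3). fst w $ i)"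
    by (rule bounded_linear_compose[OF bounded_linear_vec_nth bounded_linear_fst])
  moreover have "real_analytic_on \<Phi> U" using sc by (simp add: symplectic_coordinates_def)
  ultimately show ?thesis unfolding pos_def[abs_def] by (rule real_analytic_on_bounded_linear)
qed

lemma pos_0: "pos 1 0 = 0" "pos 2 0 = 0" "pos 3 0 = 1"
  by (simp_all add: pos_def Phi_0 unstable_equilibrium_def)

text \<open>
  Everything that is known about the case \<open>a = b = 0\<close>, on one disc.  As \<open>x\<close> and \<open>y\<close> vanish at the equilibrium and
  \<open>(x + \<i> y) (x - \<i> y) = 1 - z\<^sup>2\<close> has a double zero, both factors have simple zeros.
\<close>

lemma separatrix_data:
  assumes "\<epsilon> > 0"
  obtains \<rho>0 F e k k1 k2 where "0 < e" "e < \<rho>0"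
    "\<And>i::3. complexifies \<rho>0 (F i) (pos i)"
    "k holomorphic_on ball 0 e" "k1 holomorphic_on ball 0 e" "k2 holomorphic_on ball 0 e"
    "\<And>t. t \<in> ball 0 e \<Longrightarrow> k t \<noteq> 0 \<and> k1 t \<noteq> 0 \<and> k2 t \<noteq> 0"
    "\<And>t. t \<in> ball 0 e \<Longrightarrow> F 3 (t, 0, 0) - 1 = t ^ 2 * k t"
    "\<And>t. t \<in> ball 0 e \<Longrightarrow> F 1 (t, 0, 0) + \<i> * F 2 (t, 0, 0) = t ^ 1 * k1 t"
    "\<And>t. t \<in> ball 0 e \<Longrightarrow> F 1 (t, 0, 0) - \<i> * F 2 (t, 0, 0) = t ^ 1 * k2 t"
    "\<And>t. t \<in> ball 0 e \<Longrightarrow> norm (F 3 (t, 0, 0) - 1) < \<epsilon>"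
    "\<And>t. \<bar>t\<bar> < e \<Longrightarrow> orbit_point 0 0 t \<in> U"
    "\<And>t. t \<noteq> 0 \<Longrightarrow> \<bar>t\<bar> < e \<Longrightarrow> of_real (pos 3 (orbit_point 0 0 t)) = F 3 (of_real t, 0, 0)"
    "\<And>t. t \<noteq> 0 \<Longrightarrow> \<bar>t\<bar> < e \<Longrightarrow> of_real (mom 3 (orbit_point 0 0 t)) = cycle_root 0 0 (F 3 (of_real t, 0, 0))"
proof -
  have ex: "\<exists>\<rho> F. \<rho> > 0 \<and> complexifies \<rho> F (pos i)" for i
    using real_analytic_complexification[OF pos_real_analytic zero_in_U] by blast
  then obtain \<rho>s F where F: "\<And>i::3. \<rho>s i > 0" "\<And>i. complexifies (\<rho>s i) (F i) (pos i)" by metis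
  define \<rho>0 where "\<rho>0 = Min (range \<rho>s)"
  have \<rho>0: "\<rho>0 > 0" unfolding \<rho>0_def using F(1) by (subst Min_gr_iff) auto
  have Fi: "complexifies \<rho>0 (F i) (pos i)" for i
    by (rule complexifies_mono[OF F(2)]) (simp add: \<rho>0_def)
  obtain eU where eU: "eU > 0" "\<And>t. \<bar>t\<bar> < eU \<Longrightarrow> orbit_point 0 0 t \<in> U"
    by (rule orbit_point_zero_in_U) (rule that; assumption)
  define f where "f = (\<lambda>i t. F i (t, 0, 0))"
  have f_alt: "(\<lambda>t. F i (t, complex_of_real 0 / t, complex_of_real 0 / t)) = f i" for i
    by (simp add: f_def)
  have S: "open (ball (0::complex) \<rho>0)" "connected (ball (0::complex) \<rho>0)"
      "(\<lambda>t. complex_of_real 0 / t) holomorphic_on ball 0 \<rho>0" "(\<lambda>t. complex_of_real 0 / t) holomorphic_on ball 0 \<rho>0"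
      "\<And>t. t \<in> ball 0 \<rho>0 \<Longrightarrow> norm t + norm (complex_of_real 0 / t) + norm (complex_of_real 0 / t) \<le> \<rho>0"
    by (simp_all add: connected_ball)
  have ids: "f i holomorphic_on ball 0 \<rho>0" "(f 1 t)\<^sup>2 + (f 2 t)\<^sup>2 + (f 3 t)\<^sup>2 = 1"
      "(t * deriv (f 3) t)\<^sup>2 = pendulum_P 0 0 (f 3 t)"
      "of_real t0 * deriv (f 3) (of_real t0) = of_real (mom 3 (orbit_point 0 0 t0))"
      "f i (of_real t0) = of_real (pos i (orbit_point 0 0 t0))"
    if "t0 \<noteq> 0" "\<bar>t0\<bar> < \<rho>0" "\<bar>t0\<bar> < eU" "t \<in> ball 0 \<rho>0" for t0 t i
  proof -
    have "complex_of_real t0 \<in> ball 0 \<rho>0" using that(2) by simp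
    note c = complex_orbit_identities[OF Fi Fi Fi H_has_derivative_0 S that(1) this eU(2)[OF that(3)] that(4), unfolded f_alt]
    show "f i holomorphic_on ball 0 \<rho>0" by (rule c(1))
    show "(f 1 t)\<^sup>2 + (f 2 t)\<^sup>2 + (f 3 t)\<^sup>2 = 1"
        "(t * deriv (f 3) t)\<^sup>2 = pendulum_P 0 0 (f 3 t)"
        "of_real t0 * deriv (f 3) (of_real t0) = of_real (mom 3 (orbit_point 0 0 t0))"
        "f i (of_real t0) = of_real (pos i (orbit_point 0 0 t0))"
      using c(2,3,5) c(6)[where i=i] fun_cong[OF f_alt] by (simp_all add: H_0 f_def)
  qed
  define t0 where "t0 = min \<rho>0 eU / 2"
  have t0: "t0 \<noteq> 0" "\<bar>t0\<bar> < \<rho>0" "\<bar>t0\<bar> < eU" "of_real t0 \<in> ball (0::complex) \<rho>0" using \<rho>0 eU by (auto simp: t0_def)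
  have z0: "(0::complex) \<in> ball 0 \<rho>0" using \<rho>0 by simp
  have at0: "f i 0 = of_real (pos i 0)" for i
  proof -
    have v0: "vector [0, 0] = (0 :: real^2)" by (simp add: vec_eq_iff forall_2)
    have "\<forall>t a b. \<bar>t\<bar> + \<bar>a\<bar> + \<bar>b\<bar> \<le> \<rho>0 \<longrightarrow>
        F i (of_real t, of_real a, of_real b) = of_real (pos i (vector [t, 0], vector [a, b]))"
      using Fi[of i] unfolding complexifies_def by (elim conjE)
    from this[rule_format, of 0 0 0] show ?thesis using \<rho>0 by (simp add: f_def v0 zero_prod_def)
  qed
  have hol: "f i holomorphic_on ball 0 \<rho>0" for i by (rule ids(1)[OF t0])
  have "\<not> f 3 constant_on ball 0 \<rho>0"
  proof
    assume "f 3 constant_on ball 0 \<rho>0"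
    then have "f 3 (of_real t0) = f 3 0" using t0(4) z0 unfolding constant_on_def by metis
    then have "pos 3 (orbit_point 0 0 t0) = 1"
      unfolding ids(5)[OF t0] at0 pos_0 by simp
    with unstable_manifold_not_equilibrium[OF t0(1) eU(2)[OF t0(3)]] show False by simp
  qed
  moreover have "(t * deriv (f 3) t)\<^sup>2 = 2 * (1 - (f 3 t)\<^sup>2) * (1 - f 3 t)" if "t \<in> ball 0 \<rho>0" for t
    using ids(3)[OF t0(1-3) that] by (simp add: pendulum_P_def)
  ultimately obtain k e1 where k: "0 < e1" "e1 \<le> \<rho>0" "k holomorphic_on ball 0 e1"
    "\<And>t. t \<in> ball 0 e1 \<Longrightarrow> k t \<noteq> 0" "\<And>t. t \<in> ball 0 e1 \<Longrightarrow> f 3 t - 1 = t\<^sup>2 * k t"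
    "\<And>t. t \<in> ball 0 e1 \<Longrightarrow> t * deriv (f 3) t = (f 3 t - 1) * csqrt (2 * (f 3 t + 1))"
    using separatrix_double_zero[OF hol \<rho>0, of 3] at0[of 3] pos_0(3) by (metis of_real_1)
  have b1: "ball 0 e1 \<subseteq> ball (0::complex) \<rho>0" using k(2) by auto
  have h1: "f i holomorphic_on ball 0 e1" for i by (rule holomorphic_on_subset[OF hol b1])
  define \<kappa> where "\<kappa> = (\<lambda>t. - k t * (f 3 t + 1))"
  have \<kappa>: "\<kappa> holomorphic_on ball 0 e1" "\<kappa> 0 \<noteq> 0"
    unfolding \<kappa>_def by (intro holomorphic_intros k h1) (use at0[of 3] pos_0(3) k(1,4) in simp)
  define u v where "u = (\<lambda>t. f 1 t + \<i> * f 2 t)" and "v = (\<lambda>t. f 1 t - \<i> * f 2 t)"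
  have uvh: "u holomorphic_on ball 0 e1" "v holomorphic_on ball 0 e1"
    unfolding u_def v_def by (intro holomorphic_intros h1)+
  have uv0: "u 0 = 0" "v 0 = 0" by (simp_all add: u_def v_def at0 pos_0)
  have uv: "u t * v t = t\<^sup>2 * \<kappa> t" "v t * u t = t\<^sup>2 * \<kappa> t" if t: "t \<in> ball 0 e1" for t
  proof -
    have "u t * v t = (f 1 t)\<^sup>2 + (f 2 t)\<^sup>2" by (simp add: u_def v_def algebra_simps power2_eq_square)
    also have "\<dots> = 1 - (f 3 t)\<^sup>2" using ids(2)[OF t0(1-3) subsetD[OF b1 t]] by (simp add: algebra_simps)
    also have "\<dots> = - ((f 3 t - 1) * (f 3 t + 1))" by (simp add: algebra_simps power2_eq_square)
    also have "\<dots> = t\<^sup>2 * \<kappa> t" unfolding k(5)[OF t] by (simp add: \<kappa>_def)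
    finally show "u t * v t = t\<^sup>2 * \<kappa> t" "v t * u t = t\<^sup>2 * \<kappa> t" by (simp_all add: mult.commute)
  qed
  obtain k1 e2 where k1: "0 < e2" "e2 \<le> e1" "k1 holomorphic_on ball 0 e2" "\<And>t. t \<in> ball 0 e2 \<Longrightarrow> k1 t \<noteq> 0"
    "\<And>t. t \<in> ball 0 e2 \<Longrightarrow> u t = t * k1 t"
    by (rule simple_zeros_of_product[OF uvh(1) uv0(1) uvh(2) uv0(2) k(1) \<kappa>])
       (rule uv(1), assumption, (rule that; assumption))
  obtain k2 e3 where k2: "0 < e3" "e3 \<le> e1" "k2 holomorphic_on ball 0 e3" "\<And>t. t \<in> ball 0 e3 \<Longrightarrow> k2 t \<noteq> 0"
    "\<And>t. t \<in> ball 0 e3 \<Longrightarrow> v t = t * k2 t"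
    by (rule simple_zeros_of_product[OF uvh(2) uv0(2) uvh(1) uv0(1) k(1) \<kappa>])
       (rule uv(2), assumption, (rule that; assumption))
  have "isCont (f 3) 0"
    using hol[of 3] \<rho>0 by (auto intro: holomorphic_on_imp_continuous_on continuous_on_interior simp: interior_open)
  then have "\<forall>\<^sub>F t in nhds 0. dist (f 3 t) (f 3 0) < \<epsilon>"
    using isCont_imp_tendsto_nhds tendstoD assms by blast
  then obtain e4 where e4: "e4 > 0" "\<And>t. dist t 0 < e4 \<Longrightarrow> dist (f 3 t) (f 3 0) < \<epsilon>"
    unfolding eventually_nhds_metric by blast
  define e where "e = min (min e2 e3) (min e4 (min eU (\<rho>0 / 2)))"
  have e: "0 < e" "e < \<rho>0" "e \<le> e2" "e \<le> e3" "e \<le> e4" "e \<le> eU" "e \<le> e1"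
    using k k1 k2 e4 eU \<rho>0 by (auto simp: e_def)
  show ?thesis
  proof (rule that[of e \<rho>0 F k k1 k2])
    fix t :: complex assume "t \<in> ball 0 e"
    then have t: "t \<in> ball 0 e1" "t \<in> ball 0 e2" "t \<in> ball 0 e3" "dist t 0 < e4" using e by auto
    show "k t \<noteq> 0 \<and> k1 t \<noteq> 0 \<and> k2 t \<noteq> 0" using k(4)[OF t(1)] k1(4)[OF t(2)] k2(4)[OF t(3)] by simp
    show "F 3 (t, 0, 0) - 1 = t ^ 2 * k t" using k(5)[OF t(1)] by (simp add: f_def)
    show "F 1 (t, 0, 0) + \<i> * F 2 (t, 0, 0) = t ^ 1 * k1 t" using k1(5)[OF t(2)] by (simp add: f_def u_def)
    show "F 1 (t, 0, 0) - \<i> * F 2 (t, 0, 0) = t ^ 1 * k2 t" using k2(5)[OF t(3)] by (simp add: f_def v_def)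
    show "norm (F 3 (t, 0, 0) - 1) < \<epsilon>" using e4(2)[OF t(4)] at0[of 3] pos_0(3) by (simp add: f_def dist_norm)
  next
    fix t :: real assume t: "t \<noteq> 0" "\<bar>t\<bar> < e"
    then have tt: "t \<noteq> 0" "\<bar>t\<bar> < \<rho>0" "\<bar>t\<bar> < eU" "complex_of_real t \<in> ball 0 \<rho>0" "complex_of_real t \<in> ball 0 e1"
      using e by auto
    show "of_real (pos 3 (orbit_point 0 0 t)) = F 3 (of_real t, 0, 0)"
      using ids(5)[OF tt(1-4), of 3] by (simp add: f_def)
    show "of_real (mom 3 (orbit_point 0 0 t)) = cycle_root 0 0 (F 3 (of_real t, 0, 0))"
      using ids(4)[OF tt(1-4)] k(6)[OF tt(5)] by (simp add: f_def cycle_root_0)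
  qed (use e Fi eU(2) in \<open>auto intro: holomorphic_on_subset[OF k(3)] holomorphic_on_subset[OF k1(3)] holomorphic_on_subset[OF k2(3)]\<close>)
qed

end

section \<open>The normal form inverts the elliptic integral\<close>

context birkhoff_coordinates
begin

text \<open>
  With the slopes \<open>1/A\<close> and \<open>B/A\<close>, the chain rule gives \<open>(A \<alpha> + B \<beta>) / A - \<beta> B / A = \<alpha>\<close>.  The hypotheses
  \<open>close0\<close> to \<open>close2\<close> compare the orbit with the separatrix and thereby fix the winding numbers.
\<close>

lemma cycle_integral_normal_form_derivative:
  assumes r: "0 < r'" "r' < \<rho>" "\<rho> < R'" "R' < 2" "d1 > 0"
    and small: "\<And>h j \<zeta>. \<bar>h\<bar> \<le> d1 \<Longrightarrow> \<bar>j\<bar> \<le> d1 \<Longrightarrow> r' \<le> norm (\<zeta> - 1) \<Longrightarrow> norm (\<zeta> - 1) \<le> R' \<Longrightarrow>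
      norm (cycle_perturbation h j \<zeta>) \<le> 1/2"
    and F: "\<And>i::3. complexifies \<rho>0 (F i) (pos i)"
    and k: "k holomorphic_on ball 0 e" "k1 holomorphic_on ball 0 e" "k2 holomorphic_on ball 0 e"
      "\<And>t. t \<in> ball 0 e \<Longrightarrow> k t \<noteq> 0 \<and> k1 t \<noteq> 0 \<and> k2 t \<noteq> 0"
    and T: "open T" "connected T" "sphere 0 R \<subseteq> T" "T \<subseteq> ball 0 e - {0}" and R: "R > 0"
    and dom: "\<And>t. t \<in> T \<Longrightarrow> norm t + norm (of_real a / t) + norm (of_real b / t) \<le> \<rho>0"
    and close0: "\<And>t. t \<in> T \<Longrightarrow> norm (F 3 (t, of_real a / t, of_real b / t) - 1 - t ^ 2 * k t) < norm (t ^ 2 * k t)"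
    and close1: "\<And>t. t \<in> T \<Longrightarrow> norm (F 1 (t, of_real a / t, of_real b / t) + \<i> * F 2 (t, of_real a / t, of_real b / t) - t ^ 1 * k1 t) < norm (t ^ 1 * k1 t)"
    and close2: "\<And>t. t \<in> T \<Longrightarrow> norm (F 1 (t, of_real a / t, of_real b / t) - \<i> * F 2 (t, of_real a / t, of_real b / t) - t ^ 1 * k2 t) < norm (t ^ 1 * k2 t)"
    and ann: "\<And>t. t \<in> T \<Longrightarrow> r' < norm (F 3 (t, of_real a / t, of_real b / t) - 1) \<and> norm (F 3 (t, of_real a / t, of_real b / t) - 1) < R'"
    and orb: "orbit_point a b R \<in> U" and hb: "\<bar>\<H> a b\<bar> < d1" "\<bar>b\<bar> < d1"
    and sign: "of_real (mom 3 (orbit_point a b R)) + cycle_root (\<H> a b) b (of_real (pos 3 (orbit_point a b R))) \<noteq> 0"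
  shows "((\<lambda>(a, b). cycle_integral \<rho> (\<H> a b) b) has_derivative (\<lambda>(\<alpha>, \<beta>). of_real \<alpha>)) (at (a, b))"
proof -
  obtain A B where dH: "((\<lambda>(a, b). \<H> a b) has_derivative (\<lambda>(\<alpha>, \<beta>). A * \<alpha> + B * \<beta>)) (at (a, b))"
    using H_differentiable[OF _ orb] R by (metis less_irrefl)
  define X where "X = (\<lambda>i t. F i (t, of_real a / t, of_real b / t))"
  have RT: "of_real R \<in> T" using T(3) R by (auto simp: subset_iff)
  have S: "(\<lambda>t. of_real a / t) holomorphic_on T" "(\<lambda>t. of_real b / t) holomorphic_on T"
    using T(4) by (intro holomorphic_intros; auto)+
  have R0: "R \<noteq> 0" using R by simp
  note ids = complex_orbit_identities[OF F F F dH T(1,2) S _ R0 RT orb]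
  have hol: "X i holomorphic_on T" for i
    unfolding X_def by (rule ids(1)[OF _ RT]) (rule dom)
  have hol': "(\<lambda>t. X 3 t - 1) holomorphic_on T" "(\<lambda>t. X 1 t + \<i> * X 2 t) holomorphic_on T"
      "(\<lambda>t. X 1 t - \<i> * X 2 t) holomorphic_on T"
    by (intro holomorphic_intros hol)+
  have knz: "k t \<noteq> 0" "k1 t \<noteq> 0" "k2 t \<noteq> 0" if "t \<in> ball 0 e" for t using k(4)[OF that] by auto
  obtain l0 where l0: "l0 holomorphic_on T" "\<And>t. t \<in> T \<Longrightarrow> X 3 t - 1 = t ^ 2 * exp (l0 t)"
    by (rule holomorphic_log_near[OF k(1) knz(1) T(4) hol'(1), where m=2])
       (assumption, unfold X_def, rule close0, assumption, rule that, auto simp: X_def)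
  obtain l1 where l1: "l1 holomorphic_on T" "\<And>t. t \<in> T \<Longrightarrow> X 1 t + \<i> * X 2 t = t ^ 1 * exp (l1 t)"
    by (rule holomorphic_log_near[OF k(2) knz(2) T(4) hol'(2), where m=1])
       (assumption, unfold X_def, rule close1, assumption, rule that, auto simp: X_def)
  obtain l2 where l2: "l2 holomorphic_on T" "\<And>t. t \<in> T \<Longrightarrow> X 1 t - \<i> * X 2 t = t ^ 1 * exp (l2 t)"
    by (rule holomorphic_log_near[OF k(3) knz(3) T(4) hol'(3), where m=1])
       (assumption, unfold X_def, rule close2, assumption, rule that, auto simp: X_def)
  have slopes: "A \<noteq> 0" "cycle_slope_h \<rho> (\<H> a b, b) (\<H> a b, b) = of_real (1 / A)"
      "cycle_slope_j \<rho> (\<H> a b, b) (\<H> a b, b) = of_real (B / A)"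
  proof -
    have pert: "norm (cycle_perturbation (\<H> a b) b \<zeta>) \<le> 1/2" if "r' < norm (\<zeta> - 1)" "norm (\<zeta> - 1) < R'" for \<zeta>
      using small[of "\<H> a b" b \<zeta>] hb that by simp
    have T0: "0 \<notin> T" using T(4) by blast
    have id1: "(X 1 t)\<^sup>2 + (X 2 t)\<^sup>2 + (X 3 t)\<^sup>2 = 1"
      and id2: "(of_real A * t * deriv (X 3) t)\<^sup>2 = pendulum_P (\<H> a b) b (X 3 t)"
      and id3: "of_real A * t * (X 1 t * deriv (X 2) t - X 2 t * deriv (X 1) t) = of_real b - of_real B * (1 - (X 3 t)\<^sup>2)"
      if t: "t \<in> T" for t
      unfolding X_def by (rule ids(2)[OF _ t] ids(3)[OF _ t] ids(4)[OF _ t], rule dom, assumption)+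
    have sgn: "of_real A * of_real R * deriv (X 3) (of_real R) + cycle_root (\<H> a b) b (X 3 (of_real R)) \<noteq> 0"
    proof -
      have "of_real A * of_real R * deriv (X 3) (of_real R) = of_real (mom 3 (orbit_point a b R))"
          "X 3 (of_real R) = of_real (pos 3 (orbit_point a b R))"
        unfolding X_def by (rule ids(5)[OF _ RT] ids(6)[OF _ RT], rule dom, assumption)+
      then show ?thesis using sign by simp
    qed
    have annX: "r' < norm (X 3 t - 1) \<and> norm (X 3 t - 1) < R'" if "t \<in> T" for t
      unfolding X_def by (rule ann[OF that])
    show "A \<noteq> 0" "cycle_slope_h \<rho> (\<H> a b, b) (\<H> a b, b) = of_real (1 / A)"
        "cycle_slope_j \<rho> (\<H> a b, b) (\<H> a b, b) = of_real (B / A)"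
      by (rule orbit_loop_slopes[OF r(1-4) pert R T(1-3) T0 hol hol hol id1 id2 id3 l0 l1 l2 annX sgn]; assumption)+
  qed
  have csmall: "cycle_small \<rho> d1"
    unfolding cycle_small_def using small r by auto
  have "((\<lambda>(h, j). cycle_integral \<rho> h j) has_derivative
      (\<lambda>(\<alpha>, \<beta>). of_real \<alpha> * of_real (1 / A) - of_real \<beta> * of_real (B / A))) (at (\<H> a b, b))"
    using cycle_integral_has_derivative[OF _ _ r(5) csmall hb] r unfolding slopes by simp
  moreover have "((\<lambda>p. (\<H> (fst p) (snd p), snd p)) has_derivative (\<lambda>p. (A * fst p + B * snd p, snd p))) (at (a, b))"
    using dH by (intro has_derivative_Pair has_derivative_snd has_derivative_ident) (simp add: case_prod_unfold)
  ultimately have "((\<lambda>p. (\<lambda>(h, j). cycle_integral \<rho> h j) (\<H> (fst p) (snd p), snd p)) has_derivative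
      (\<lambda>p. (\<lambda>(\<alpha>, \<beta>). of_real \<alpha> * of_real (1 / A) - of_real \<beta> * of_real (B / A)) (A * fst p + B * snd p, snd p))) (at (a, b))"
    by (intro has_derivative_compose[where f="\<lambda>p. (\<H> (fst p) (snd p), snd p)" and g="\<lambda>(h, j). cycle_integral \<rho> h j"]) simp_all
  moreover have "complex_of_real (A * \<alpha> + B * \<beta>) * of_real (1 / A) - of_real \<beta> * of_real (B / A) = of_real \<alpha>" for \<alpha> \<beta>
    using slopes(1) by (simp add: field_simps)
  ultimately show ?thesis by (simp add: case_prod_unfold)
qed

lemma cycle_integral_0: "0 < \<rho> \<Longrightarrow> \<rho> < 2 \<Longrightarrow> cycle_integral \<rho> 0 0 = 0"
proof -
  assume \<rho>: "0 < \<rho>" "\<rho> < 2"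
  obtain C d where "C > 0" "d > 0" "\<And>h j. \<bar>h\<bar> \<le> d \<Longrightarrow> \<bar>j\<bar> \<le> d \<Longrightarrow>
      norm (cycle_integral \<rho> h j - of_real (cycle_taylor h j)) \<le> C * (\<bar>h\<bar> + j\<^sup>2) ^ 6"
    by (rule cycle_integral_taylor[OF \<rho>]) (rule that; assumption)
  from this(3)[of 0 0] this(2) show ?thesis by (simp add: cycle_taylor_explicit)
qed

text \<open>
  The radius \<open>R\<close> is fixed; the actions are then taken so small that on an annulus around \<open>|t| = R\<close> the orbit is close
  to the separatrix.  There the derivative of \<open>K(\<H>(a, b), b) - a\<close> vanishes.
\<close>

lemma cycle_integral_normal_form:
  assumes \<rho>: "0 < \<rho>" "\<rho> < 2"
  obtains d where "d > 0"
    "\<And>a b. \<bar>a\<bar> < d \<Longrightarrow> \<bar>b\<bar> < d \<Longrightarrow> cycle_integral \<rho> (\<H> a b) b = of_real a"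
proof -
  obtain \<rho>0 F e k k1 k2 where e: "0 < e" "e < \<rho>0"
    and F: "\<And>i::3. complexifies \<rho>0 (F i) (pos i)"
    and k: "k holomorphic_on ball 0 e" "k1 holomorphic_on ball 0 e" "k2 holomorphic_on ball 0 e"
      "\<And>t. t \<in> ball 0 e \<Longrightarrow> k t \<noteq> 0 \<and> k1 t \<noteq> 0 \<and> k2 t \<noteq> 0"
    and sep: "\<And>t. t \<in> ball 0 e \<Longrightarrow> F 3 (t, 0, 0) - 1 = t ^ 2 * k t"
      "\<And>t. t \<in> ball 0 e \<Longrightarrow> F 1 (t, 0, 0) + \<i> * F 2 (t, 0, 0) = t ^ 1 * k1 t"
      "\<And>t. t \<in> ball 0 e \<Longrightarrow> F 1 (t, 0, 0) - \<i> * F 2 (t, 0, 0) = t ^ 1 * k2 t"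
      "\<And>t. t \<in> ball 0 e \<Longrightarrow> norm (F 3 (t, 0, 0) - 1) < \<rho> / 2"
    and orb: "\<And>t. \<bar>t\<bar> < e \<Longrightarrow> orbit_point 0 0 t \<in> U"
    and real: "\<And>t. t \<noteq> 0 \<Longrightarrow> \<bar>t\<bar> < e \<Longrightarrow> of_real (pos 3 (orbit_point 0 0 t)) = F 3 (of_real t, 0, 0)"
      "\<And>t. t \<noteq> 0 \<Longrightarrow> \<bar>t\<bar> < e \<Longrightarrow> of_real (mom 3 (orbit_point 0 0 t)) = cycle_root 0 0 (F 3 (of_real t, 0, 0))"
    by (rule separatrix_data[of "\<rho> / 2"]) (use \<rho> in simp, (rule that; assumption))
  define R where "R = e / 2"
  have R: "R > 0" "R < e" "3/2 * R < e" "3/2 * R < \<rho>0" using e by (auto simp: R_def)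
  define N where "N = {t::complex. R / 2 \<le> norm (t - 0) \<and> norm (t - 0) \<le> 3/2 * R}"
  have N: "N \<subseteq> ball 0 e - {0}" using R by (auto simp: N_def)
  have "N = cball 0 (3/2 * R) - ball 0 (R / 2)" by (auto simp: N_def)
  then have "compact N" by (simp add: compact_diff)
  have Nb: "N \<subseteq> ball 0 e" using N by blast
  have kc: "continuous_on N k" "continuous_on N k1" "continuous_on N k2"
    using k(1-3) holomorphic_on_imp_continuous_on continuous_on_subset Nb by blast+
  obtain m0 where m0: "m0 > 0" "\<And>t. t \<in> N \<Longrightarrow> m0 \<le> norm (t ^ 2 * k t)"
    by (rule compact_norm_lower_bound[OF \<open>compact N\<close>, of "\<lambda>t. t ^ 2 * k t"])
       (intro continuous_intros kc, use N k(4) in auto)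
  obtain m1 where m1: "m1 > 0" "\<And>t. t \<in> N \<Longrightarrow> m1 \<le> norm (t ^ 1 * k1 t)"
    by (rule compact_norm_lower_bound[OF \<open>compact N\<close>, of "\<lambda>t. t ^ 1 * k1 t"])
       (intro continuous_intros kc, use N k(4) in auto)
  obtain m2 where m2: "m2 > 0" "\<And>t. t \<in> N \<Longrightarrow> m2 \<le> norm (t ^ 1 * k2 t)"
    by (rule compact_norm_lower_bound[OF \<open>compact N\<close>, of "\<lambda>t. t ^ 1 * k2 t"])
       (intro continuous_intros kc, use N k(4) in auto)
  \<comment> \<open>Closeness \<open>m / 2\<close> keeps the loop outside the circle of radius \<open>m / 2\<close> around 1 and preserves all three winding numbers.\<close>
  define m where "m = min \<rho> (min m0 (min m1 m2))"
  have m: "m > 0" "m \<le> \<rho>" "m \<le> m0" "m \<le> m1" "m \<le> m2" using m0 m1 m2 \<rho> by (auto simp: m_def)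
  \<comment> \<open>An annulus around 1 that contains the loop and the circle of radius \<open>\<rho>\<close>, but not \<open>\<zeta> = -1\<close>.\<close>
  define r' R' where "r' = m / 2" and "R' = (\<rho> + 2) / 2"
  have r: "0 < r'" "r' < \<rho>" "\<rho> < R'" "R' < 2" "r' \<le> R'" using m \<rho> by (auto simp: r'_def R'_def)
  obtain d1 where d1: "d1 > 0" and small: "\<And>h j \<zeta>. \<bar>h\<bar> \<le> d1 \<Longrightarrow> \<bar>j\<bar> \<le> d1 \<Longrightarrow> r' \<le> norm (\<zeta> - 1) \<Longrightarrow> norm (\<zeta> - 1) \<le> R' \<Longrightarrow>
      norm (cycle_perturbation h j \<zeta>) \<le> 1/2"
    by (rule cycle_perturbation_small[OF r(1) r(5) r(4), of "1/2"]) (simp, (rule that; assumption))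
  have Fc: "continuous_on {(t, \<alpha>, \<beta>). norm t + norm \<alpha> + norm \<beta> \<le> \<rho>0} (F i)" for i
    using F[of i] unfolding complexifies_def by blast
  have "\<exists>d>0. \<forall>a b t. \<bar>a\<bar> < d \<longrightarrow> \<bar>b\<bar> < d \<longrightarrow> R / 2 \<le> norm t \<longrightarrow> norm t \<le> 3/2 * R \<longrightarrow>
      norm t + norm (of_real a / t) + norm (of_real b / t) \<le> \<rho>0 \<and>
      norm (F i (t, of_real a / t, of_real b / t) - F i (t, 0, 0)) < m / 2" for i
    by (rule uniform_near_unstable_manifold[OF Fc, of "R / 2" "3/2 * R" "m / 2"]) (use R m in auto)
  then obtain ds where ds: "\<And>i. ds i > 0"
    "\<And>i a b t. \<bar>a\<bar> < ds i \<Longrightarrow> \<bar>b\<bar> < ds i \<Longrightarrow> R / 2 \<le> norm t \<Longrightarrow> norm t \<le> 3/2 * R \<Longrightarrow>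
      norm t + norm (of_real a / t) + norm (of_real b / t) \<le> \<rho>0 \<and>
      norm (F i (t, of_real a / t, of_real b / t) - F i (t, 0, 0)) < m / 2" by metis
  define x0 where "x0 = orbit_point 0 0 R"
  have x0: "x0 \<in> U" using orb R by (simp add: x0_def)
  let ?s = "\<lambda>p. orbit_point (fst p) (snd p) R"
  have cs: "isCont ?s (0, 0)"
    using has_derivative_continuous[OF orbit_section_has_derivative[of R "(0, 0)"]] by (simp add: case_prod_unfold)
  have "isCont \<Phi> x0" by (rule has_derivative_continuous[OF symplectic_coordinates_has_derivative[OF sc x0]])
  then have cP: "isCont (\<lambda>p. \<Phi> (?s p)) (0, 0)" by (intro isCont_o2[OF cs]) (simp add: x0_def)
  have cpos: "isCont (\<lambda>p. pos 3 (?s p)) (0, 0)" and cmom: "isCont (\<lambda>p. mom 3 (?s p)) (0, 0)"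
    unfolding pos_def mom_def by (intro continuous_intros cP)+
  have cH: "isCont (\<lambda>p. \<H> (fst p) (snd p)) (0, 0)"
    using has_derivative_continuous[OF H_has_derivative_0] by (simp add: case_prod_unfold)
  \<comment> \<open>At \<open>a = b = 0\<close> velocity and branch agree at \<open>t = R\<close>; their sum stays nonzero for small \<open>a\<close>, \<open>b\<close>, which excludes the sign \<open>-1\<close>.\<close>
  define z0 where "z0 = F 3 (of_real R, 0, 0)"
  have pos_z0: "of_real (pos 3 x0) = z0" and mom_z0: "of_real (mom 3 x0) = cycle_root 0 0 z0"
    using real[of R] R by (simp_all add: x0_def z0_def)
  have RN: "of_real R \<in> N" using R by (simp add: N_def)
  have z0: "r' < norm (z0 - 1)" "norm (z0 - 1) < R'"
  proof -
    have "norm (z0 - 1) = norm ((of_real R) ^ 2 * k (of_real R))"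
      using sep(1)[of "of_real R"] R by (simp add: z0_def)
    then have "m \<le> norm (z0 - 1)" using m0(2)[OF RN] m by simp
    then show "r' < norm (z0 - 1)" using m by (simp add: r'_def)
    show "norm (z0 - 1) < R'" using sep(4)[of "of_real R"] R r \<rho> by (simp add: z0_def)
  qed
  define Om where "Om = ({-d1<..<d1} \<times> {-d1<..<d1}) \<times> {\<zeta>. r' < norm (\<zeta> - 1) \<and> norm (\<zeta> - (1::complex)) < R'}"
  have "open {\<zeta>. r' < norm (\<zeta> - 1) \<and> norm (\<zeta> - (1::complex)) < R'}"
    by (intro open_Collect_conj open_Collect_less continuous_intros)
  then have "open Om" by (simp add: Om_def open_Times)
  have "continuous_on Om (\<lambda>((h, j), \<zeta>). cycle_root h j \<zeta>)"
    by (rule cycle_root_continuous) (use r small in \<open>auto simp: Om_def\<close>)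
  then have cR: "isCont (\<lambda>((h, j), \<zeta>). cycle_root h j \<zeta>) ((0, 0), z0)"
    using \<open>open Om\<close> z0 d1 by (simp add: continuous_on_eq_continuous_at Om_def)
  have g: "isCont (\<lambda>p. ((\<H> (fst p) (snd p), snd p), complex_of_real (pos 3 (?s p)))) (0, 0)"
    by (intro continuous_intros cH cpos)
  have "isCont (\<lambda>p. (\<lambda>((h, j), \<zeta>). cycle_root h j \<zeta>) ((\<H> (fst p) (snd p), snd p), complex_of_real (pos 3 (?s p)))) (0, 0)"
    by (rule isCont_o2[OF g]) (use cR pos_z0 in \<open>simp add: H_0 x0_def\<close>)
  then have cS: "isCont (\<lambda>p. of_real (mom 3 (?s p)) + cycle_root (\<H> (fst p) (snd p)) (snd p) (of_real (pos 3 (?s p)))) (0, 0)"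
    by (intro continuous_intros cmom) simp
  have "cycle_root 0 0 z0 \<noteq> 0"
    by (rule cycle_root_nz) (use z0 r in \<open>auto simp: cycle_perturbation_def\<close>)
  then have "of_real (mom 3 (?s (0, 0))) + cycle_root (\<H> (fst (0, 0)) (snd (0, 0))) (snd (0, 0)) (of_real (pos 3 (?s (0, 0)))) \<noteq> 0"
    using pos_z0 mom_z0 by (simp add: x0_def[symmetric] H_0)
  from tendsto_imp_eventually_ne[OF isCont_imp_tendsto_nhds[OF cS] this]
  have "\<forall>\<^sub>F p in nhds (0, 0). of_real (mom 3 (?s p)) + cycle_root (\<H> (fst p) (snd p)) (snd p) (of_real (pos 3 (?s p))) \<noteq> 0" .
  moreover have "\<forall>\<^sub>F p in nhds (0, 0). ?s p \<in> U"
    using topological_tendstoD[OF isCont_imp_tendsto_nhds[OF cs] open_U] x0 by (simp add: x0_def)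
  moreover have "\<forall>\<^sub>F p in nhds (0, 0). dist (\<H> (fst p) (snd p)) (\<H> 0 0) < d1"
    using tendstoD[OF isCont_imp_tendsto_nhds[OF cH] d1] by simp
  ultimately have "\<forall>\<^sub>F p in nhds (0, 0). of_real (mom 3 (?s p)) + cycle_root (\<H> (fst p) (snd p)) (snd p) (of_real (pos 3 (?s p))) \<noteq> 0
      \<and> ?s p \<in> U \<and> \<bar>\<H> (fst p) (snd p)\<bar> < d1"
    by eventually_elim (simp add: H_0 dist_real_def)
  then obtain \<eta> where \<eta>: "\<eta> > 0" "\<And>p. dist p (0, 0) < \<eta> \<Longrightarrow>
      of_real (mom 3 (?s p)) + cycle_root (\<H> (fst p) (snd p)) (snd p) (of_real (pos 3 (?s p))) \<noteq> 0
      \<and> ?s p \<in> U \<and> \<bar>\<H> (fst p) (snd p)\<bar> < d1"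
    unfolding eventually_nhds_metric by blast
  define d where "d = min (min (\<eta> / 2) d1) (min (ds 1) (min (ds 2) (ds 3)))"
  have d: "d > 0" "d \<le> \<eta> / 2" "d \<le> d1" "d \<le> ds 1" "d \<le> ds 2" "d \<le> ds 3"
    using \<eta>(1) d1 ds(1) by (auto simp: d_def)
  define T where "T = {t::complex. R / 2 < norm (t - 0) \<and> norm (t - 0) < 3/2 * R}"
  have TN: "T \<subseteq> N" by (auto simp: T_def N_def)
  have T: "open T" "connected T" "sphere 0 R \<subseteq> T" "T \<subseteq> ball 0 e - {0}"
  proof -
    show "open T" unfolding T_def by (intro open_Collect_conj open_Collect_less continuous_intros)
    show "connected T" unfolding T_def by (rule connected_annulus) simp
    show "sphere 0 R \<subseteq> T" using R by (auto simp: T_def)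
    show "T \<subseteq> ball 0 e - {0}" using TN N by blast
  qed
  define D where "D = {-d<..<d} \<times> {-d<..<d}"
  have deriv: "((\<lambda>(a, b). cycle_integral \<rho> (\<H> a b) b) has_derivative (\<lambda>(\<alpha>, \<beta>). of_real \<alpha>)) (at (a, b))"
    if ab: "\<bar>a\<bar> < d" "\<bar>b\<bar> < d" for a b
  proof (rule cycle_integral_normal_form_derivative[OF r(1-4) d1 small F k T R(1)])
    have "dist (a, b) (0, 0) < \<eta>" using norm_Pair_le[of a b] ab d by (simp add: dist_norm)
    note \<eta>' = \<eta>(2)[OF this]
    show "orbit_point a b R \<in> U" "\<bar>\<H> a b\<bar> < d1"
      "of_real (mom 3 (orbit_point a b R)) + cycle_root (\<H> a b) b (of_real (pos 3 (orbit_point a b R))) \<noteq> 0"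
      using \<eta>' by simp_all
    show "\<bar>b\<bar> < d1" using ab d by simp
    fix t assume t: "t \<in> T"
    then have tN: "R / 2 \<le> norm t" "norm t \<le> 3/2 * R" "t \<in> N" "t \<in> ball 0 e" using TN N by (auto simp: T_def)
    let ?X = "\<lambda>i. F i (t, of_real a / t, of_real b / t)" and ?x = "\<lambda>i. F i (t, 0, 0)"
    have c1: "norm (?X 1 - ?x 1) < m / 2" and c2: "norm (?X 2 - ?x 2) < m / 2" and c3: "norm (?X 3 - ?x 3) < m / 2"
      using ds(2)[of a 1 b t] ds(2)[of a 2 b t] ds(2)[of a 3 b t] ab d tN by auto
    show "norm t + norm (of_real a / t) + norm (of_real b / t) \<le> \<rho>0"
      using ds(2)[of a 1 b t] ab d tN by auto
    have b0: "m \<le> norm (t ^ 2 * k t)" "m \<le> norm (t ^ 1 * k1 t)" "m \<le> norm (t ^ 1 * k2 t)"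
      using m0(2)[OF tN(3)] m1(2)[OF tN(3)] m2(2)[OF tN(3)] m by linarith+
    have eq3: "?X 3 - 1 - t ^ 2 * k t = ?X 3 - ?x 3" using sep(1)[OF tN(4)] by (simp add: algebra_simps)
    have c3': "norm (?X 3 - 1 - t ^ 2 * k t) < m / 2" unfolding eq3 by (rule c3)
    show "norm (?X 3 - 1 - t ^ 2 * k t) < norm (t ^ 2 * k t)" using c3' b0 m by linarith
    have ub: "norm (x + \<i> * y) \<le> norm x + norm y" "norm (x - \<i> * y) \<le> norm x + norm y" for x y
      using norm_triangle_ineq[of x "\<i> * y"] norm_triangle_ineq4[of x "\<i> * y"] by (simp_all add: norm_mult)
    have eq1: "?X 1 + \<i> * ?X 2 - t ^ 1 * k1 t = (?X 1 - ?x 1) + \<i> * (?X 2 - ?x 2)"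
      unfolding sep(2)[OF tN(4), symmetric] by (simp add: algebra_simps)
    show "norm (?X 1 + \<i> * ?X 2 - t ^ 1 * k1 t) < norm (t ^ 1 * k1 t)"
      unfolding eq1 using ub(1)[of "?X 1 - ?x 1" "?X 2 - ?x 2"] c1 c2 b0 by linarith
    have eq2: "?X 1 - \<i> * ?X 2 - t ^ 1 * k2 t = (?X 1 - ?x 1) - \<i> * (?X 2 - ?x 2)"
      unfolding sep(3)[OF tN(4), symmetric] by (simp add: algebra_simps)
    show "norm (?X 1 - \<i> * ?X 2 - t ^ 1 * k2 t) < norm (t ^ 1 * k2 t)"
      unfolding eq2 using ub(2)[of "?X 1 - ?x 1" "?X 2 - ?x 2"] c1 c2 b0 by linarith
    have "norm (t ^ 2 * k t) - norm (?X 3 - 1) \<le> norm (?X 3 - 1 - t ^ 2 * k t)"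
      using norm_triangle_ineq2[of "t ^ 2 * k t" "?X 3 - 1"] by (simp add: norm_minus_commute)
    then have lo: "r' < norm (?X 3 - 1)" using c3' b0 by (simp add: r'_def)
    have "norm (?X 3 - 1) \<le> norm (?X 3 - ?x 3) + norm (?x 3 - 1)"
      using norm_triangle_ineq[of "?X 3 - ?x 3" "?x 3 - 1"] by simp
    then have "norm (?X 3 - 1) < R'" using c3 sep(4)[OF tN(4)] m r by linarith
    with lo show "r' < norm (?X 3 - 1) \<and> norm (?X 3 - 1) < R'" by simp
  qed
  have "\<exists>c. \<forall>p\<in>D. cycle_integral \<rho> (\<H> (fst p) (snd p)) (snd p) - of_real (fst p) = c"
  proof (rule has_derivative_zero_constant)
    show "convex D" unfolding D_def by (intro convex_Times convex_real_interval)
    fix p assume "p \<in> D"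
    then have "\<bar>fst p\<bar> < d" "\<bar>snd p\<bar> < d" by (auto simp: D_def)
    from deriv[OF this] have "((\<lambda>p. cycle_integral \<rho> (\<H> (fst p) (snd p)) (snd p)) has_derivative (\<lambda>p. of_real (fst p))) (at p)"
      by (simp add: case_prod_unfold)
    moreover have "((\<lambda>p. complex_of_real (fst p)) has_derivative (\<lambda>p. of_real (fst p))) (at p)"
      by (intro bounded_linear.has_derivative[OF bounded_linear_of_real] has_derivative_fst has_derivative_ident)
    ultimately have "((\<lambda>p. cycle_integral \<rho> (\<H> (fst p) (snd p)) (snd p) - of_real (fst p)) has_derivative
        (\<lambda>p. of_real (fst p) - of_real (fst p))) (at p)"
      by (rule has_derivative_diff)
    then show "((\<lambda>p. cycle_integral \<rho> (\<H> (fst p) (snd p)) (snd p) - of_real (fst p)) has_derivative (\<lambda>h. 0)) (at p within D)"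
      by (simp add: has_derivative_at_withinI)
  qed
  then obtain c where c: "\<And>p. p \<in> D \<Longrightarrow> cycle_integral \<rho> (\<H> (fst p) (snd p)) (snd p) - of_real (fst p) = c" by blast
  have "c = 0" using c[of "(0, 0)"] d cycle_integral_0[OF \<rho>] by (simp add: D_def H_0)
  show ?thesis
  proof (rule that[OF d(1)])
    fix a b :: real assume "\<bar>a\<bar> < d" "\<bar>b\<bar> < d"
    then have "(a, b) \<in> D" by (auto simp: D_def)
    from c[OF this] show "cycle_integral \<rho> (\<H> a b) b = of_real a" by (simp add: \<open>c = 0\<close>)
  qed
qed

end

text \<open>
  The slope is continuous and equals 1 at the origin, so the elliptic integral is bi-Lipschitz in \<open>h\<close>.
\<close>

lemma cycle_slope_h_near_1:
  assumes \<rho>: "0 < \<rho>" "\<rho> < 2" "d > 0" "cycle_small \<rho> d"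
  obtains \<delta> where "\<delta> > 0" "\<delta> \<le> d"
    "\<And>h j h' j'. \<bar>h\<bar> < \<delta> \<Longrightarrow> \<bar>j\<bar> < \<delta> \<Longrightarrow> \<bar>h'\<bar> < \<delta> \<Longrightarrow> \<bar>j'\<bar> < \<delta> \<Longrightarrow>
      1/2 \<le> norm (cycle_slope_h \<rho> (h, j) (h', j'))"
proof -
  let ?I = "{-d<..<d} \<times> {-d<..<d}"
  have sub: "?I \<subseteq> square_of d" by (auto simp: square_of_def)
  have "continuous_on (?I \<times> ?I) (\<lambda>(p, p'). cycle_slope_h \<rho> p p')"
    by (rule continuous_on_subset[OF cycle_slopes_continuous(1)[OF assms]]) (use sub in blast)
  then have "isCont (\<lambda>(p, p'). cycle_slope_h \<rho> p p') ((0, 0), (0, 0))"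
    using \<rho>(3) by (subst (asm) continuous_on_eq_continuous_at) (auto simp: open_Times)
  from tendstoD[OF isCont_imp_tendsto_nhds[OF this], of "1/2"]
  have "\<forall>\<^sub>F x in nhds ((0, 0), (0, 0)). dist (case x of (p, p') \<Rightarrow> cycle_slope_h \<rho> p p') 1 < 1/2"
    by (simp add: cycle_slope_h_0[OF assms])
  then obtain e where e: "e > 0" "\<And>x. dist x ((0, 0), (0, 0)) < e \<Longrightarrow>
      dist (case x of (p, p') \<Rightarrow> cycle_slope_h \<rho> p p') 1 < 1/2"
    unfolding eventually_nhds_metric by blast
  show ?thesis
  proof (rule that[of "min d (e / 4)"])
    fix h j h' j' :: real
    assume "\<bar>h\<bar> < min d (e / 4)" "\<bar>j\<bar> < min d (e / 4)" "\<bar>h'\<bar> < min d (e / 4)" "\<bar>j'\<bar> < min d (e / 4)"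
    then have "dist ((h, j), (h', j')) ((0, 0), (0, 0)) < e"
      using norm_Pair_le[of "(h, j)" "(h', j')"] norm_Pair_le[of h j] norm_Pair_le[of h' j'] by (simp add: dist_norm)
    from e(2)[OF this] have "norm (cycle_slope_h \<rho> (h, j) (h', j') - 1) < 1/2" by (simp add: dist_norm)
    then show "1/2 \<le> norm (cycle_slope_h \<rho> (h, j) (h', j'))"
      using norm_triangle_ineq3[of "cycle_slope_h \<rho> (h, j) (h', j')" 1] by simp
  qed (use \<rho>(3) e(1) in auto)
qed

lemma isCont_mult_bigo_norm:
  fixes q :: "real \<times> real \<Rightarrow> real"
  assumes "isCont q (0, 0)"
  shows "(\<lambda>z. q z * fst z) \<in> O[nhds (0, 0)](norm)" "(\<lambda>z. q z * snd z) \<in> O[nhds (0, 0)](norm)"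
proof -
  have "(fst :: real \<times> real \<Rightarrow> real) \<in> O[nhds (0, 0)](norm)" "(snd :: real \<times> real \<Rightarrow> real) \<in> O[nhds (0, 0)](norm)"
  proof -
    have bnd: "norm (fst z) \<le> 1 * norm (norm z)" "norm (snd z) \<le> 1 * norm (norm z)" for z :: "real \<times> real"
      using norm_fst_le[of "fst z" "snd z"] norm_snd_le[of "snd z" "fst z"] by simp_all
    show "(fst :: real \<times> real \<Rightarrow> real) \<in> O[nhds (0, 0)](norm)"
      by (rule bigoI[of _ 1], rule always_eventually, rule allI, rule bnd(1))
    show "(snd :: real \<times> real \<Rightarrow> real) \<in> O[nhds (0, 0)](norm)"
      by (rule bigoI[of _ 1], rule always_eventually, rule allI, rule bnd(2))
  qed
  from landau_o.big.mult[OF isCont_imp_bigo_1[OF assms] this(1)]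
       landau_o.big.mult[OF isCont_imp_bigo_1[OF assms] this(2)]
  show "(\<lambda>z. q z * fst z) \<in> O[nhds (0, 0)](norm)" "(\<lambda>z. q z * snd z) \<in> O[nhds (0, 0)](norm)" by simp_all
qed

lemma birkhoff_polynomial_bigo: "(\<lambda>z. \<bar>birkhoff_polynomial (fst z) (snd z)\<bar> + (snd z)\<^sup>2) \<in> O[nhds (0, 0)](norm)"
proof -
  let ?p = "\<lambda>z. 1 + 1/16 * fst z - 1/256 * ((fst z)^2 + 9 * (snd z)^2) + 1/8192 * (5 * (fst z)^3 + 102 * fst z * (snd z)^2)
    - 3/262144 * (11 * (fst z)^4 + 410 * (fst z)^2 * (snd z)^2 + 271 * (snd z)^4) :: real"
  let ?q = "\<lambda>z. 3/16 * snd z + 33/8192 * (snd z)^3 :: real"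
  have "birkhoff_polynomial (fst z) (snd z) = ?p z * fst z + ?q z * snd z" for z
    unfolding birkhoff_polynomial_def by algebra
  moreover have "(\<lambda>z. ?p z * fst z + ?q z * snd z) \<in> O[nhds (0, 0)](norm)"
    by (intro sum_in_bigo isCont_mult_bigo_norm continuous_intros)
  ultimately have "(\<lambda>z. birkhoff_polynomial (fst z) (snd z)) \<in> O[nhds (0, 0)](norm)" by simp
  moreover have "(\<lambda>z. snd z * snd z) \<in> O[nhds (0, 0)](norm :: real \<times> real \<Rightarrow> real)"
    by (intro isCont_mult_bigo_norm continuous_intros)
  ultimately show ?thesis
    by (intro sum_in_bigo) (simp_all add: power2_eq_square)
qed

lemma eventually_small_near_0:
  fixes f :: "real \<times> real \<Rightarrow> real"
  assumes "isCont f (0, 0)" "f (0, 0) = 0" "\<delta> > 0"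
  shows "\<forall>\<^sub>F z in nhds (0, 0). \<bar>f z\<bar> < \<delta>"
  using tendstoD[OF isCont_imp_tendsto_nhds[OF assms(1)] assms(3)] assms(2) by (simp add: dist_real_def)

context birkhoff_coordinates
begin

lemma H_continuous:
  obtains d where "d > 0" "\<And>a b. \<bar>a\<bar> < d \<Longrightarrow> \<bar>b\<bar> < d \<Longrightarrow> isCont (\<lambda>z. \<H> (fst z) (snd z)) (a, b)"
proof -
  obtain e where e: "e > 0" "\<And>t. \<bar>t\<bar> < e \<Longrightarrow> orbit_point 0 0 t \<in> U"
    by (rule orbit_point_zero_in_U) (rule that; assumption)
  define t where "t = e / 2"
  have t: "t \<noteq> 0" "orbit_point 0 0 t \<in> U" using e by (auto simp: t_def)
  have "isCont (\<lambda>p. orbit_point (fst p) (snd p) t) (0, 0)"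
    using has_derivative_continuous[OF orbit_section_has_derivative[of t "(0, 0)"]] by (simp add: case_prod_unfold)
  from topological_tendstoD[OF isCont_imp_tendsto_nhds[OF this] open_U] t(2)
  obtain \<eta> where \<eta>: "\<eta> > 0" "\<And>p. dist p (0, 0) < \<eta> \<Longrightarrow> orbit_point (fst p) (snd p) t \<in> U"
    unfolding eventually_nhds_metric by auto
  show ?thesis
  proof (rule that[of "\<eta> / 2"])
    fix a b :: real assume "\<bar>a\<bar> < \<eta> / 2" "\<bar>b\<bar> < \<eta> / 2"
    then have "dist (a, b) (0, 0) < \<eta>" using norm_Pair_le[of a b] by (simp add: dist_norm)
    from \<eta>(2)[OF this] have "orbit_point a b t \<in> U" by simp
    from H_differentiable[OF t(1) this] obtain A B where
      "((\<lambda>(a, b). \<H> a b) has_derivative (\<lambda>(\<alpha>, \<beta>). A * \<alpha> + B * \<beta>)) (at (a, b))" by blast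
    from has_derivative_continuous[OF this] show "isCont (\<lambda>z. \<H> (fst z) (snd z)) (a, b)"
      by (simp add: case_prod_unfold)
  qed (use \<eta> in simp)
qed

text \<open>
  Intermediate value theorem: \<open>\<H>(a, j)\<close> is close to \<open>a\<close>.
\<close>

lemma H_locally_onto:
  assumes "d > 0"
  obtains \<delta> where "\<delta> > 0" "\<And>h j. \<bar>h\<bar> < \<delta> \<Longrightarrow> \<bar>j\<bar> < \<delta> \<Longrightarrow> \<exists>a. \<bar>a\<bar> < d \<and> \<H> a j = h"
proof -
  obtain C d1 where C: "C > 0" "d1 > 0" "\<And>a b. \<bar>a\<bar> < d1 \<Longrightarrow> \<bar>b\<bar> < d1 \<Longrightarrow> \<bar>\<H> a b - a\<bar> \<le> C * norm (a, b) ^ 2"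
    by (rule H_quadratic) (rule that; assumption)
  obtain d2 where d2: "d2 > 0" "\<And>a b. \<bar>a\<bar> < d2 \<Longrightarrow> \<bar>b\<bar> < d2 \<Longrightarrow> isCont (\<lambda>z. \<H> (fst z) (snd z)) (a, b)"
    by (rule H_continuous) (rule that; assumption)
  \<comment> \<open>For \<open>\<bar>a\<bar> = \<epsilon>\<close> the quadratic error is at most \<open>2 C \<epsilon>\<^sup>2 \<le> \<epsilon> / 2\<close>.\<close>
  define \<epsilon> where "\<epsilon> = min (min (d / 2) (d1 / 2)) (min (d2 / 2) (1 / (4 * C)))"
  have e: "\<epsilon> > 0" "\<epsilon> < d" "\<epsilon> < d1" "\<epsilon> < d2" using assms C d2 by (auto simp: \<epsilon>_def)
  have "\<epsilon> \<le> 1 / (4 * C)" by (simp add: \<epsilon>_def)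
  then have Ce: "C * (2 * \<epsilon>) \<le> 1/2" using C(1) by (simp add: field_simps)
  show ?thesis
  proof (rule that[of "\<epsilon> / 2"])
    fix h j :: real assume hj: "\<bar>h\<bar> < \<epsilon> / 2" "\<bar>j\<bar> < \<epsilon> / 2"
    have bound: "\<bar>\<H> a j - a\<bar> \<le> \<epsilon> / 2" if a: "\<bar>a\<bar> = \<epsilon>" for a
    proof -
      have "norm (a, j) ^ 2 = \<bar>a\<bar> * \<bar>a\<bar> + \<bar>j\<bar> * \<bar>j\<bar>" by (simp add: norm_Pair power2_eq_square)
      also have "\<dots> \<le> \<epsilon> * \<epsilon> + \<epsilon> * \<epsilon>" using a hj by (intro add_mono mult_mono) auto
      finally have "C * norm (a, j) ^ 2 \<le> (C * (2 * \<epsilon>)) * \<epsilon>"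
        using C(1) mult_left_mono[of "norm (a, j) ^ 2" "\<epsilon> * \<epsilon> + \<epsilon> * \<epsilon>" C] by (simp add: algebra_simps)
      also have "\<dots> \<le> 1/2 * \<epsilon>" using Ce e(1) by (intro mult_right_mono) auto
      finally show ?thesis using C(3)[of a j] a hj e by simp
    qed
    have "continuous_on {-\<epsilon>..\<epsilon>} (\<lambda>a. \<H> a j)"
    proof (rule continuous_at_imp_continuous_on, rule ballI)
      fix a assume "a \<in> {-\<epsilon>..\<epsilon>}"
      then have "\<bar>a\<bar> < d2" using e by auto
      then have "isCont (\<lambda>z. \<H> (fst z) (snd z)) (a, j)" using d2(2)[of a j] hj e by simp
      then have "isCont (\<lambda>a. (\<lambda>z. \<H> (fst z) (snd z)) (a, j)) a"
        by (intro isCont_o2[where f="\<lambda>a. (a, j)" and g="\<lambda>z. \<H> (fst z) (snd z)"] continuous_intros)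
      then show "isCont (\<lambda>a. \<H> a j) a" by simp
    qed
    moreover have "\<H> (-\<epsilon>) j \<le> h" "h \<le> \<H> \<epsilon> j"
      using abs_le_D2[OF bound[of \<epsilon>]] abs_le_D1[OF bound[of "-\<epsilon>"]] abs_ge_self[of h] abs_ge_minus_self[of h] hj e
      by linarith+
    ultimately obtain a where "-\<epsilon> \<le> a" "a \<le> \<epsilon>" "\<H> a j = h"
      using IVT'[of "\<lambda>a. \<H> a j" "-\<epsilon>" h \<epsilon>] e by auto
    then show "\<exists>a. \<bar>a\<bar> < d \<and> \<H> a j = h" using e by (intro exI[of _ a]) auto
  qed (use e in simp)
qed

text \<open>
  Put \<open>h = birkhoff_polynomial a b\<close> and compare with \<open>\<H> a b\<close>: the elliptic integral takes the value \<open>a\<close> at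
  \<open>\<H> a b\<close> and \<open>a\<close> up to sixth order at \<open>h\<close>, and its slope in between is at least \<open>1/2\<close>.  Any radius of the
  circle serves; \<open>\<rho> = 1\<close> is taken.
\<close>

lemma H_taylor:
  "(\<lambda>(a, b). \<H> a b - birkhoff_polynomial a b) \<in> O[nhds (0, 0)](\<lambda>z. norm z ^ 6)"
proof -
  define \<rho> :: real where "\<rho> = 1"
  have \<rho>: "0 < \<rho>" "\<rho> < 2" by (simp_all add: \<rho>_def)
  obtain d0 where d0: "d0 > 0" "cycle_small \<rho> d0" using ex_cycle_small[OF \<rho>] by blast
  obtain \<delta> where \<delta>: "\<delta> > 0" "\<delta> \<le> d0"
    "\<And>h j h' j'. \<bar>h\<bar> < \<delta> \<Longrightarrow> \<bar>j\<bar> < \<delta> \<Longrightarrow> \<bar>h'\<bar> < \<delta> \<Longrightarrow> \<bar>j'\<bar> < \<delta> \<Longrightarrow>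
      1/2 \<le> norm (cycle_slope_h \<rho> (h, j) (h', j'))"
    by (rule cycle_slope_h_near_1[OF \<rho> d0]) (rule that; assumption)
  obtain C d1 where C: "C > 0" "d1 > 0" "\<And>h j. \<bar>h\<bar> \<le> d1 \<Longrightarrow> \<bar>j\<bar> \<le> d1 \<Longrightarrow>
      norm (cycle_integral \<rho> h j - of_real (cycle_taylor h j)) \<le> C * (\<bar>h\<bar> + j\<^sup>2) ^ 6"
    by (rule cycle_integral_taylor[OF \<rho>]) (rule that; assumption)
  obtain d2 where d2: "d2 > 0" "\<And>a b. \<bar>a\<bar> < d2 \<Longrightarrow> \<bar>b\<bar> < d2 \<Longrightarrow> cycle_integral \<rho> (\<H> a b) b = of_real a"
    by (rule cycle_integral_normal_form[OF \<rho>]) (rule that; assumption)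
  let ?B = "\<lambda>z. birkhoff_polynomial (fst z) (snd z)"
  let ?f = "\<lambda>z. \<bar>?B z\<bar> + (snd z)\<^sup>2" and ?T = "\<lambda>z. cycle_taylor (?B z) (snd z) - fst z"
  have cH: "isCont (\<lambda>z. \<H> (fst z) (snd z)) (0, 0)"
    using has_derivative_continuous[OF H_has_derivative_0] by (simp add: case_prod_unfold)
  have "\<forall>\<^sub>F z in nhds (0, 0). \<bar>\<H> (fst z) (snd z)\<bar> < \<delta>"
    by (rule eventually_small_near_0[OF cH]) (use \<delta> H_0 in simp_all)
  moreover have "\<forall>\<^sub>F z in nhds (0 :: real, 0 :: real). \<bar>?B z\<bar> < min \<delta> d1"
    by (rule eventually_small_near_0) (unfold birkhoff_polynomial_def, intro continuous_intros, use \<delta> C in simp_all)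
  moreover have "\<forall>\<^sub>F z in nhds (0 :: real, 0 :: real). \<bar>fst z\<bar> < d2"
    by (rule eventually_small_near_0[where f=fst]) (use d2 in \<open>auto intro!: continuous_intros\<close>)
  moreover have "\<forall>\<^sub>F z in nhds (0 :: real, 0 :: real). \<bar>snd z\<bar> < min (min d2 d1) \<delta>"
    by (rule eventually_small_near_0[where f=snd]) (use d2 \<delta> C in \<open>auto intro!: continuous_intros\<close>)
  ultimately have "\<forall>\<^sub>F z in nhds (0, 0). norm (\<H> (fst z) (snd z) - ?B z) \<le> 2 * C * ?f z ^ 6 + 2 * \<bar>?T z\<bar>"
  proof eventually_elim
    case (elim z)
    let ?h = "\<H> (fst z) (snd z)" and ?b = "snd z"
    have sq: "(?h, ?b) \<in> square_of d0" "(?B z, ?b) \<in> square_of d0" using elim \<delta>(2) by (auto simp: square_of_def)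
    have "cycle_integral \<rho> (?B z) ?b - of_real (fst z) = of_real (?B z - ?h) * cycle_slope_h \<rho> (?h, ?b) (?B z, ?b)"
      using cycle_integral_diff[OF \<rho> d0 sq] d2(2)[of "fst z" ?b] elim by simp
    then have "norm (cycle_integral \<rho> (?B z) ?b - of_real (fst z)) = \<bar>?B z - ?h\<bar> * norm (cycle_slope_h \<rho> (?h, ?b) (?B z, ?b))"
      by (simp only: norm_mult norm_of_real)
    also have "\<dots> \<ge> \<bar>?B z - ?h\<bar> * (1/2)"
      using \<delta>(3)[of ?h ?b "?B z" ?b] elim by (intro mult_left_mono) auto
    finally have 1: "\<bar>?B z - ?h\<bar> \<le> 2 * norm (cycle_integral \<rho> (?B z) ?b - of_real (fst z))" by simp
    have "cycle_integral \<rho> (?B z) ?b - of_real (fst z) =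
        (cycle_integral \<rho> (?B z) ?b - of_real (cycle_taylor (?B z) ?b)) + of_real (?T z)" by simp
    then have "norm (cycle_integral \<rho> (?B z) ?b - of_real (fst z)) \<le> C * ?f z ^ 6 + \<bar>?T z\<bar>"
      using norm_triangle_ineq[of "cycle_integral \<rho> (?B z) ?b - of_real (cycle_taylor (?B z) ?b)" "of_real (?T z)"]
        C(3)[of "?B z" ?b] elim by (simp only: norm_of_real) simp
    with 1 show ?case by (simp add: abs_minus_commute)
  qed
  then have "(\<lambda>z. \<H> (fst z) (snd z) - ?B z) \<in> O[nhds (0, 0)](\<lambda>z. 2 * C * ?f z ^ 6 + 2 * \<bar>?T z\<bar>)"
    by (intro bigoI[of _ 1]) (auto elim!: eventually_mono)
  also have "(\<lambda>z. 2 * C * ?f z ^ 6 + 2 * \<bar>?T z\<bar>) \<in> O[nhds (0, 0)](\<lambda>z. norm z ^ 6)"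
  proof (rule sum_in_bigo)
    show "(\<lambda>z. 2 * C * ?f z ^ 6) \<in> O[nhds (0, 0)](\<lambda>z. norm z ^ 6)"
      using landau_o.big_power[OF birkhoff_polynomial_bigo, of 6] C(1) by simp
    show "(\<lambda>z. 2 * \<bar>?T z\<bar>) \<in> O[nhds (0, 0)](\<lambda>z. norm z ^ 6)"
      using cycle_taylor_birkhoff_polynomial by (simp add: sixth_order_def case_prod_unfold)
  qed
  finally show ?thesis by (simp add: case_prod_unfold)
qed

end

theorem theorem7:
  fixes \<H> :: "real \<Rightarrow> real \<Rightarrow> real"
    and w :: "real \<Rightarrow> real \<Rightarrow> complex \<Rightarrow> complex"
    and \<rho> :: real
  assumes "birkhoff_normal_form \<H>"
    and "0 < \<rho>" and "\<rho> < 2"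
    and "vanishing_cycle_branch \<rho> w"
  shows "((\<lambda>(a, b). \<H> a b -
            (a + 1/16 * (a^2 + 3 * b^2) - 1/256 * a * (a^2 + 9 * b^2)
             + 1/8192 * (5 * a^4 + 102 * a^2 * b^2 + 33 * b^4)
             - 3/262144 * a * (11 * a^4 + 410 * a^2 * b^2 + 271 * b^4)))
          \<in> O[nhds (0, 0)](\<lambda>z. norm z ^ 6)) \<and>
         (\<forall>\<^sub>F (h, j) in nhds (0, 0).
          elliptic_J1 \<rho> w h j \<in> \<real> \<and> \<H> (Re (elliptic_J1 \<rho> w h j)) j = h)"
proof -
  obtain U \<Phi> where "symplectic_coordinates U \<Phi>"
      "\<forall>x\<in>U. pendulum_Lz (\<Phi> x) = BNF_J2 x \<and> pendulum_H (\<Phi> x) = \<H> (BNF_J1 x) (BNF_J2 x)"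
      "(\<lambda>(a, b). \<H> a b - a) \<in> O[nhds (0, 0)](\<lambda>z. norm z ^ 2)"
    using assms(1) unfolding birkhoff_normal_form_def by blast
  then interpret birkhoff_coordinates \<H> U \<Phi> by unfold_locales auto
  obtain d where d: "d > 0" "\<And>a b. \<bar>a\<bar> < d \<Longrightarrow> \<bar>b\<bar> < d \<Longrightarrow> cycle_integral \<rho> (\<H> a b) b = of_real a"
    by (rule cycle_integral_normal_form[OF assms(2,3)]) (rule that; assumption)
  obtain \<delta> where \<delta>: "\<delta> > 0" "\<And>h j. \<bar>h\<bar> < \<delta> \<Longrightarrow> \<bar>j\<bar> < \<delta> \<Longrightarrow> \<exists>a. \<bar>a\<bar> < d \<and> \<H> a j = h"
    by (rule H_locally_onto[OF d(1)]) (rule that; assumption)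
  have "\<forall>\<^sub>F (h, j) in nhds (0, 0). elliptic_J1 \<rho> w h j \<in> \<real> \<and> \<H> (Re (elliptic_J1 \<rho> w h j)) j = h"
    using elliptic_J1_eq_cycle_integral[OF assms(2-4)] eventually_square[OF \<delta>(1)] eventually_square[OF d(1)]
  proof eventually_elim
    case (elim p)
    obtain h j where p: "p = (h, j)" by (cases p)
    obtain a where a: "\<bar>a\<bar> < d" "\<H> a j = h" using \<delta>(2)[of h j] elim by (auto simp: p)
    have "elliptic_J1 \<rho> w h j = cycle_integral \<rho> (\<H> a j) j" using elim a by (simp add: p)
    also have "\<dots> = of_real a" using d(2)[of a j] a elim by (simp add: p)
    finally show ?case using a by (simp add: p)
  qed
  moreover have "(\<lambda>(a, b). \<H> a b -
            (a + 1/16 * (a^2 + 3 * b^2) - 1/256 * a * (a^2 + 9 * b^2)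
             + 1/8192 * (5 * a^4 + 102 * a^2 * b^2 + 33 * b^4)
             - 3/262144 * a * (11 * a^4 + 410 * a^2 * b^2 + 271 * b^4)))
          \<in> O[nhds (0, 0)](\<lambda>z. norm z ^ 6)"
    using H_taylor unfolding birkhoff_polynomial_def .
  ultimately show ?thesis by blast
qed

end
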